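(* Let $(M,H)$ be an $n$-dimensional Carnot manifold, $a\in M$, and $(X_1,\ldots,X_n)$ an $H$-frame near $a$. Let $(x_1,\ldots,x_n)$ be privileged coordinates at $a$ adapted to $(X_1,\ldots,X_n)$. For $j=1,\ldots,n$, let $X_j^{(a)}$ be the model vector field of $X_j$ in these privileged coordinates. Set $\phi=\exp_{X^{(a)}}^{-1}$, where $\exp_{X^{(a)}}:\mathbb{R}^n\to\mathbb{R}^n$ is the diffeomorphism $x\mapsto \exp(x_1X_1^{(a)}+\cdots+x_nX_n^{(a)})$. (1) The map $\phi$ is the unique $w$-homogeneous polynomial diffeomorphism of $\mathbb{R}^n$ such that $\phi_*X_j^{(a)}=X_j^a$ for $j=1,\ldots,n$. (2) The coordinate change $x\mapsto\phi(x)$ is the unique $w$-homogeneous change of coordinates that gives rise to Carnot coordinates at $a$ adapted to $(X_1,\ldots,X_n)$.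
   Context: A Carnot manifold of step $r$ is a smooth manifold $M$ ($\dim M=n$) with a filtration by subbundles $H_1\subset\cdots\subset H_r=TM$ such that the Lie bracket of local sections of $H_w$ and $H_{w'}$ is a section of $H_{w+w'}$ whenever $w+w'\le r$. Its weights are $w_j=\min\{w:\ j\le \mathrm{rk}\,H_w\}$, $1\le j\le n$. An $H$-frame near $a$ is a tangent frame $(X_1,\ldots,X_n)$ near $a$ with each $X_j$ a section of $H_{w_j}$; then $[X_i,X_j]=\sum_{w_k\le w_i+w_j}L_{ij}^k X_k$ with smooth functions $L_{ij}^k$ near $a$. Dilations on $\mathbb{R}^n$: $\delta_t(x)=t\cdot x=(t^{w_1}x_1,\ldots,t^{w_n}x_n)$. A map $\phi:\mathbb{R}^n\to\mathbb{R}^n$ is $w$-homogeneous if $\phi(t\cdot x)=t\cdot\phi(x)$ for all $t\in\mathbb{R}$, $x\in\mathbb{R}^n$. For a vector field $X=\sum a_j(x)\partial_j$, $\delta_t^*X=\sum_j t^{-w_j}a_j(t\cdot x)\partial_j$. Order and privileged coordinates: for $I=(i_1,\ldots,i_k)$, $k\ge 0$, put $X_I=X_{i_1}\cdots X_{i_k}$, $\langle I\rangle=w_{i_1}+\cdots+w_{i_k}$. A smooth $f$ near $a$ has order $N$ at $a$ if $X_If(a)=0$ whenever $\langle I\rangle<N$ and $X_If(a)\ne0$ for some $I$ with $\langle I\rangle=N$. Local coordinates centered at $a$ are linearly adapted to the $H$-frame if $X_j(0)=\partial_j$ for all $j$; they are privileged coordinates at $a$ adapted to $(X_1,\ldots,X_n)$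 if moreover each coordinate $x_j$ has order $w_j$ at $a$. In privileged coordinates, $t^{w_j}\delta_t^*X_j$ converges as $t\to0$ ($C^\infty$ uniformly on compact sets) to a polynomial vector field $X_j^{(a)}$ on $\mathbb{R}^n$, the model vector field of $X_j$. For $X=\sum\xi_jX_j^{(a)}$ with $\xi_j\in\mathbb{R}$, the flow exists for all times, and $\exp(X)$ denotes the time-one flow of $X$ starting at $0$; the map $\exp_{X^{(a)}}$ is a $w$-homogeneous polynomial diffeomorphism of $\mathbb{R}^n$. The group $G(a)$ and the vector fields $X_j^a$: equip $\mathbb{R}^n$, with canonical basis $(\epsilon_j)$, with the nilpotent Lie bracket $[\epsilon_i,\epsilon_j]=\sum_{w_k=w_i+w_j}L_{ij}^k(a)\epsilon_k$ (zero if $w_i+w_j>r$). $G(a)$ is $\mathbb{R}^n$ with the Dynkin (Baker-Campbell-Hausdorff) product $x\cdot y=x+y+\frac12[x,y]+\frac1{12}([x,[x,y]]+[y,[y,x]])+\cdots$ (finite sum). $X_j^a$ is the left-invariant vector field on $G(a)$ with $X_j^a(0)=\partial_j$. Carnot coordinates at $a$ adapted to $(X_1,\ldots,X_n)$ are privileged coordinates at $a$ adapted to $(X_1,\ldots,X_n)$ in which the model vector field of $X_j$ is $X_j^a$ for every $j$. *)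

theory Defs
  imports "HOL-Analysis.Analysis" "HOL-Library.Function_Algebras"
begin

section \<open>Smooth maps between open subsets of Euclidean spaces\<close>

text \<open>Iterated directional derivative; the last entry of the list is differentiated first.\<close>

fun iter_deriv ::
    "'a list \<Rightarrow> ('a::real_normed_vector \<Rightarrow> 'b::real_normed_vector) \<Rightarrow> 'a \<Rightarrow> 'b" where
  "iter_deriv [] f = f"
| "iter_deriv (v # vs) f = (\<lambda>x. frechet_derivative (iter_deriv vs f) (at x) v)"

text \<open>Smoothness (of class \<open>C\<close>-infinity) on a set; only meant for open sets and for
  finite-dimensional domains.\<close>

definition smooth_on ::
    "'a set \<Rightarrow> ('a::real_normed_vector \<Rightarrow> 'b::real_normed_vector) \<Rightarrow> bool" where
  "smooth_on S f \<longleftrightarrow> (\<forall>vs. \<forall>x\<in>S. iter_deriv vs f differentiable (at x))"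

text \<open>Convergence of all derivatives, uniformly on compact sets.\<close>

definition smooth_limit ::
    "('c \<Rightarrow> 'a \<Rightarrow> 'b) \<Rightarrow> ('a::real_normed_vector \<Rightarrow> 'b::real_normed_vector) \<Rightarrow> 'c filter \<Rightarrow> bool"
  where
  "smooth_limit f g F \<longleftrightarrow> smooth_on UNIV g \<and>
     (\<forall>vs K. compact K \<longrightarrow> uniform_limit K (\<lambda>t. iter_deriv vs (f t)) (iter_deriv vs g) F)"

definition diffeomorphism :: "('a::real_normed_vector \<Rightarrow> 'a) \<Rightarrow> bool" where
  "diffeomorphism \<phi> \<longleftrightarrow> bij \<phi> \<and> smooth_on UNIV \<phi> \<and> smooth_on UNIV (inv \<phi>)"

definition pushforward ::
    "('a::real_normed_vector \<Rightarrow> 'a) \<Rightarrow> ('a \<Rightarrow> 'a) \<Rightarrow> 'a \<Rightarrow> 'a" where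
  "pushforward \<phi> Y = (\<lambda>y. frechet_derivative \<phi> (at (inv \<phi> y)) (Y (inv \<phi> y)))"

definition time_one_flow :: "('a::real_normed_vector \<Rightarrow> 'a) \<Rightarrow> 'a" where
  "time_one_flow Y = (THE y. \<exists>\<gamma>. \<gamma> 0 = 0 \<and> \<gamma> 1 = y \<and>
     (\<forall>t\<in>{0..1}. (\<gamma> has_vector_derivative Y (\<gamma> t)) (at t within {0..1::real})))"

definition exp_map :: "('n \<Rightarrow> real ^ 'n \<Rightarrow> real ^ 'n) \<Rightarrow> real ^ 'n \<Rightarrow> real ^ 'n::finite" where
  "exp_map Y = (\<lambda>x. time_one_flow (\<lambda>y. \<Sum>j\<in>UNIV. x $ j *\<^sub>R Y j y))"


section \<open>Smooth manifolds\<close>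

text \<open>
  A manifold is a Hausdorff second countable type \<open>'m\<close> with a smooth atlas modelled on
  \<open>real ^ 'n\<close>. A chart is a pair of a domain and a coordinate map, whose values
  off the domain are irrelevant. The index type \<open>'n\<close> is linearly ordered so that
  its elements stand for the indices \<open>1, \<dots>, n\<close>; the position of \<open>j\<close> is \<open>card {..j}\<close>.
\<close>

type_synonym ('m, 'n) chart = "'m set \<times> ('m \<Rightarrow> real ^ 'n)"

definition topological_chart ::
    "('m::topological_space, 'n::finite) chart \<Rightarrow> bool" where
  "topological_chart = (\<lambda>(U, \<kappa>). open U \<and> open (\<kappa> ` U) \<and>
     homeomorphism U (\<kappa> ` U) \<kappa> (inv_into U \<kappa>))"

definition compatible_charts ::
    "('m, 'n::finite) chart \<Rightarrow> ('m, 'n) chart \<Rightarrow> bool" where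
  "compatible_charts = (\<lambda>(U, \<kappa>) (V, \<mu>).
     smooth_on (\<kappa> ` (U \<inter> V)) (\<mu> \<circ> inv_into U \<kappa>) \<and>
     smooth_on (\<mu> ` (U \<inter> V)) (\<kappa> \<circ> inv_into V \<mu>))"

definition smooth_atlas ::
    "('m::{t2_space,second_countable_topology}, 'n::finite) chart set \<Rightarrow> bool" where
  "smooth_atlas A \<longleftrightarrow> (\<forall>c\<in>A. topological_chart c) \<and>
     (\<forall>c\<in>A. \<forall>d\<in>A. compatible_charts c d) \<and> (\<Union>c\<in>A. fst c) = UNIV"

text \<open>Membership in the maximal atlas.\<close>

definition smooth_chart ::
    "('m::topological_space, 'n::finite) chart set \<Rightarrow> ('m, 'n) chart \<Rightarrow> bool" where
  "smooth_chart A c \<longleftrightarrow> topological_chart c \<and> (\<forall>d\<in>A. compatible_charts c d)"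

definition smooth_fun_on ::
    "('m, 'n::finite) chart set \<Rightarrow> 'm set \<Rightarrow> ('m \<Rightarrow> real) \<Rightarrow> bool" where
  "smooth_fun_on A V f \<longleftrightarrow> (\<forall>(U, \<kappa>)\<in>A. smooth_on (\<kappa> ` (U \<inter> V)) (f \<circ> inv_into U \<kappa>))"

definition smooth_near ::
    "('m::topological_space, 'n::finite) chart set \<Rightarrow> 'm \<Rightarrow> ('m \<Rightarrow> real) \<Rightarrow> bool" where
  "smooth_near A p f \<longleftrightarrow> (\<exists>V. open V \<and> p \<in> V \<and> smooth_fun_on A V f)"


section \<open>Tangent vectors and vector fields\<close>

text \<open>
  Tangent vectors at \<open>p\<close> are derivations on germs at \<open>p\<close> of smooth functions. They are
  represented by functionals on all functions, set to \<open>0\<close> on the functions that are not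
  smooth near \<open>p\<close>, so that equality of functionals is equality of tangent vectors.
\<close>

type_synonym 'm tvec = "('m \<Rightarrow> real) \<Rightarrow> real"
type_synonym 'm vfield = "'m \<Rightarrow> 'm tvec"

definition tangent_space ::
    "('m::topological_space, 'n::finite) chart set \<Rightarrow> 'm \<Rightarrow> 'm tvec set" where
  "tangent_space A p = {v.
     (\<forall>f. \<not> smooth_near A p f \<longrightarrow> v f = 0) \<and>
     (\<forall>f g. smooth_near A p f \<and> smooth_near A p g \<and> (\<forall>\<^sub>F q in nhds p. f q = g q) \<longrightarrow> v f = v g) \<and>
     (\<forall>f g. smooth_near A p f \<and> smooth_near A p g \<longrightarrow> v (\<lambda>q. f q + g q) = v f + v g) \<and>
     (\<forall>f c. smooth_near A p f \<longrightarrow> v (\<lambda>q. c * f q) = c * v f) \<and>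
     (\<forall>f g. smooth_near A p f \<and> smooth_near A p g \<longrightarrow>
        v (\<lambda>q. f q * g q) = v f * g p + f p * v g)}"

definition tscale :: "real \<Rightarrow> 'm tvec \<Rightarrow> 'm tvec" where
  "tscale c v = (\<lambda>f. c * v f)"

text \<open>Provides \<open>tvec.span\<close>, \<open>tvec.dim\<close>, \<open>tvec.independent\<close>; addition of tangent vectors is
  the pointwise addition of functions.\<close>

global_interpretation tvec: vector_space tscale
  defines tspan = tvec.span and tdim = tvec.dim and tdependent = tvec.dependent
  by unfold_locales (auto simp: tscale_def fun_eq_iff algebra_simps)

text \<open>\<open>v\<^sub>i\<close>, \<open>i \<in> I\<close>, is a basis of \<open>E\<close>.\<close>

definition tbasis :: "'i set \<Rightarrow> ('i \<Rightarrow> 'm tvec) \<Rightarrow> 'm tvec set \<Rightarrow> bool" where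
  "tbasis I v E \<longleftrightarrow> inj_on v I \<and> \<not> tdependent (v ` I) \<and> tspan (v ` I) = E"

definition smooth_vfield ::
    "('m::topological_space, 'n::finite) chart set \<Rightarrow> 'm set \<Rightarrow> 'm vfield \<Rightarrow> bool" where
  "smooth_vfield A U X \<longleftrightarrow> (\<forall>p\<in>U. X p \<in> tangent_space A p) \<and>
     (\<forall>V f. open V \<and> V \<subseteq> U \<and> smooth_fun_on A V f \<longrightarrow> smooth_fun_on A V (\<lambda>p. X p f))"

text \<open>The case distinction keeps the bracket within the representation of tangent vectors:
  \<open>\<lambda>q. Y q f\<close> may be smooth near \<open>p\<close> although \<open>f\<close> is not.\<close>

definition lie_bracket ::
    "('m::topological_space, 'n::finite) chart set \<Rightarrow> 'm vfield \<Rightarrow> 'm vfield \<Rightarrow> 'm vfield" where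
  "lie_bracket A X Y = (\<lambda>p f. if smooth_near A p f
     then X p (\<lambda>q. Y q f) - Y p (\<lambda>q. X q f) else 0)"

definition coord_vfield ::
    "('m, 'n) chart \<Rightarrow> 'm vfield \<Rightarrow> real ^ 'n \<Rightarrow> real ^ 'n::finite" where
  "coord_vfield = (\<lambda>(U, \<kappa>) X x. \<chi> k. X (inv_into U \<kappa> x) (\<lambda>q. \<kappa> q $ k))"


section \<open>Carnot manifolds\<close>

definition subbundle ::
    "('m::topological_space, 'n::finite) chart set \<Rightarrow> ('m \<Rightarrow> 'm tvec set) \<Rightarrow> bool" where
  "subbundle A E \<longleftrightarrow> (\<exists>d. \<forall>p. \<exists>U Y. open U \<and> p \<in> U \<and>
     (\<forall>i<d. smooth_vfield A U (Y i)) \<and>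
     (\<forall>q\<in>U. tbasis {..<d::nat} (\<lambda>i. Y i q) (E q)))"

definition bundle_rank :: "('m \<Rightarrow> 'm tvec set) \<Rightarrow> nat" where
  "bundle_rank E = (THE d. \<forall>p. tdim (E p) = d)"

definition section_on ::
    "('m::topological_space, 'n::finite) chart set \<Rightarrow> ('m \<Rightarrow> 'm tvec set) \<Rightarrow> 'm set \<Rightarrow>
     'm vfield \<Rightarrow> bool" where
  "section_on A E U X \<longleftrightarrow> smooth_vfield A U X \<and> (\<forall>p\<in>U. X p \<in> E p)"

text \<open>\<open>H w\<close> is only meaningful for \<open>1 \<le> w \<le> r\<close>.\<close>

definition carnot_manifold ::
    "('m::{t2_space,second_countable_topology}, 'n::finite) chart set \<Rightarrow> nat \<Rightarrow>
     (nat \<Rightarrow> 'm \<Rightarrow> 'm tvec set) \<Rightarrow> bool" where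
  "carnot_manifold A r H \<longleftrightarrow> smooth_atlas A \<and> 1 \<le> r \<and>
     (\<forall>w\<in>{1..r}. subbundle A (H w)) \<and>
     (\<forall>w\<in>{1..<r}. \<forall>p. H w p \<subseteq> H (Suc w) p) \<and>
     (\<forall>p. H r p = tangent_space A p) \<and>
     (\<forall>w w' U X Y. 1 \<le> w \<and> 1 \<le> w' \<and> w + w' \<le> r \<and> open U \<and>
        section_on A (H w) U X \<and> section_on A (H w') U Y \<longrightarrow>
        section_on A (H (w + w')) U (lie_bracket A X Y))"

definition weights :: "(nat \<Rightarrow> 'm \<Rightarrow> 'm tvec set) \<Rightarrow> 'n::{finite,linorder} \<Rightarrow> nat" where
  "weights H j = (LEAST w. 1 \<le> w \<and> card {..j} \<le> bundle_rank (H w))"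

definition H_frame ::
    "('m::topological_space, 'n::{finite,linorder}) chart set \<Rightarrow>
     (nat \<Rightarrow> 'm \<Rightarrow> 'm tvec set) \<Rightarrow> 'm \<Rightarrow> 'm set \<Rightarrow> ('n \<Rightarrow> 'm vfield) \<Rightarrow> bool" where
  "H_frame A H a W X \<longleftrightarrow> open W \<and> a \<in> W \<and>
     (\<forall>j. section_on A (H (weights H j)) W (X j)) \<and>
     (\<forall>q\<in>W. tbasis UNIV (\<lambda>j. X j q) (tangent_space A q))"

text \<open>The coefficient \<open>L\<^sub>i\<^sub>j\<^sup>k(p)\<close> of \<open>X\<^sub>k\<close> in \<open>[X\<^sub>i, X\<^sub>j]\<close> at \<open>p\<close>.\<close>

definition structure_fun ::
    "('m::topological_space, 'n::finite) chart set \<Rightarrow> ('n \<Rightarrow> 'm vfield) \<Rightarrow>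
     'n \<Rightarrow> 'n \<Rightarrow> 'n \<Rightarrow> 'm \<Rightarrow> real" where
  "structure_fun A X i j k p =
     (THE c. lie_bracket A (X i) (X j) p = (\<Sum>l\<in>UNIV. tscale (c l) (X l p))) k"


section \<open>Privileged coordinates and model vector fields\<close>

definition dilation :: "('n \<Rightarrow> nat) \<Rightarrow> real \<Rightarrow> real ^ 'n \<Rightarrow> real ^ 'n::finite" where
  "dilation w t x = (\<chi> j. t ^ w j * x $ j)"

definition w_homogeneous :: "('n \<Rightarrow> nat) \<Rightarrow> (real ^ 'n \<Rightarrow> real ^ 'n::finite) \<Rightarrow> bool" where
  "w_homogeneous w \<phi> \<longleftrightarrow> (\<forall>t x. \<phi> (dilation w t x) = dilation w t (\<phi> x))"

definition dilation_pullback ::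
    "('n \<Rightarrow> nat) \<Rightarrow> real \<Rightarrow> (real ^ 'n \<Rightarrow> real ^ 'n) \<Rightarrow> real ^ 'n \<Rightarrow> real ^ 'n::finite" where
  "dilation_pullback w t Y x = (\<chi> j. inverse (t ^ w j) * Y (dilation w t x) $ j)"

text \<open>\<open>apply_word X [i\<^sub>1, \<dots>, i\<^sub>k] f\<close> is \<open>X\<^sub>I f\<close> for the multi-index \<open>I\<close>.\<close>

fun apply_word :: "('n \<Rightarrow> 'm vfield) \<Rightarrow> 'n list \<Rightarrow> ('m \<Rightarrow> real) \<Rightarrow> 'm \<Rightarrow> real" where
  "apply_word X [] f = f"
| "apply_word X (i # I) f = (\<lambda>p. X i p (apply_word X I f))"

definition has_order ::
    "('m::topological_space, 'n::finite) chart set \<Rightarrow> ('n \<Rightarrow> nat) \<Rightarrow> ('n \<Rightarrow> 'm vfield) \<Rightarrow>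
     'm \<Rightarrow> ('m \<Rightarrow> real) \<Rightarrow> nat \<Rightarrow> bool" where
  "has_order A w X a f N \<longleftrightarrow> smooth_near A a f \<and>
     (\<forall>I. sum_list (map w I) < N \<longrightarrow> apply_word X I f a = 0) \<and>
     (\<exists>I. sum_list (map w I) = N \<and> apply_word X I f a \<noteq> 0)"

definition privileged_coords ::
    "('m::topological_space, 'n::finite) chart set \<Rightarrow> ('n \<Rightarrow> nat) \<Rightarrow> ('n \<Rightarrow> 'm vfield) \<Rightarrow>
     'm \<Rightarrow> ('m, 'n) chart \<Rightarrow> bool" where
  "privileged_coords A w X a c \<longleftrightarrow> smooth_chart A c \<and> a \<in> fst c \<and> snd c a = 0 \<and>
     (\<forall>j. coord_vfield c (X j) 0 = axis j 1) \<and>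
     (\<forall>j. has_order A w X a (\<lambda>q. snd c q $ j) (w j))"

text \<open>The coordinate expression of a vector field only makes sense near \<open>0\<close>, but for every
  compact set \<open>K\<close> its pullback by a dilation is meaningful near \<open>K\<close> once \<open>t\<close> is small enough.\<close>

definition converges_to_model ::
    "('n \<Rightarrow> nat) \<Rightarrow> ('n \<Rightarrow> 'm vfield) \<Rightarrow> ('m, 'n) chart \<Rightarrow> 'n \<Rightarrow>
     (real ^ 'n \<Rightarrow> real ^ 'n::finite) \<Rightarrow> bool" where
  "converges_to_model w X c j Y \<longleftrightarrow>
     smooth_limit (\<lambda>t x. t ^ w j *\<^sub>R dilation_pullback w t (coord_vfield c (X j)) x) Y (at 0)"

definition model_vfield ::
    "('n \<Rightarrow> nat) \<Rightarrow> ('n \<Rightarrow> 'm vfield) \<Rightarrow> ('m, 'n) chart \<Rightarrow> 'n \<Rightarrow>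
     real ^ 'n \<Rightarrow> real ^ 'n::finite" where
  "model_vfield w X c j = (THE Y. converges_to_model w X c j Y)"


section \<open>The group \<open>G(a)\<close> and Carnot coordinates\<close>

definition model_bracket ::
    "('m::topological_space, 'n::finite) chart set \<Rightarrow> ('n \<Rightarrow> nat) \<Rightarrow> ('n \<Rightarrow> 'm vfield) \<Rightarrow> 'm \<Rightarrow>
     real ^ 'n \<Rightarrow> real ^ 'n \<Rightarrow> real ^ 'n" where
  "model_bracket A w X a x y = (\<chi> k. \<Sum>(i, j) | w k = w i + w j.
     x $ i * y $ j * structure_fun A X i j k a)"

text \<open>\<open>[v\<^sub>1, [v\<^sub>2, [\<dots>, [v\<^sub>m\<^sub>-\<^sub>1, v\<^sub>m]\<dots>]]]\<close>\<close>

fun nested_bracket :: "('v \<Rightarrow> 'v \<Rightarrow> 'v) \<Rightarrow> 'v list \<Rightarrow> 'v::zero" where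
  "nested_bracket br [] = 0"
| "nested_bracket br [v] = v"
| "nested_bracket br (u # v # vs) = br u (nested_bracket br (v # vs))"

text \<open>
  Dynkin's formula for a bracket all of whose iterates of length greater than \<open>r\<close> vanish:
  the sum, over all \<open>k \<ge> 1\<close> and all \<open>(p\<^sub>1, q\<^sub>1), \<dots>, (p\<^sub>k, q\<^sub>k)\<close> with \<open>p\<^sub>i + q\<^sub>i \<ge> 1\<close>, of
  \<open>(-1)\<^sup>k\<^sup>-\<^sup>1 / k \<cdot> [x\<^sup>p\<^sup>1 y\<^sup>q\<^sup>1 \<dots> x\<^sup>p\<^sup>k y\<^sup>q\<^sup>k] / ((\<Sum>p\<^sub>i + q\<^sub>i) \<cdot> \<Prod>p\<^sub>i! q\<^sub>i!)\<close>, where the bracket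
  is nested to the right.
\<close>

definition dynkin_product ::
    "('v \<Rightarrow> 'v \<Rightarrow> 'v) \<Rightarrow> nat \<Rightarrow> 'v \<Rightarrow> 'v \<Rightarrow> 'v::real_vector" where
  "dynkin_product br r x y =
     (\<Sum>ps | ps \<noteq> [] \<and> (\<forall>(p, q)\<in>set ps. 1 \<le> p + q) \<and> (\<Sum>(p, q)\<leftarrow>ps. p + q) \<le> r.
        ((- 1) ^ (length ps - 1) /
          (real (length ps) * real (\<Sum>(p, q)\<leftarrow>ps. p + q) * (\<Prod>(p, q)\<leftarrow>ps. fact p * fact q))) *\<^sub>R
        nested_bracket br (concat (map (\<lambda>(p, q). replicate p x @ replicate q y) ps)))"

text \<open>The left-invariant vector field on \<open>G(a)\<close> with value \<open>\<partial>\<^sub>j\<close> at the unit \<open>0\<close>: at \<open>x\<close> it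
  is the image of \<open>\<partial>\<^sub>j\<close> under the differential at \<open>0\<close> of the left translation by \<open>x\<close>.\<close>

definition left_invariant_vfield ::
    "('m::topological_space, 'n::finite) chart set \<Rightarrow> ('n \<Rightarrow> nat) \<Rightarrow> nat \<Rightarrow> ('n \<Rightarrow> 'm vfield) \<Rightarrow>
     'm \<Rightarrow> 'n \<Rightarrow> real ^ 'n \<Rightarrow> real ^ 'n" where
  "left_invariant_vfield A w r X a j = (\<lambda>x.
     frechet_derivative (\<lambda>y. dynkin_product (model_bracket A w X a) r x y) (at 0) (axis j 1))"

definition carnot_coords ::
    "('m::topological_space, 'n::finite) chart set \<Rightarrow> ('n \<Rightarrow> nat) \<Rightarrow> nat \<Rightarrow> ('n \<Rightarrow> 'm vfield) \<Rightarrow>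
     'm \<Rightarrow> ('m, 'n) chart \<Rightarrow> bool" where
  "carnot_coords A w r X a c \<longleftrightarrow> privileged_coords A w X a c \<and>
     (\<forall>j. converges_to_model w X c j (left_invariant_vfield A w r X a j))"

end

theory Submission
  imports Defs
begin

text \<open>
  Write \<open>Y\<^sub>j\<close> for the coordinate expressions of the \<open>X\<^sub>j\<close>. By privilegedness, the rescaled fields
  \<open>t\<^bsup>w\<^sub>j\<^esup> \<delta>\<^sub>t\<^sup>* Y\<^sub>j\<close> extend smoothly across \<open>t = 0\<close>; their values \<open>Z\<^sub>j\<close> at \<open>t = 0\<close> are homogeneous, hence
  polynomial and triangular with respect to the weights, and letting \<open>t \<rightarrow> 0\<close> in the structure equations
  yields \<open>[Z\<^sub>i, Z\<^sub>j] = \<Sum> L\<^sub>i\<^sub>j\<^sup>k(a) Z\<^sub>k\<close> over \<open>w\<^sub>k = w\<^sub>i + w\<^sub>j\<close>. Triangularity makes the exponential map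
  \<open>E\<close> of the \<open>Z\<^sub>j\<close> a homogeneous polynomial diffeomorphism, and a linear differential equation along the
  flow gives \<open>DE(x) u = Z\<^sub>v(E x)\<close> with \<open>v = (1 - exp(- ad x)) / ad x \<cdot> u\<close>. The part of the Dynkin product
  \<open>x \<cdot> y\<close> that is linear in \<open>y\<close> is \<open>ad x / (1 - exp(- ad x)) \<cdot> y\<close>, so \<open>E\<^sub>* X\<^sub>j\<^sup>a = Z\<^sub>j\<close>. Conversely, if \<open>\<psi>\<close> maps
  each \<open>Z\<^sub>j\<close> to \<open>X\<^sub>j\<^sup>a\<close>, then \<open>E \<circ> \<psi>\<close> preserves the integral curves of the \<open>Z\<^sub>v\<close> through \<open>0\<close>, which fill
  the space, so \<open>\<psi> = E\<^sup>-\<^sup>1\<close>. A homogeneous \<open>\<psi>\<close> giving Carnot coordinates has this property, as is seen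
  by rescaling and letting \<open>t \<rightarrow> 0\<close>.
\<close>

section \<open>Smooth maps\<close>

text \<open>The order of a function is defined through derivatives along words in the
  \<open>X j\<close>, whereas the model fields are limits under dilations. The bridge is the
  equivalence of \<open>vanish N f\<close>, the order condition, with \<open>divisible N f\<close>,
  the factorization of \<open>f (dilation w t x)\<close> as \<open>t ^ N * G (t, x)\<close>. The
  factor \<open>G\<close> is smooth jointly in \<open>(t, x)\<close>, also across
  \<open>t = 0\<close>: convergence of all derivatives on compact sets then reduces to uniform
  continuity, and identities at \<open>t = 0\<close> are limits of identities for
  \<open>t \<noteq> 0\<close>. One direction produces the model fields; the other shows that the
  components of the homogeneous map \<open>Log\<close> have the orders required of privileged
  coordinates. The obstacle in the first direction is a circularity: dividing \<open>f\<close> uses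
  the leading parts of the fields, which come from dividing their coefficients. Induction on
  \<open>N\<close> breaks it, because a coefficient that cannot yet be divided far enough
  contributes only terms that vanish at \<open>t = 0\<close>. In the second claim the coordinate
  changes are known to be smooth only near 0; homogeneity spreads differentiability to the whole
  space.\<close>

abbreviation FD ::
    "('a::real_normed_vector \<Rightarrow> 'b::real_normed_vector) \<Rightarrow> 'a \<Rightarrow> 'a \<Rightarrow> 'b" where
  "FD f x \<equiv> frechet_derivative f (at x)"

lemma FD_eq: "(f has_derivative f') (at x) \<Longrightarrow> FD f x = f'"
  using frechet_derivative_at by blast

lemma FD_cong:
  assumes "open S" "x \<in> S" "\<And>y. y \<in> S \<Longrightarrow> f y = g y"
  shows "FD f x = FD g x"
proof -
  have "(f has_derivative f') (at x) \<longleftrightarrow> (g has_derivative f') (at x)" for f'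
    using has_derivative_transform_within_open[of _ f' x UNIV S] assms by metis
  then show ?thesis by (simp add: frechet_derivative_def)
qed

lemma differentiable_cong_open:
  assumes "open S" "x \<in> S" "\<And>y. y \<in> S \<Longrightarrow> f y = g y"
  shows "f differentiable (at x) \<longleftrightarrow> g differentiable (at x)"
proof -
  have "(f has_derivative f') (at x) \<longleftrightarrow> (g has_derivative f') (at x)" for f'
    using has_derivative_transform_within_open[of _ f' x UNIV S] assms by metis
  then show ?thesis by (simp add: differentiable_def)
qed

text \<open>In contrast to \<^const>\<open>iter_deriv\<close>, the outer step of the recursion differentiates the given function
  itself, so that closure properties follow by induction on the order.\<close>

fun cdiff :: "nat \<Rightarrow> 'a set \<Rightarrow> ('a::real_normed_vector \<Rightarrow> 'b::real_normed_vector) \<Rightarrow> bool" where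
  "cdiff 0 S f = (\<forall>x\<in>S. f differentiable (at x))"
| "cdiff (Suc n) S f = ((\<forall>x\<in>S. f differentiable (at x)) \<and> (\<forall>v. cdiff n S (\<lambda>x. FD f x v)))"

lemma iter_deriv_snoc: "iter_deriv (vs @ [v]) f = iter_deriv vs (\<lambda>x. FD f x v)"
  by (induction vs) auto

text \<open>The last entry of the list is differentiated first, so splitting lists at their end
  matches the recursion of \<open>cdiff\<close>, which passes from \<open>f\<close> to a directional
  derivative of \<open>f\<close>.\<close>

lemma cdiff_iff: "cdiff n S f \<longleftrightarrow>
  (\<forall>vs. length vs \<le> n \<longrightarrow> (\<forall>x\<in>S. iter_deriv vs f differentiable (at x)))"
proof (induction n arbitrary: f)
  case 0
  then show ?case by simp
next
  case (Suc n)
  have "(\<forall>vs. length vs \<le> Suc n \<longrightarrow> (\<forall>x\<in>S. iter_deriv vs f differentiable (at x))) \<longleftrightarrow>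
    (\<forall>x\<in>S. f differentiable (at x)) \<and>
    (\<forall>vs v. length vs \<le> n \<longrightarrow> (\<forall>x\<in>S. iter_deriv (vs @ [v]) f differentiable (at x)))"
    (is "?L \<longleftrightarrow> ?R")
  proof
    assume ?L
    then show ?R by (metis iter_deriv.simps(1) le0 length_append_singleton list.size(3) not_less_eq_eq)
  next
    assume R: ?R
    show ?L
    proof (intro allI impI)
      fix vs :: "'a list" assume "length vs \<le> Suc n"
      with R show "\<forall>x\<in>S. iter_deriv vs f differentiable (at x)"
        by (cases vs rule: rev_cases) auto
    qed
  qed
  then show ?case using Suc.IH by (auto simp: iter_deriv_snoc)
qed

lemma smooth_on_iff_cdiff: "smooth_on S f \<longleftrightarrow> (\<forall>n. cdiff n S f)"
  unfolding cdiff_iff smooth_on_def by auto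

lemma cdiff_Suc_D: "cdiff (Suc n) S f \<Longrightarrow> cdiff n S f"
  by (simp add: cdiff_iff)

lemma cdiff_differentiable: "cdiff n S f \<Longrightarrow> x \<in> S \<Longrightarrow> f differentiable (at x)"
  by (cases n) auto

lemma smooth_on_differentiable: "smooth_on S f \<Longrightarrow> x \<in> S \<Longrightarrow> f differentiable (at x)"
  using cdiff_differentiable smooth_on_iff_cdiff by blast

lemma smooth_on_has_derivative: "smooth_on S f \<Longrightarrow> x \<in> S \<Longrightarrow> (f has_derivative FD f x) (at x)"
  using frechet_derivative_works smooth_on_differentiable by blast

lemma smooth_on_FD: "smooth_on S f \<Longrightarrow> smooth_on S (\<lambda>x. FD f x v)"
  unfolding smooth_on_iff_cdiff using cdiff.simps(2) by blast

lemma smooth_on_continuous: "smooth_on S f \<Longrightarrow> continuous_on S f"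
  by (meson continuous_at_imp_continuous_on differentiable_imp_continuous_within
      smooth_on_differentiable)

lemma smooth_on_subset: "smooth_on S f \<Longrightarrow> T \<subseteq> S \<Longrightarrow> smooth_on T f"
  by (auto simp: smooth_on_def)

lemma cdiff_cong:
  assumes "open S" "\<And>x. x \<in> S \<Longrightarrow> f x = g x"
  shows "cdiff n S f \<longleftrightarrow> cdiff n S g"
  using assms(2)
proof (induction n arbitrary: f g)
  case 0
  have "f differentiable (at x) \<longleftrightarrow> g differentiable (at x)" if "x \<in> S" for x
    using differentiable_cong_open[OF assms(1) that 0] by simp
  then show ?case by simp
next
  case (Suc n)
  have "FD f x v = FD g x v" if "x \<in> S" for x v
    using FD_cong[OF assms(1) that Suc.prems] by simp
  then have "cdiff n S (\<lambda>x. FD f x v) \<longleftrightarrow> cdiff n S (\<lambda>x. FD g x v)" for v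
    by (rule Suc.IH)
  moreover have "f differentiable (at x) \<longleftrightarrow> g differentiable (at x)" if "x \<in> S" for x
    using differentiable_cong_open[OF assms(1) that Suc.prems] by simp
  ultimately show ?case by simp
qed

lemma smooth_on_cong:
  assumes "open S" "\<And>x. x \<in> S \<Longrightarrow> f x = g x"
  shows "smooth_on S f \<longleftrightarrow> smooth_on S g"
  unfolding smooth_on_iff_cdiff using cdiff_cong[of S f g] assms by auto

lemma smooth_on_local:
  assumes "\<And>x. x \<in> S \<Longrightarrow> \<exists>T. x \<in> T \<and> smooth_on T f"
  shows "smooth_on S f"
  using assms unfolding smooth_on_def by blast

lemma cdiff_bounded_linear:
  assumes "bounded_linear L" "open S" "cdiff n S f"
  shows "cdiff n S (\<lambda>x. L (f x))"
  using assms(3)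
proof (induction n arbitrary: f)
  case 0
  then show ?case using bounded_linear.has_derivative[OF assms(1)]
    by (simp add: differentiable_def) blast
next
  case (Suc n)
  have d: "((\<lambda>x. L (f x)) has_derivative (\<lambda>v. L (FD f x v))) (at x)" if "x \<in> S" for x
    using Suc.prems that by (intro bounded_linear.has_derivative[OF assms(1)])
      (simp add: frechet_derivative_works)
  have "cdiff n S (\<lambda>x. FD (\<lambda>x. L (f x)) x v)" for v
  proof -
    have "cdiff n S (\<lambda>x. L (FD f x v))" using Suc by simp
    then show ?thesis using FD_eq[OF d]
      by (subst cdiff_cong[OF assms(2), where g="\<lambda>x. L (FD f x v)"]) auto
  qed
  then show ?case using d by (auto intro: differentiableI)
qed

lemma smooth_on_bounded_linear:
  "bounded_linear L \<Longrightarrow> open S \<Longrightarrow> smooth_on S f \<Longrightarrow> smooth_on S (\<lambda>x. L (f x))"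
  unfolding smooth_on_iff_cdiff using cdiff_bounded_linear by blast

lemma cdiff_add:
  assumes "open S" "cdiff n S f" "cdiff n S g"
  shows "cdiff n S (\<lambda>x. f x + g x)"
  using assms(2,3)
proof (induction n arbitrary: f g)
  case 0
  then show ?case by simp
next
  case (Suc n)
  have d: "((\<lambda>x. f x + g x) has_derivative (\<lambda>v. FD f x v + FD g x v)) (at x)" if "x \<in> S" for x
    using Suc.prems that by (intro has_derivative_add) (simp_all add: frechet_derivative_works)
  have "cdiff n S (\<lambda>x. FD (\<lambda>x. f x + g x) x v)" for v
  proof -
    have "cdiff n S (\<lambda>x. FD f x v + FD g x v)" using Suc by simp
    then show ?thesis using FD_eq[OF d]
      by (subst cdiff_cong[OF assms(1), where g="\<lambda>x. FD f x v + FD g x v"]) auto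
  qed
  then show ?case using d by (auto intro: differentiableI)
qed

lemma cdiff_const: "cdiff n S (\<lambda>x. c)"
  by (induction n arbitrary: c) auto

lemma cdiff_sum:
  assumes "open S" "\<And>i. i \<in> I \<Longrightarrow> cdiff n S (f i)"
  shows "cdiff n S (\<lambda>x. \<Sum>i\<in>I. f i x)"
  using assms(2)
  by (induction I rule: infinite_finite_induct) (auto intro: cdiff_const cdiff_add[OF assms(1)])

lemma cdiff_bilinear:
  assumes "bounded_bilinear h" "open S" "cdiff n S f" "cdiff n S g"
  shows "cdiff n S (\<lambda>x. h (f x) (g x))"
  using assms(3,4)
proof (induction n arbitrary: f g)
  case 0
  then show ?case using bounded_bilinear.FDERIV[OF assms(1)] unfolding differentiable_def
    by (simp add: differentiable_def) blast
next
  case (Suc n)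
  have d: "((\<lambda>x. h (f x) (g x)) has_derivative (\<lambda>v. h (f x) (FD g x v) + h (FD f x v) (g x))) (at x)"
    if "x \<in> S" for x
    using Suc.prems that by (intro bounded_bilinear.FDERIV[OF assms(1)])
      (simp_all add: frechet_derivative_works)
  have "cdiff n S (\<lambda>x. FD (\<lambda>x. h (f x) (g x)) x v)" for v
  proof -
    have "cdiff n S (\<lambda>x. h (f x) (FD g x v) + h (FD f x v) (g x))"
      using Suc.prems cdiff_Suc_D[OF Suc.prems(1)] cdiff_Suc_D[OF Suc.prems(2)]
      by (intro cdiff_add[OF assms(2)] Suc.IH) auto
    then show ?thesis using FD_eq[OF d]
      by (subst cdiff_cong[OF assms(2), where g="\<lambda>x. h (f x) (FD g x v) + h (FD f x v) (g x)"])
        auto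
  qed
  then show ?case using d by (auto intro: differentiableI)
qed

text \<open>In the derivative \<open>FD g (f x) (FD f x v)\<close> base point and direction both
  vary. Expanding the direction in \<open>Basis\<close> leaves composites of \<open>FD g _ b\<close>
  with the same \<open>f\<close>, to which the induction hypothesis applies, times coefficients
  depending on \<open>f\<close> alone. Taking \<open>f\<close> smooth to all orders keeps it fixed
  during the induction.\<close>

lemma cdiff_compose:
  fixes f :: "'a::real_normed_vector \<Rightarrow> 'b::euclidean_space" and g :: "'b \<Rightarrow> 'c::real_normed_vector"
  assumes "open S" "open T" "smooth_on S f" "f ` S \<subseteq> T" "cdiff n T g"
  shows "cdiff n S (\<lambda>x. g (f x))"
  using assms(5)
proof (induction n arbitrary: g)
  case 0
  have "(\<lambda>x. g (f x)) differentiable (at x)" if "x \<in> S" for x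
    using differentiable_chain_at[of f x g] 0 assms that
    by (auto simp: o_def smooth_on_differentiable)
  then show ?case by simp
next
  case (Suc n)
  have d: "((\<lambda>x. g (f x)) has_derivative (\<lambda>v. FD g (f x) (FD f x v))) (at x)" if "x \<in> S" for x
  proof -
    have "(g has_derivative FD g (f x)) (at (f x))"
      using Suc.prems assms(4) that by (auto simp: frechet_derivative_works[symmetric])
    then show ?thesis
      using diff_chain_at[OF smooth_on_has_derivative[OF assms(3) that]] by (auto simp: o_def)
  qed
  have e: "FD (\<lambda>x. g (f x)) x v = (\<Sum>b\<in>Basis. (FD f x v \<bullet> b) *\<^sub>R FD g (f x) b)" if "x \<in> S" for x v
  proof -
    have lin: "linear (FD g (f x))"
      using Suc.prems assms(4) that by (auto intro!: linear_frechet_derivative)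
    have "FD g (f x) (FD f x v) = FD g (f x) (\<Sum>b\<in>Basis. (FD f x v \<bullet> b) *\<^sub>R b)"
      by (simp add: euclidean_representation)
    also have "\<dots> = (\<Sum>b\<in>Basis. (FD f x v \<bullet> b) *\<^sub>R FD g (f x) b)"
      using lin by (simp add: linear_sum linear_scale)
    finally show ?thesis using FD_eq[OF d[OF that]] by simp
  qed
  have "cdiff n S (\<lambda>x. FD (\<lambda>x. g (f x)) x v)" for v
  proof -
    have "cdiff n S (\<lambda>x. \<Sum>b\<in>Basis. (FD f x v \<bullet> b) *\<^sub>R FD g (f x) b)"
    proof (intro cdiff_sum[OF assms(1)] cdiff_bilinear[OF bounded_bilinear_scaleR assms(1)])
      fix b :: 'b assume "b \<in> Basis"
      show "cdiff n S (\<lambda>x. FD f x v \<bullet> b)"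
        using smooth_on_FD[OF assms(3)] unfolding smooth_on_iff_cdiff
        by (intro cdiff_bounded_linear[OF bounded_linear_inner_left assms(1)]) auto
      show "cdiff n S (\<lambda>x. FD g (f x) b)" using Suc by auto
    qed
    then show ?thesis
      by (subst cdiff_cong[OF assms(1) e])
  qed
  then show ?case using d by (auto intro: differentiableI)
qed

lemma smooth_on_compose:
  fixes f :: "'a::real_normed_vector \<Rightarrow> 'b::euclidean_space" and g :: "'b \<Rightarrow> 'c::real_normed_vector"
  assumes "open S" "open T" "smooth_on S f" "smooth_on T g" "\<And>x. x \<in> S \<Longrightarrow> f x \<in> T"
  shows "smooth_on S (\<lambda>x. g (f x))"
proof -
  have "cdiff n S (\<lambda>x. g (f x))" for n
    using assms smooth_on_iff_cdiff[of T g] by (intro cdiff_compose[of S T f]) auto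
  then show ?thesis unfolding smooth_on_iff_cdiff by blast
qed

lemma smooth_on_const: "smooth_on S (\<lambda>x. c)"
  using cdiff_const smooth_on_iff_cdiff by blast

lemma smooth_on_linear: "bounded_linear L \<Longrightarrow> smooth_on S L"
proof -
  assume L: "bounded_linear L"
  have "cdiff n S L" for n
  proof (cases n)
    case 0
    then show ?thesis using bounded_linear_imp_differentiable[OF L] by simp
  next
    case (Suc k)
    have "FD L x = L" for x using FD_eq[OF bounded_linear_imp_has_derivative[OF L]] .
    then show ?thesis using Suc bounded_linear_imp_differentiable[OF L] by (simp add: cdiff_const)
  qed
  then show ?thesis using smooth_on_iff_cdiff by blast
qed

lemma smooth_on_id: "smooth_on S (\<lambda>x. x)"
  using smooth_on_linear[OF bounded_linear_ident] .

lemma smooth_on_add: "open S \<Longrightarrow> smooth_on S f \<Longrightarrow> smooth_on S g \<Longrightarrow> smooth_on S (\<lambda>x. f x + g x)"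
  unfolding smooth_on_iff_cdiff using cdiff_add by blast

lemma smooth_on_sum:
  "open S \<Longrightarrow> (\<And>i. i \<in> I \<Longrightarrow> smooth_on S (f i)) \<Longrightarrow> smooth_on S (\<lambda>x. \<Sum>i\<in>I. f i x)"
  unfolding smooth_on_iff_cdiff by (auto intro!: cdiff_sum)

lemma smooth_on_bilinear:
  "bounded_bilinear h \<Longrightarrow> open S \<Longrightarrow> smooth_on S f \<Longrightarrow> smooth_on S g \<Longrightarrow>
    smooth_on S (\<lambda>x. h (f x) (g x))"
  unfolding smooth_on_iff_cdiff using cdiff_bilinear by blast

lemmas smooth_on_scaleR = smooth_on_bilinear[OF bounded_bilinear_scaleR]
lemmas smooth_on_mult = smooth_on_bilinear[OF bounded_bilinear_mult]

lemma smooth_on_minus: "open S \<Longrightarrow> smooth_on S f \<Longrightarrow> smooth_on S (\<lambda>x. - f x)"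
  by (rule smooth_on_bounded_linear[OF bounded_linear_minus[OF bounded_linear_ident]])

lemma smooth_on_diff:
  assumes "open S" "smooth_on S f" "smooth_on S g" shows "smooth_on S (\<lambda>x. f x - g x)"
  using smooth_on_add[OF assms(1,2) smooth_on_minus[OF assms(1,3)]] by simp

lemma smooth_on_power:
  fixes f :: "_ \<Rightarrow> real"
  shows "open S \<Longrightarrow> smooth_on S f \<Longrightarrow> smooth_on S (\<lambda>x. f x ^ n)"
  by (induction n) (auto intro: smooth_on_const smooth_on_mult)

lemma smooth_on_fst: "open S \<Longrightarrow> smooth_on S f \<Longrightarrow> smooth_on S (\<lambda>x. fst (f x))"
  by (rule smooth_on_bounded_linear[OF bounded_linear_fst])

lemma smooth_on_snd: "open S \<Longrightarrow> smooth_on S f \<Longrightarrow> smooth_on S (\<lambda>x. snd (f x))"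
  by (rule smooth_on_bounded_linear[OF bounded_linear_snd])

lemma smooth_on_vec_nth: "open S \<Longrightarrow> smooth_on S f \<Longrightarrow> smooth_on S (\<lambda>x. f x $ i)"
  by (rule smooth_on_bounded_linear[OF bounded_linear_vec_nth])

lemma smooth_on_Pair:
  assumes "open S" "smooth_on S f" "smooth_on S g"
  shows "smooth_on S (\<lambda>x. (f x, g x))"
proof -
  have "bounded_linear (\<lambda>y::'b. (y, 0::'c))" "bounded_linear (\<lambda>y::'c. (0::'b, y))"
    by (auto intro!: bounded_linear_Pair bounded_linear_ident bounded_linear_zero)
  then have "smooth_on S (\<lambda>x. (f x, 0::'c) + (0::'b, g x))"
    using assms by (intro smooth_on_add smooth_on_bounded_linear[where L="\<lambda>y::'b. (y, 0::'c)"]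
       smooth_on_bounded_linear[where L="\<lambda>y::'c. (0::'b, y)"])
  then show ?thesis by simp
qed

lemma vec_eq_sum_axis: "(x :: real ^ 'n) = (\<Sum>i\<in>UNIV. x $ i *\<^sub>R axis i 1)"
  by (simp add: vec_eq_iff axis_def if_distrib cong: if_cong)

lemma smooth_on_vec_iff:
  fixes f :: "_ \<Rightarrow> real ^ 'n"
  assumes "open S"
  shows "smooth_on S f \<longleftrightarrow> (\<forall>i. smooth_on S (\<lambda>x. f x $ i))"
proof
  assume "\<forall>i. smooth_on S (\<lambda>x. f x $ i)"
  then have "smooth_on S (\<lambda>x. \<Sum>i\<in>UNIV. f x $ i *\<^sub>R axis i 1)"
    using assms by (intro smooth_on_sum smooth_on_scaleR smooth_on_const) auto
  moreover have "(\<lambda>x. \<Sum>i\<in>UNIV. f x $ i *\<^sub>R axis i 1) = f"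
    by (rule ext) (rule vec_eq_sum_axis[symmetric])
  ultimately show "smooth_on S f" by (rule back_subst)
qed (auto intro: smooth_on_vec_nth[OF assms])

lemma smooth_on_vec_lambda:
  fixes f :: "_ \<Rightarrow> _ \<Rightarrow> real"
  assumes "open S" "\<And>i. smooth_on S (f i)"
  shows "smooth_on S (\<lambda>x. \<chi> i. f i x)"
  using assms by (subst smooth_on_vec_iff) auto

lemma FD_linear_sum:
  fixes f :: "real ^ 'n \<Rightarrow> 'b::real_normed_vector"
  assumes "f differentiable (at x)"
  shows "FD f x v = (\<Sum>k\<in>UNIV. v $ k *\<^sub>R FD f x (axis k 1))"
proof -
  note lin = linear_frechet_derivative[OF assms]
  have "FD f x v = FD f x (\<Sum>k\<in>UNIV. v $ k *\<^sub>R axis k 1)" by (simp add: vec_eq_sum_axis[symmetric])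
  then show ?thesis using lin by (simp add: linear_sum linear_scale)
qed

lemma FD_vec_nth: 
  fixes f :: "'a::real_normed_vector \<Rightarrow> real ^ 'n"
  assumes "f differentiable (at x)"
  shows "FD (\<lambda>x. f x $ i) x v = FD f x v $ i"
  using FD_eq[OF bounded_linear.has_derivative[OF bounded_linear_vec_nth
    assms[unfolded frechet_derivative_works]]] by simp

lemma smooth_on_FD_apply:
  fixes f :: "real ^ 'n \<Rightarrow> 'b::real_normed_vector"
  assumes "open S" "smooth_on S f" "smooth_on S v"
  shows "smooth_on S (\<lambda>x. FD f x (v x))"
proof -
  have "smooth_on S (\<lambda>x. \<Sum>k\<in>UNIV. v x $ k *\<^sub>R FD f x (axis k 1))"
    using assms by (intro smooth_on_sum smooth_on_scaleR smooth_on_vec_nth smooth_on_FD) auto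
  moreover have "smooth_on S (\<lambda>x. FD f x (v x)) \<longleftrightarrow>
      smooth_on S (\<lambda>x. \<Sum>k\<in>UNIV. v x $ k *\<^sub>R FD f x (axis k 1))"
    by (rule smooth_on_cong[OF assms(1) FD_linear_sum[OF smooth_on_differentiable[OF assms(2)]]])
  ultimately show ?thesis by (rule iffD2[rotated])
qed

lemma smooth_on_has_derivative_snd:
  assumes "smooth_on T g" "(t, x) \<in> T"
  shows "((\<lambda>x. g (t, x)) has_derivative (\<lambda>v. FD g (t, x) (0, v))) (at x)"
proof -
  have "(Pair t has_derivative Pair 0) (at x)"
    by (auto intro!: derivative_eq_intros)
  from diff_chain_at[OF this smooth_on_has_derivative[OF assms]] show ?thesis by (simp add: o_def)
qed

lemma smooth_on_has_vector_derivative_fst: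
  fixes g :: "real \<times> 'a::real_normed_vector \<Rightarrow> 'b::real_normed_vector"
  assumes "smooth_on T g" "(t, x) \<in> T"
  shows "((\<lambda>t. g (t, x)) has_vector_derivative FD g (t, x) (1, 0)) (at t)"
proof -
  have "((\<lambda>t. (t, x)) has_derivative (\<lambda>h. (h, 0))) (at t)"
    by (auto intro!: derivative_eq_intros)
  from diff_chain_at[OF this smooth_on_has_derivative[OF assms]]
  have d: "((\<lambda>t. g (t, x)) has_derivative (\<lambda>h. FD g (t, x) (h, 0))) (at t)" by (simp add: o_def)
  have "(\<lambda>h. FD g (t, x) (h, 0)) = (\<lambda>h. h *\<^sub>R FD g (t, x) (1, 0))"
  proof
    show "FD g (t, x) (h, 0) = h *\<^sub>R FD g (t, x) (1, 0)" for h
      using linear_scale[OF linear_frechet_derivative[OF smooth_on_differentiable[OF assms]], of h "(1, 0)"]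
      by (simp only: scaleR_Pair scaleR_zero_right real_scaleR_def mult_1_right)
  qed
  then show ?thesis using d unfolding has_vector_derivative_def by (simp only:)
qed

section \<open>Integrals depending smoothly on a parameter\<close>

lemma param_integral_has_derivative:
  fixes g :: "real \<times> 'a::euclidean_space \<Rightarrow> 'b::euclidean_space"
  assumes "open S" "smooth_on T g" "{0..1} \<times> S \<subseteq> T" "x0 \<in> S"
  shows "((\<lambda>x. integral {0..1} (\<lambda>s. g (s, x))) has_derivative
    (\<lambda>v. integral {0..1} (\<lambda>s. FD g (s, x0) (0, v)))) (at x0)"
proof -
  obtain e where e: "e > 0" "ball x0 e \<subseteq> S" using assms(1,4) openE by blast
  define U where "U = ball x0 e"
  \<comment> \<open>The Leibniz rule asks for a continuous family of bounded linear maps;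
    \<open>Blinfun\<close> yields the intended map for \<open>x\<close> in \<open>U\<close> and
    \<open>t\<close> in \<open>[0, 1]\<close>, where \<open>g\<close> is known to be
    differentiable.\<close>
  define fx where "fx = (\<lambda>x t. Blinfun (\<lambda>v. FD g (t, x) (0, v)))"
  have inT: "(t, x) \<in> T" if "x \<in> U" "t \<in> {0..1}" for t x
    using that e(2) assms(3) unfolding U_def by blast
  have fx: "blinfun_apply (fx x t) = (\<lambda>v. FD g (t, x) (0, v))" if "x \<in> U" "t \<in> {0..1}" for t x
    unfolding fx_def using smooth_on_has_derivative_snd[OF assms(2) inT[OF that]]
    by (intro bounded_linear_Blinfun_apply has_derivative_bounded_linear)
  have contg: "continuous_on T (\<lambda>p. FD g p v)" for v
    by (intro smooth_on_continuous smooth_on_FD assms)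
  have c: "continuous_on (U \<times> {0..1}) (\<lambda>(x, t). fx x t)"
  proof (rule continuous_on_blinfun_componentwise)
    fix i :: 'a assume "i \<in> Basis"
    have "continuous_on (U \<times> {0..1}) (\<lambda>p. FD g (snd p, fst p) (0, i))"
      by (intro continuous_on_compose2[OF contg] continuous_intros) (use inT in auto)
    moreover have "blinfun_apply (case p of (x, t) \<Rightarrow> fx x t) i = FD g (snd p, fst p) (0, i)"
      if "p \<in> U \<times> {0..1}" for p
      using that fx by (auto split: prod.split)
    ultimately show "continuous_on (U \<times> {0..1}) (\<lambda>p. blinfun_apply (case p of (x, t) \<Rightarrow> fx x t) i)"
      by (simp cong: continuous_on_cong)
  qed
  have x0: "x0 \<in> U" using e by (simp add: U_def)
  have "((\<lambda>x. integral (cbox 0 1) (\<lambda>s. g (s, x))) has_derivative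
      blinfun_apply (integral (cbox 0 1) (fx x0))) (at x0 within U)"
  proof (rule leibniz_rule)
    show "((\<lambda>x. g (t, x)) has_derivative blinfun_apply (fx x t)) (at x within U)"
      if "x \<in> U" "t \<in> cbox 0 1" for x t
      using that smooth_on_has_derivative_snd[OF assms(2) inT] fx
      by (auto intro: has_derivative_at_withinI)
    show "(\<lambda>s. g (s, x)) integrable_on cbox 0 1" if "x \<in> U" for x
      by (intro integrable_continuous continuous_on_compose2[OF smooth_on_continuous[OF assms(2)]]
        continuous_intros) (use inT that in auto)
    show "continuous_on (U \<times> cbox 0 1) (\<lambda>(x, t). fx x t)" using c by simp
  qed (auto simp: U_def e x0)
  moreover have "blinfun_apply (integral (cbox 0 1) (fx x0)) v = integral {0..1} (\<lambda>s. FD g (s, x0) (0, v))" for v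
  proof -
    have "fx x0 integrable_on {0..1}"
    proof (rule integrable_continuous_interval)
      have "continuous_on {0..1} (\<lambda>t. (\<lambda>(x, t). fx x t) (x0, t))"
        by (intro continuous_on_compose2[OF c] continuous_intros) (use x0 in auto)
      then show "continuous_on {0..1} (fx x0)" by simp
    qed
    then have "blinfun_apply (integral {0..1} (fx x0)) v = integral {0..1} (\<lambda>s. blinfun_apply (fx x0 s) v)"
      by (rule blinfun_apply_integral)
    also have "\<dots> = integral {0..1} (\<lambda>s. FD g (s, x0) (0, v))"
      using fx[OF x0] by (intro integral_cong) auto
    finally show ?thesis by simp
  qed
  then have "blinfun_apply (integral (cbox 0 1) (fx x0)) = (\<lambda>v. integral {0..1} (\<lambda>s. FD g (s, x0) (0, v)))"
    by (rule ext)
  ultimately have "((\<lambda>x. integral {0..1} (\<lambda>s. g (s, x))) has_derivative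
    (\<lambda>v. integral {0..1} (\<lambda>s. FD g (s, x0) (0, v)))) (at x0 within U)"
    by simp
  then show ?thesis using at_within_open[OF x0] by (simp add: U_def)
qed

text \<open>The derivative in direction \<open>v\<close> is again such an integral, with integrand
  \<open>FD g (s, x) (0, v)\<close>, whence the induction on the order with \<open>g\<close>
  arbitrary.\<close>

lemma smooth_on_param_integral:
  fixes g :: "real \<times> 'a::euclidean_space \<Rightarrow> 'b::euclidean_space"
  assumes "open S" "smooth_on T g" "{0..1} \<times> S \<subseteq> T"
  shows "smooth_on S (\<lambda>x. integral {0..1} (\<lambda>s. g (s, x)))"
proof -
  have "cdiff n S (\<lambda>x. integral {0..1} (\<lambda>s. g (s, x)))" for n
    using assms(2)
  proof (induction n arbitrary: g)
    case 0
    then show ?case using param_integral_has_derivative[OF assms(1) 0 assms(3)]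
      by (auto intro: differentiableI)
  next
    case (Suc n)
    note d = param_integral_has_derivative[OF assms(1) Suc.prems assms(3)]
    have "cdiff n S (\<lambda>x. integral {0..1} (\<lambda>s. FD g (s, x) (0, v)))" for v
      by (rule Suc.IH) (rule smooth_on_FD[OF Suc.prems])
    moreover have "cdiff n S (\<lambda>x. FD (\<lambda>x. integral {0..1} (\<lambda>s. g (s, x))) x v) \<longleftrightarrow>
        cdiff n S (\<lambda>x. integral {0..1} (\<lambda>s. FD g (s, x) (0, v)))" for v
      by (rule cdiff_cong[OF assms(1)]) (simp add: FD_eq[OF d])
    ultimately show ?case using d by (auto intro: differentiableI)
  qed
  then show ?thesis using smooth_on_iff_cdiff by blast
qed

text \<open>\<open>F (t, x)\<close> is the integral over \<open>s\<close> in \<open>[0, 1]\<close>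
  of \<open>t\<close> times the \<open>t\<close>-derivative of \<open>F\<close> at
  \<open>(s * t, x)\<close>; \<open>star\<close> keeps the segment from \<open>(0, x)\<close> to
  \<open>(t, x)\<close> inside \<open>T\<close>.\<close>

lemma smooth_on_hadamard:
  fixes F :: "real \<times> 'a::euclidean_space \<Rightarrow> 'b::euclidean_space"
  assumes "open T" "smooth_on T F"
    and star: "\<And>t x s. (t, x) \<in> T \<Longrightarrow> s \<in> {0..1} \<Longrightarrow> (s * t, x) \<in> T"
    and zero: "\<And>x. (0, x) \<in> T \<Longrightarrow> F (0, x) = 0"
  obtains G where "smooth_on T G" "\<And>t x. (t, x) \<in> T \<Longrightarrow> F (t, x) = t *\<^sub>R G (t, x)"
proof
  let ?g = "\<lambda>q::real \<times> real \<times> 'a. FD F (fst q * fst (snd q), snd (snd q)) (1, 0)"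
  let ?m = "\<lambda>q::real \<times> real \<times> 'a. (fst q * fst (snd q), snd (snd q))"
  let ?T = "?m -` T"
  have oT: "open ?T" by (intro open_vimage assms continuous_intros)
  have m: "smooth_on ?T ?m"
    by (intro smooth_on_Pair smooth_on_mult smooth_on_fst smooth_on_snd smooth_on_id oT)
  have g: "smooth_on ?T ?g"
    by (rule smooth_on_compose[OF oT assms(1) m smooth_on_FD[OF assms(2)]]) auto
  show "smooth_on T (\<lambda>p. integral {0..1} (\<lambda>s. ?g (s, p)))"
    by (rule smooth_on_param_integral[OF assms(1) g]) (use star in auto)
  show "F (t, x) = t *\<^sub>R integral {0..1} (\<lambda>s. ?g (s, (t, x)))" if "(t, x) \<in> T" for t x
  proof -
    have "((\<lambda>s. t *\<^sub>R FD F (s * t, x) (1, 0)) has_integral F (1 * t, x) - F (0 * t, x)) {0..1}"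
    proof (rule fundamental_theorem_of_calculus)
      fix s :: real assume "s \<in> {0..1}"
      then have "(s * t, x) \<in> T" using star that by auto
      from smooth_on_has_vector_derivative_fst[OF assms(2) this]
      have "(((\<lambda>u. F (u, x)) \<circ> (\<lambda>s. s * t)) has_vector_derivative t *\<^sub>R FD F (s * t, x) (1, 0)) (at s)"
        by (intro vector_diff_chain_at) (auto intro!: derivative_eq_intros simp: has_real_derivative_iff_has_vector_derivative[symmetric])
      then show "((\<lambda>s. F (s * t, x)) has_vector_derivative t *\<^sub>R FD F (s * t, x) (1, 0)) (at s within {0..1})"
        by (auto simp: o_def intro: has_vector_derivative_at_within)
    qed auto
    from integral_unique[OF this]
    have "t *\<^sub>R integral {0..1} (\<lambda>s. FD F (s * t, x) (1, 0)) = F (t, x) - F (0, x)"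
      by (simp del: integral_cmul add: integral_cmul[symmetric])
    moreover have "F (0, x) = 0" using zero star[OF that, of 0] by simp
    ultimately show ?thesis by simp
  qed
qed

text \<open>The primitive of \<open>h\<close> from \<open>0\<close> to \<open>t\<close>, rescaled to
  the fixed interval \<open>[0, 1]\<close> so that the results on parameter integrals apply, for
  negative \<open>t\<close> as well.\<close>

definition t_primitive ::
    "(real \<times> 'a::euclidean_space \<Rightarrow> 'b::euclidean_space) \<Rightarrow> real \<times> 'a \<Rightarrow> 'b" where
  "t_primitive h p = fst p *\<^sub>R integral {0..1} (\<lambda>s. h (s * fst p, snd p))"

lemma smooth_on_rescaled:
  assumes "smooth_on UNIV (h :: real \<times> 'a::euclidean_space \<Rightarrow> 'b::euclidean_space)"
  shows "smooth_on UNIV (\<lambda>q::real \<times> real \<times> 'a. h (fst q * fst (snd q), snd (snd q)))"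
  by (rule smooth_on_compose[OF open_UNIV open_UNIV _ assms])
    (intro smooth_on_Pair smooth_on_mult smooth_on_fst smooth_on_snd smooth_on_id open_UNIV UNIV_I)+

lemma smooth_on_t_primitive:
  assumes "smooth_on UNIV h"
  shows "smooth_on UNIV (t_primitive h)"
proof -
  have "smooth_on UNIV (\<lambda>p. integral {0..1} (\<lambda>s. h (s * fst p, snd p)))"
    using smooth_on_param_integral[OF open_UNIV smooth_on_rescaled[OF assms]] by simp
  then have "smooth_on UNIV (\<lambda>p. fst p *\<^sub>R integral {0..1} (\<lambda>s. h (s * fst p, snd p)))"
    by (intro smooth_on_scaleR smooth_on_fst smooth_on_id open_UNIV)
  then show ?thesis unfolding t_primitive_def[abs_def] .
qed

lemma t_primitive_0: "t_primitive h (0, x) = 0"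
  by (simp add: t_primitive_def)

lemma FD_t_primitive:
  assumes "smooth_on UNIV h"
  shows "FD (t_primitive h) p v =
    fst p *\<^sub>R integral {0..1} (\<lambda>s. FD h (s * fst p, snd p) (s * fst v, snd v)) +
    fst v *\<^sub>R integral {0..1} (\<lambda>s. h (s * fst p, snd p))"
proof -
  let ?g = "\<lambda>q::real \<times> real \<times> _. h (fst q * fst (snd q), snd (snd q))"
  have m: "((\<lambda>q::real \<times> real \<times> _. (fst q * fst (snd q), snd (snd q))) has_derivative
     (\<lambda>v. (fst q * fst (snd v) + fst v * fst (snd q), snd (snd v)))) (at q)" for q
    by (auto intro!: derivative_eq_intros)
  have fg: "FD ?g q v = FD h (fst q * fst (snd q), snd (snd q))
     (fst q * fst (snd v) + fst v * fst (snd q), snd (snd v))" for q v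
    using FD_eq[OF diff_chain_at[OF m smooth_on_has_derivative[OF assms UNIV_I]], unfolded o_def] by simp
  have "((\<lambda>p. integral {0..1} (\<lambda>s. ?g (s, p))) has_derivative
     (\<lambda>v. integral {0..1} (\<lambda>s. FD ?g (s, p) (0, v)))) (at p)"
    by (rule param_integral_has_derivative[OF open_UNIV smooth_on_rescaled[OF assms]]) auto
  then have "((\<lambda>p. integral {0..1} (\<lambda>s. h (s * fst p, snd p))) has_derivative
     (\<lambda>v. integral {0..1} (\<lambda>s. FD h (s * fst p, snd p) (s * fst v, snd v)))) (at p)"
    by (simp add: fg)
  then have "((\<lambda>p. fst p *\<^sub>R integral {0..1} (\<lambda>s. h (s * fst p, snd p))) has_derivative
     (\<lambda>v. fst p *\<^sub>R integral {0..1} (\<lambda>s. FD h (s * fst p, snd p) (s * fst v, snd v))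
       + fst v *\<^sub>R integral {0..1} (\<lambda>s. h (s * fst p, snd p)))) (at p)"
    by (intro has_derivative_scaleR has_derivative_fst has_derivative_ident)
  from FD_eq[OF this] show ?thesis unfolding t_primitive_def[abs_def] by simp
qed

text \<open>A direction without \<open>t\<close>-component removes the boundary term and passes
  under the integral. This yields the variational equation of a flow that is written as a
  primitive.\<close>

lemma FD_t_primitive_snd:
  "smooth_on UNIV h \<Longrightarrow> FD (t_primitive h) p (0, u) = t_primitive (\<lambda>p. FD h p (0, u)) p"
  by (simp add: FD_t_primitive t_primitive_def)

text \<open>The derivative is the integral over \<open>s\<close> of the derivative of \<open>s *\<^sub>R h (s * t, x)\<close>.\<close>

lemma t_primitive_has_vector_derivative:
  assumes "smooth_on UNIV h"
  shows "((\<lambda>t. t_primitive h (t, x)) has_vector_derivative h (t, x)) (at t)"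
proof -
  let ?D = "\<lambda>s. FD h (s * t, x) (1, 0)"
  have cont: "continuous_on {0..1} (\<lambda>s. G (s * t, x))" if "smooth_on UNIV G" for G :: "real \<times> 'a \<Rightarrow> 'b"
    by (intro continuous_on_compose2[OF smooth_on_continuous[OF that]] continuous_intros) simp
  note c = cont[OF smooth_on_FD[OF assms]] cont[OF assms]
  have lin: "FD h (s * t, x) (s, 0) = s *\<^sub>R ?D s" for s
    using linear_scale[OF linear_frechet_derivative[OF smooth_on_differentiable[OF assms UNIV_I]], of "(s * t, x)" s "(1, 0)"]
    by (simp only: scaleR_Pair scaleR_zero_right real_scaleR_def mult_1_right)
  have "((\<lambda>s. s *\<^sub>R (t *\<^sub>R ?D s) + 1 *\<^sub>R h (s * t, x)) has_integral
      1 *\<^sub>R h (1 * t, x) - 0 *\<^sub>R h (0 * t, x)) {0..1}"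
  proof (rule fundamental_theorem_of_calculus)
    fix s :: real
    have "(((\<lambda>u. h (u, x)) \<circ> (\<lambda>s. s * t)) has_vector_derivative t *\<^sub>R ?D s) (at s)"
      by (intro vector_diff_chain_at smooth_on_has_vector_derivative_fst[OF assms UNIV_I])
        (auto intro!: derivative_eq_intros simp: has_real_derivative_iff_has_vector_derivative[symmetric])
    then have "((\<lambda>s. h (s * t, x)) has_vector_derivative t *\<^sub>R ?D s) (at s)" by (simp add: o_def)
    from has_vector_derivative_scaleR[OF DERIV_ident this]
    show "((\<lambda>s. s *\<^sub>R h (s * t, x)) has_vector_derivative s *\<^sub>R (t *\<^sub>R ?D s) + 1 *\<^sub>R h (s * t, x))
        (at s within {0..1})"
      by (rule has_vector_derivative_at_within)
  qed simp
  from integral_unique[OF this]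
  have "h (t, x) = integral {0..1} (\<lambda>s. t *\<^sub>R (s *\<^sub>R ?D s) + h (s * t, x))"
    by (simp add: mult.commute)
  also have "\<dots> = integral {0..1} (\<lambda>s. t *\<^sub>R (s *\<^sub>R ?D s)) + integral {0..1} (\<lambda>s. h (s * t, x))"
    by (rule integral_add) (intro integrable_continuous_interval continuous_intros c)+
  also have "\<dots> = FD (t_primitive h) (t, x) (1, 0)"
    by (simp add: FD_t_primitive[OF assms] lin del: scaleR_scaleR)
  finally show ?thesis
    using smooth_on_has_vector_derivative_fst[OF smooth_on_t_primitive[OF assms] UNIV_I, where t=t and x=x] by simp
qed

lemma iter_deriv_cong:
  assumes "open S" "\<And>y. y \<in> S \<Longrightarrow> f y = g y" "x \<in> S"
  shows "iter_deriv vs f x = iter_deriv vs g x"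
  using assms(3)
proof (induction vs arbitrary: x)
  case (Cons v vs)
  then show ?case using FD_cong[OF assms(1) Cons.prems, of "iter_deriv vs f" "iter_deriv vs g"] by simp
qed (use assms in auto)

lemma smooth_on_iter_deriv: "smooth_on S f \<Longrightarrow> smooth_on S (iter_deriv vs f)"
proof (induction vs arbitrary: f rule: rev_induct)
  case (snoc v vs)
  then show ?case using snoc.IH[OF smooth_on_FD[OF snoc.prems]] by (simp add: iter_deriv_snoc)
qed simp

lemma iter_deriv_slice:
  assumes "open T" "smooth_on T Q" "(t, x) \<in> T"
  shows "iter_deriv vs (\<lambda>x. Q (t, x)) x = iter_deriv (map (Pair 0) vs) Q (t, x)"
  using assms(3)
proof (induction vs arbitrary: x)
  case (Cons v vs)
  have o: "open (Pair t -` T)" by (intro open_vimage assms continuous_intros)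
  have "FD (iter_deriv vs (\<lambda>x. Q (t, x))) x = FD (\<lambda>x. iter_deriv (map (Pair 0) vs) Q (t, x)) x"
    by (rule FD_cong[OF o]) (use Cons in auto)
  also have "\<dots> = (\<lambda>v. FD (iter_deriv (map (Pair 0) vs) Q) (t, x) (0, v))"
    by (rule FD_eq[OF smooth_on_has_derivative_snd[OF smooth_on_iter_deriv[OF assms(2)] Cons.prems]])
  finally show ?case by simp
qed simp

text \<open>Every limit \<open>t \<rightarrow> 0\<close> of rescaled fields is obtained from a smooth extension across \<open>t = 0\<close>.\<close>

lemma smooth_limit_joint:
  fixes Q :: "real \<times> 'a::euclidean_space \<Rightarrow> 'b::euclidean_space"
  assumes T: "open T" "\<And>x. (0, x) \<in> T" and Q: "smooth_on T Q"
    and f: "\<And>t x. (t, x) \<in> T \<Longrightarrow> t \<noteq> 0 \<Longrightarrow> f t x = Q (t, x)"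
  shows "smooth_limit f (\<lambda>x. Q (0, x)) (at 0)"
  unfolding smooth_limit_def
proof (intro conjI allI impI)
  show "smooth_on UNIV (\<lambda>x. Q (0, x))"
    by (rule smooth_on_compose[OF open_UNIV T(1) _ Q])
      (auto intro!: smooth_on_Pair smooth_on_const smooth_on_id T)
  fix vs and K :: "'a set" assume K: "compact K"
  define R where "R = iter_deriv (map (Pair 0) vs) Q"
  have R: "continuous_on T R" unfolding R_def by (intro smooth_on_continuous smooth_on_iter_deriv Q)
  show "uniform_limit K (\<lambda>t. iter_deriv vs (f t)) (iter_deriv vs (\<lambda>x. Q (0, x))) (at 0)"
  proof (cases "K = {}")
    case False
    \<comment> \<open>The set \<open>{0} \<times> K\<close> is compact in the open set
      \<open>T\<close>, so a whole neighbourhood of it fits into \<open>T\<close>; halving the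
      radius allows a closed \<open>t\<close>-interval, on whose product with \<open>K\<close>
      continuity is uniform.\<close>
    have "\<exists>d>0. \<forall>t x. \<bar>t\<bar> \<le> d \<and> x \<in> K \<longrightarrow> (t, x) \<in> T"
    proof -
      have "compact ({0::real} \<times> K)" by (intro compact_Times K) auto
      moreover have "{0} \<times> K \<subseteq> T" using T by auto
      ultimately obtain e where e: "e > 0" "(\<Union>p\<in>{0} \<times> K. ball p e) \<subseteq> T"
        using compact_subset_open_imp_ball_epsilon_subset[of "{0} \<times> K" T] T(1) by metis
      have "(t, x) \<in> T" if "\<bar>t\<bar> \<le> e / 2" "x \<in> K" for t x
      proof -
        have "(t, x) \<in> ball (0, x) e" using that e(1) by (auto simp: dist_Pair_Pair)
        then show ?thesis using e(2) that(2) by blast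
      qed
      then show ?thesis using e(1) by (intro exI[of _ "e / 2"]) auto
    qed
    then obtain d where d: "d > 0" "\<And>t x. \<bar>t\<bar> \<le> d \<Longrightarrow> x \<in> K \<Longrightarrow> (t, x) \<in> T" by blast
    have c: "uniformly_continuous_on ({-d..d} \<times> K) R"
      by (intro compact_uniformly_continuous continuous_on_subset[OF R] compact_Times K) (use d(2) in \<open>auto simp: abs_le_iff\<close>)
    show ?thesis
      unfolding uniform_limit_iff
    proof (intro allI impI)
      fix \<epsilon> :: real assume "\<epsilon> > 0"
      from c[unfolded uniformly_continuous_on_def, THEN spec, THEN mp, OF this]
      obtain \<delta> where \<delta>: "\<delta> > 0"
        and \<delta>': "\<forall>p\<in>{-d..d} \<times> K. \<forall>q\<in>{-d..d} \<times> K. dist q p < \<delta> \<longrightarrow> dist (R q) (R p) < \<epsilon>"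
        by (elim exE conjE)
      have "\<forall>\<^sub>F t in at (0::real). t \<noteq> 0 \<and> dist t 0 < min d \<delta>"
        unfolding eventually_at using d(1) \<delta> by (intro exI[of _ "min d \<delta>"]) auto
      then show "\<forall>\<^sub>F t in at 0. \<forall>x\<in>K. dist (iter_deriv vs (f t) x) (iter_deriv vs (\<lambda>x. Q (0, x)) x) < \<epsilon>"
      proof eventually_elim
        case (elim t)
        show ?case
        proof
          fix x assume x: "x \<in> K"
          have tx: "(t, x) \<in> T" using d(2)[OF _ x, of t] elim by auto
          have "iter_deriv vs (f t) x = iter_deriv vs (\<lambda>x. Q (t, x)) x"
          proof (rule iter_deriv_cong)
            show "open (Pair t -` T)" by (intro open_vimage T continuous_intros)
            show "f t y = Q (t, y)" if "y \<in> Pair t -` T" for y using f that elim by auto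
            show "x \<in> Pair t -` T" using tx by simp
          qed
          then have "iter_deriv vs (f t) x = R (t, x)"
            using iter_deriv_slice[OF T(1) Q tx] by (simp add: R_def)
          moreover have "iter_deriv vs (\<lambda>x. Q (0, x)) x = R (0, x)"
            using iter_deriv_slice[OF T(1) Q T(2)] by (simp add: R_def)
          moreover have "dist (R (t, x)) (R (0, x)) < \<epsilon>"
            using \<delta>'[rule_format, of "(0, x)" "(t, x)"] x elim d(1)
            by (auto simp: dist_Pair_Pair abs_less_iff)
          ultimately show "dist (iter_deriv vs (f t) x) (iter_deriv vs (\<lambda>x. Q (0, x)) x) < \<epsilon>" by simp
        qed
      qed
    qed
  next
    case True
    then show ?thesis unfolding uniform_limit_iff by auto
  qed
qed

lemma smooth_limit_tendsto:
  assumes "smooth_limit f g F"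
  shows "((\<lambda>t. f t x) \<longlongrightarrow> g x) F"
proof -
  have "uniform_limit {x} (\<lambda>t. iter_deriv [] (f t)) (iter_deriv [] g) F"
    using assms compact_sing unfolding smooth_limit_def by blast
  then show ?thesis by (intro tendsto_uniform_limitI[where S="{x}"]) auto
qed

section \<open>Dilations and homogeneous functions\<close>

lemma dilation_nth [simp]: "dilation w t x $ j = t ^ w j * x $ j"
  by (simp add: dilation_def)

lemma dilation_1 [simp]: "dilation w 1 x = x"
  by (simp add: vec_eq_iff)

lemma dilation_dilation: "dilation w s (dilation w t x) = dilation w (s * t) x"
  by (simp add: vec_eq_iff power_mult_distrib)

lemma dilation_at_0 [simp]: "dilation w t 0 = 0"
  by (simp add: vec_eq_iff)

lemma bounded_linear_dilation: "bounded_linear (dilation w t)"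
  by (rule linear_bounded_pos[THEN exE, of "dilation w t"])
     (auto intro!: linearI simp: vec_eq_iff algebra_simps linear_conv_bounded_linear[symmetric])

lemma smooth_on_dilation: "smooth_on UNIV (\<lambda>p. dilation w (fst p) (snd p))"
  unfolding dilation_def
  by (intro smooth_on_vec_lambda smooth_on_mult smooth_on_power smooth_on_vec_nth smooth_on_fst
      smooth_on_snd smooth_on_id open_UNIV)

lemma has_derivative_dilation: "(dilation w t has_derivative dilation w t) (at x)"
  by (rule bounded_linear_imp_has_derivative[OF bounded_linear_dilation])

locale weighted =
  fixes w :: "'n::finite \<Rightarrow> nat"
  assumes w_pos: "1 \<le> w j"
begin

lemma dilation_0 [simp]: "dilation w 0 x = 0"
proof -
  have "(0::real) ^ w j = 0" for j using w_pos[of j] by simp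
  then show ?thesis by (simp add: vec_eq_iff)
qed

lemma norm_dilation_le:
  assumes "\<bar>t\<bar> \<le> 1" shows "norm (dilation w t x) \<le> norm x"
proof (rule norm_le_componentwise_cart)
  fix j
  have "\<bar>t\<bar> ^ w j \<le> 1" using assms by (simp add: power_le_one)
  then show "norm (dilation w t x $ j) \<le> norm (x $ j)"
    by (simp add: abs_mult power_abs mult_left_le_one_le)
qed

lemma dilation_tendsto_0:
  "((\<lambda>t. dilation w t x) \<longlongrightarrow> 0) (at 0)"
proof -
  have "((\<lambda>t. dilation w t x) \<longlongrightarrow> dilation w 0 x) (at 0)"
    unfolding dilation_def by (intro tendsto_intros)
  then show ?thesis by simp
qed

text \<open>For \<open>f\<close> given on the ball of radius \<open>\<rho>\<close> this is the
  natural domain of \<open>f (dilation w t x)\<close>. For positive \<open>\<rho>\<close> it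
  contains every \<open>(0, x)\<close>, and it is star-shaped in \<open>t\<close>, as Hadamard
  division by \<open>t\<close> requires.\<close>

definition dilation_dom :: "real \<Rightarrow> (real \<times> (real ^ 'n)) set" where
  "dilation_dom \<rho> = {(t, x). norm (dilation w t x) < \<rho>}"

lemma open_dilation_dom: "open (dilation_dom \<rho>)"
proof -
  have "dilation_dom \<rho> = (\<lambda>p. norm (dilation w (fst p) (snd p))) -` {..<\<rho>}"
    by (auto simp: dilation_dom_def)
  then show ?thesis
    by (auto intro!: open_vimage continuous_on_norm smooth_on_continuous[OF smooth_on_dilation])
qed

lemma zero_in_dilation_dom: "\<rho> > 0 \<Longrightarrow> (0, x) \<in> dilation_dom \<rho>"
  by (simp add: dilation_dom_def)

lemma dilation_dom_star:
  "(t, x) \<in> dilation_dom \<rho> \<Longrightarrow> s \<in> {0..1} \<Longrightarrow> (s * t, x) \<in> dilation_dom \<rho>"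
  using norm_dilation_le[of s "dilation w t x"]
  by (auto simp: dilation_dom_def dilation_dilation)

lemma dilation_dom_dilation_iff:
  "(t, dilation w s x) \<in> dilation_dom \<rho> \<longleftrightarrow> (t * s, x) \<in> dilation_dom \<rho>"
  by (simp add: dilation_dom_def dilation_dilation)

lemma eventually_in_dilation_dom:
  assumes "\<rho> > 0" shows "\<forall>\<^sub>F t in at 0. (t, x) \<in> dilation_dom \<rho>"
proof -
  have "((\<lambda>t. norm (dilation w t x)) \<longlongrightarrow> norm (0::real^'n)) (at 0)"
    by (intro tendsto_norm dilation_tendsto_0)
  then show ?thesis unfolding dilation_dom_def
    using assms order_tendstoD(2)[of _ "norm (0::real^'n)" "at 0" \<rho>] by simp
qed

lemma smooth_on_comp_dilation:
  assumes "smooth_on (ball 0 \<rho>) f"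
  shows "smooth_on (dilation_dom \<rho>) (\<lambda>p. f (dilation w (fst p) (snd p)))"
  by (rule smooth_on_compose[OF open_dilation_dom open_ball smooth_on_subset[OF smooth_on_dilation] assms])
     (auto simp: dilation_dom_def)

definition homogeneous :: "nat \<Rightarrow> (real ^ 'n \<Rightarrow> real) \<Rightarrow> bool" where
  "homogeneous m f \<longleftrightarrow> (\<forall>t x. f (dilation w t x) = t ^ m * f x)"

lemma homogeneousD: "homogeneous m f \<Longrightarrow> f (dilation w t x) = t ^ m * f x"
  by (simp add: homogeneous_def)

lemma partial_dilation:
  assumes "f differentiable (at (dilation w t x))"
  shows "FD (\<lambda>x. f (dilation w t x)) x (axis k 1) = t ^ w k * FD f (dilation w t x) (axis k 1)"
proof -
  have "FD (\<lambda>x. f (dilation w t x)) x = (\<lambda>v. FD f (dilation w t x) (dilation w t v))"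
    using FD_eq[OF diff_chain_at[OF has_derivative_dilation assms[unfolded frechet_derivative_works]]]
    by (simp add: o_def)
  moreover have "dilation w t (axis k 1) = (t ^ w k) *\<^sub>R (axis k (1::real))"
    by (simp add: vec_eq_iff axis_def)
  ultimately show ?thesis
    using linear_scale[OF linear_frechet_derivative[OF assms]] by simp
qed

text \<open>Powers stand on both sides because the degree \<open>m - w k\<close> of the partial
  derivative may be negative; \<open>scaling_zero\<close> and \<open>scaling_homogeneous\<close>
  treat the two signs.\<close>

lemma homogeneous_partial_eq:
  assumes "smooth_on UNIV f" "homogeneous m f"
  shows "t ^ w k * FD f (dilation w t x) (axis k 1) = t ^ m * FD f x (axis k 1)"
proof -
  have "t ^ w k * FD f (dilation w t x) (axis k 1) = FD (\<lambda>x. f (dilation w t x)) x (axis k 1)"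
    by (rule partial_dilation[symmetric]) (use assms in \<open>auto intro: smooth_on_differentiable\<close>)
  also have "(\<lambda>x. f (dilation w t x)) = (\<lambda>x. t ^ m * f x)"
    using assms(2) by (simp add: homogeneous_def)
  also have "FD (\<lambda>x. t ^ m * f x) x (axis k 1) = t ^ m * FD f x (axis k 1)"
    using FD_eq[OF has_derivative_mult_right[OF smooth_on_has_derivative[OF assms(1) UNIV_I, of x]]]
    by metis
  finally show ?thesis .
qed

lemma homogeneous_continuous_at_0:
  assumes "continuous_on UNIV (f :: real ^ 'n \<Rightarrow> real)"
  shows "((\<lambda>t. f (dilation w t x)) \<longlongrightarrow> f 0) (at 0)"
  using assms dilation_tendsto_0 by (metis continuous_on_eq_continuous_at isCont_tendsto_compose open_UNIV UNIV_I)

text \<open>The way identities are carried to \<open>t = 0\<close>: powers of \<open>t\<close> are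
  cancelled while \<open>t \<noteq> 0\<close>, and then both sides pass to the limit.\<close>

lemma eq_by_punctured_limit:
  assumes "(f \<longlongrightarrow> a) (at (0::real))" "(g \<longlongrightarrow> (b::real)) (at 0)"
    "\<forall>\<^sub>F t in at 0. t \<noteq> 0 \<longrightarrow> f t = g t"
  shows "a = b"
proof -
  have "(g \<longlongrightarrow> a) (at 0)"
    using assms(1) by (rule Lim_transform_eventually)
      (use assms(3) in \<open>auto simp: eventually_at_filter elim: eventually_mono\<close>)
  then show ?thesis using tendsto_unique[OF _ _ assms(2)] by simp
qed

text \<open>For \<open>s \<noteq> 0\<close> cancellation gives
  \<open>f x = s ^ (a - b) * f (dilation w s x)\<close>, and by continuity of \<open>f\<close> at 0
  the right-hand side tends to 0 with \<open>s\<close>. In short, a nonzero continuous function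
  cannot have negative degree.\<close>

lemma scaling_zero:
  assumes "continuous_on UNIV f" "\<And>s x. s \<noteq> 0 \<Longrightarrow> s ^ a * f (dilation w s x) = s ^ b * f x" "b < a"
  shows "f x = 0"
proof -
  have e: "s ^ (a - b) * f (dilation w s x) = f x" if "s \<noteq> 0" for s
  proof -
    have "s ^ b * (s ^ (a - b) * f (dilation w s x)) = s ^ b * f x"
      using assms(2)[OF that, of x] assms(3) by (simp add: mult.assoc[symmetric] power_add[symmetric])
    then show ?thesis using that by simp
  qed
  have "((\<lambda>t. t ^ (a - b) * f (dilation w t x)) \<longlongrightarrow> 0 ^ (a - b) * f 0) (at 0)"
    by (intro tendsto_intros homogeneous_continuous_at_0 assms)
  from eq_by_punctured_limit[OF this tendsto_const[of "f x"]] e assms(3) show ?thesis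
    by (simp add: zero_power)
qed

lemma scaling_homogeneous:
  assumes "continuous_on UNIV f" "\<And>s x. s \<noteq> 0 \<Longrightarrow> s ^ a * f (dilation w s x) = s ^ b * f x" "a \<le> b"
  shows "homogeneous (b - a) f"
  unfolding homogeneous_def
proof (intro allI)
  fix t x
  have e: "f (dilation w s x) = s ^ (b - a) * f x" if "s \<noteq> 0" for s
  proof -
    have "s ^ a * f (dilation w s x) = s ^ a * (s ^ (b - a) * f x)"
      using assms(2)[OF that, of x] assms(3) by (simp add: mult.assoc[symmetric] power_add[symmetric])
    then show ?thesis using that by simp
  qed
  show "f (dilation w t x) = t ^ (b - a) * f x"
  proof (cases "t = 0")
    case True
    have "((\<lambda>s. s ^ (b - a) * f x) \<longlongrightarrow> 0 ^ (b - a) * f x) (at 0)"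
      by (intro tendsto_intros)
    from eq_by_punctured_limit[OF homogeneous_continuous_at_0[OF assms(1), of x] this] e True
    show ?thesis by simp
  qed (use e in simp)
qed

lemma homogeneous_partial_high:
  assumes "smooth_on UNIV f" "homogeneous m f" "m < w k"
  shows "FD f x (axis k 1) = 0"
  by (rule scaling_zero[OF smooth_on_continuous[OF smooth_on_FD[OF assms(1)]]
    homogeneous_partial_eq[OF assms(1,2)] assms(3)])

lemma homogeneous_partial:
  assumes "smooth_on UNIV f" "homogeneous m f" "w k \<le> m"
  shows "homogeneous (m - w k) (\<lambda>x. FD f x (axis k 1))"
  by (rule scaling_homogeneous[OF smooth_on_continuous[OF smooth_on_FD[OF assms(1)]]
    homogeneous_partial_eq[OF assms(1,2)] assms(3)])

lemma constant_if_partials_0: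
  fixes f :: "real ^ 'n \<Rightarrow> real"
  assumes "smooth_on UNIV f" "\<And>k x. FD f x (axis k 1) = 0"
  shows "f x = f 0"
proof -
  have "FD f x v = 0" for x v
    by (subst FD_linear_sum) (use assms in \<open>auto intro: smooth_on_differentiable\<close>)
  then have "FD f x = (\<lambda>v. 0)" for x by auto
  then have "(f has_derivative (\<lambda>v. 0)) (at x)" for x
    using smooth_on_has_derivative[OF assms(1), of x] by simp
  then show ?thesis
    by (intro has_derivative_zero_unique[of UNIV f]) auto
qed

lemma euler_homogeneous:
  assumes "smooth_on UNIV f" "homogeneous m f"
  shows "(\<Sum>k\<in>UNIV. real (w k) * x $ k * FD f x (axis k 1)) = real m * f x"
proof -
  have d: "((\<lambda>t. dilation w t x) has_vector_derivative (\<chi> k. real (w k) * x $ k)) (at 1)"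
  proof -
    have "((\<lambda>t. \<Sum>k\<in>UNIV. (t ^ w k * x $ k) *\<^sub>R axis k (1::real)) has_vector_derivative
        (\<Sum>k\<in>UNIV. (real (w k) * x $ k) *\<^sub>R axis k 1)) (at 1)"
      unfolding has_vector_derivative_def
      by (auto intro!: derivative_eq_intros sum.cong simp: scaleR_sum_right)
    moreover have "(\<lambda>t. \<Sum>k\<in>UNIV. (t ^ w k * x $ k) *\<^sub>R axis k 1) = (\<lambda>t. dilation w t x)"
      by (rule ext) (subst (2) vec_eq_sum_axis, simp)
    moreover have "(\<Sum>k\<in>UNIV. (real (w k) * x $ k) *\<^sub>R axis k 1) = (\<chi> k. real (w k) * x $ k)"
      by (subst vec_eq_sum_axis) simp
    ultimately show ?thesis by simp
  qed
  have "((f \<circ> (\<lambda>t. dilation w t x)) has_derivative (\<lambda>h. FD f x (h *\<^sub>R (\<chi> k. real (w k) * x $ k)))) (at 1)"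
    using diff_chain_at[OF d[unfolded has_vector_derivative_def], of f "FD f x"]
      smooth_on_has_derivative[OF assms(1), of x] by (simp add: o_def)
  moreover have "(f \<circ> (\<lambda>t. dilation w t x)) = (\<lambda>t. t ^ m * f x)"
    using assms(2) by (auto simp: homogeneous_def)
  moreover have "((\<lambda>t. t ^ m * f x) has_derivative (\<lambda>h. h * (real m * f x))) (at 1)"
    by (auto intro!: derivative_eq_intros)
  ultimately have "FD f x (1 *\<^sub>R (\<chi> k. real (w k) * x $ k)) = 1 * (real m * f x)"
    using has_derivative_unique by metis
  then show ?thesis
    using FD_linear_sum[OF smooth_on_differentiable[OF assms(1) UNIV_I], of x "\<chi> k. real (w k) * x $ k"] by simp
qed

lemma homogeneous_0_const:
  assumes "homogeneous 0 f" shows "f x = f 0"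
  using assms homogeneousD[OF assms, of 0 x] by simp

lemma homogeneous_at_0:
  assumes "homogeneous m f" "m \<noteq> 0" shows "f 0 = 0"
  using homogeneousD[OF assms(1), of 0 0] assms(2) by (simp add: zero_power)

lemma real_polynomial_function_vec_nth: "real_polynomial_function (\<lambda>x::real^'n. x $ k)"
  by (rule real_polynomial_function.intros(1)) (rule bounded_linear_vec_nth)

text \<open>By Euler's identity \<open>f\<close> is a combination of its partial derivatives, which have lower degree.\<close>

lemma homogeneous_imp_polynomial:
  assumes "smooth_on UNIV f" "homogeneous m f"
  shows "real_polynomial_function f"
  using assms
proof (induction m arbitrary: f rule: less_induct)
  case (less m)
  show ?case
  proof (cases "m = 0")
    case True
    then have "f = (\<lambda>x. f 0)" using homogeneous_0_const less.prems by blast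
    then show ?thesis by (metis real_polynomial_function.intros(2))
  next
    case False
    have p: "real_polynomial_function (\<lambda>x. FD f x (axis k 1))" for k
    proof (cases "w k \<le> m")
      case True
      then show ?thesis using w_pos[of k]
        by (intro less.IH[of "m - w k"] smooth_on_FD less.prems homogeneous_partial) auto
    next
      case False
      then have "(\<lambda>x. FD f x (axis k 1)) = (\<lambda>x. 0)"
        using homogeneous_partial_high less.prems by auto
      then show ?thesis by (simp add: real_polynomial_function.intros(2))
    qed
    define q where "q = (\<lambda>x. (1 / real m) * (\<Sum>k\<in>UNIV. (real (w k) * x $ k) * FD f x (axis k 1)))"
    have "real_polynomial_function q" unfolding q_def
      by (intro real_polynomial_function.intros(2,4) real_polynomial_function_sum
        real_polynomial_function_vec_nth p) auto
    moreover have "q = f" unfolding q_def using euler_homogeneous[OF less.prems] False by auto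
    ultimately show ?thesis by simp
  qed
qed

lemma w_homogeneous_nth: "w_homogeneous w \<phi> \<Longrightarrow> homogeneous (w j) (\<lambda>x. \<phi> x $ j)"
  by (auto simp: w_homogeneous_def homogeneous_def)

lemma w_homogeneous_imp_polynomial:
  assumes "smooth_on UNIV \<phi>" "w_homogeneous w \<phi>"
  shows "polynomial_function \<phi>"
proof -
  have p: "real_polynomial_function (\<lambda>x. \<phi> x $ j)" for j
    by (rule homogeneous_imp_polynomial[OF smooth_on_vec_nth w_homogeneous_nth]) (use assms in auto)
  show ?thesis
    unfolding polynomial_function_iff_Basis_inner
  proof
    fix b :: "real ^ 'n" assume "b \<in> Basis"
    then obtain j where "b = axis j 1" by (auto simp: Basis_vec_def)
    then show "real_polynomial_function (\<lambda>x. \<phi> x \<bullet> b)" using p[of j] by (simp add: inner_axis)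
  qed
qed

text \<open>The segment from \<open>x\<close> to \<open>y\<close> moves only in coordinates of
  weight above \<open>m\<close>, and there the partial derivatives vanish because their degree would
  be negative.\<close>

lemma homogeneous_depends:
  assumes "smooth_on UNIV f" "homogeneous m f" "\<And>l. w l \<le> m \<Longrightarrow> x $ l = y $ l"
  shows "f x = f y"
proof -
  define c where "c = (\<lambda>s::real. x + s *\<^sub>R (y - x))"
  have "((\<lambda>s. f (c s)) has_vector_derivative 0) (at s)" for s
  proof -
    have "FD f (c s) (y - x) = 0"
      by (subst FD_linear_sum[OF smooth_on_differentiable[OF assms(1) UNIV_I]])
        (auto intro!: sum.neutral, metis assms(3) homogeneous_partial_high[OF assms(1,2)] not_le)
    moreover have "(c has_derivative (\<lambda>h. h *\<^sub>R (y - x))) (at s)"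
      unfolding c_def by (auto intro!: derivative_eq_intros)
    from diff_chain_at[OF this smooth_on_has_derivative[OF assms(1) UNIV_I]]
    have "((\<lambda>s. f (c s)) has_derivative (\<lambda>h. FD f (c s) (h *\<^sub>R (y - x)))) (at s)" by (simp add: o_def)
    ultimately show ?thesis
      using linear_scale[OF linear_frechet_derivative[OF smooth_on_differentiable[OF assms(1) UNIV_I]]]
      by (simp add: has_vector_derivative_def)
  qed
  then have "((\<lambda>s. f (c s)) has_derivative (\<lambda>h. 0)) (at s within UNIV)" for s
    by (simp add: has_vector_derivative_def)
  then have "f (c 0) = f (c 1)"
    by (intro has_derivative_zero_unique[of UNIV "\<lambda>s. f (c s)"]) auto
  then show ?thesis by (simp add: c_def)
qed

lemma FD_homogeneous:
  assumes h: "w_homogeneous w \<psi>" and d: "\<psi> differentiable (at x)" "\<psi> differentiable (at (dilation w t x))"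
  shows "FD \<psi> (dilation w t x) (dilation w t v) = dilation w t (FD \<psi> x v)"
proof -
  have "((\<lambda>x. \<psi> (dilation w t x)) has_derivative (\<lambda>v. FD \<psi> (dilation w t x) (dilation w t v))) (at x)"
    using diff_chain_at[OF has_derivative_dilation d(2)[unfolded frechet_derivative_works]]
    by (simp add: o_def)
  moreover have "((\<lambda>x. \<psi> (dilation w t x)) has_derivative (\<lambda>v. dilation w t (FD \<psi> x v))) (at x)"
    using bounded_linear.has_derivative[OF bounded_linear_dilation d(1)[unfolded frechet_derivative_works]] h
    by (simp add: w_homogeneous_def)
  ultimately show ?thesis using has_derivative_unique by metis
qed

text \<open>A small dilation moves \<open>x\<close> into \<open>S\<close>, and \<open>\<psi>\<close>
  coincides with its own conjugate by this dilation.\<close>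

lemma homogeneous_differentiable:
  assumes h: "w_homogeneous w \<psi>" and S: "open S" "0 \<in> S" "smooth_on S \<psi>"
  shows "\<psi> differentiable (at x)"
proof -
  have "\<forall>\<^sub>F t in at 0. dilation w t x \<in> S" by (rule topological_tendstoD[OF dilation_tendsto_0 S(1,2)])
  moreover have "\<forall>\<^sub>F t in at (0::real). t \<noteq> 0" by (simp add: eventually_at_filter)
  ultimately have "\<forall>\<^sub>F t in at (0::real). dilation w t x \<in> S \<and> t \<noteq> 0" by eventually_elim simp
  then obtain t :: real where t: "dilation w t x \<in> S" "t \<noteq> 0"
    using eventually_happens'[of "at (0::real)"] by auto
  have e: "dilation w (1 / t) \<circ> (\<psi> \<circ> dilation w t) = \<psi>"
    using h t(2) by (simp add: fun_eq_iff w_homogeneous_def dilation_dilation)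
  have "dilation w (1 / t) \<circ> (\<psi> \<circ> dilation w t) differentiable (at x)"
    using has_derivative_dilation smooth_on_differentiable[OF S(3) t(1)]
    by (intro differentiable_chain_at) (auto simp: differentiable_def)
  then show ?thesis unfolding e .
qed

end

section \<open>Blow-up of privileged coordinates\<close>

fun word_deriv :: "('n \<Rightarrow> 'a \<Rightarrow> 'a) \<Rightarrow> 'n list \<Rightarrow> ('a::real_normed_vector \<Rightarrow> real) \<Rightarrow> 'a \<Rightarrow> real" where
  "word_deriv Y [] f = f"
| "word_deriv Y (i # I) f = (\<lambda>x. FD (word_deriv Y I f) x (Y i x))"

lemma word_deriv_snoc: "word_deriv Y (I @ [j]) f = word_deriv Y I (\<lambda>x. FD f x (Y j x))"
  by (induction I) auto

definition vfield_bracket :: "('a \<Rightarrow> 'a) \<Rightarrow> ('a \<Rightarrow> 'a) \<Rightarrow> 'a \<Rightarrow> 'a::real_normed_vector" where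
  "vfield_bracket V W x = FD W x (V x) - FD V x (W x)"

text \<open>The assumptions express privilegedness in a chart, so that the blow-up takes place on a
  ball of \<open>real ^ 'n\<close>, with ordinary derivatives in place of derivations.\<close>

locale privileged_fields = weighted w for w :: "'n::finite \<Rightarrow> nat" +
  fixes Y :: "'n \<Rightarrow> real ^ 'n \<Rightarrow> real ^ 'n" and \<rho> :: real
  assumes \<rho>_pos: "\<rho> > 0"
    and Y_smooth: "smooth_on (ball 0 \<rho>) (Y j)"
    and Y_0: "Y j 0 = axis j 1"
    and coord_order: "sum_list (map w I) < w k \<Longrightarrow> word_deriv Y I (\<lambda>x. x $ k) 0 = 0"
begin

section \<open>Order along words and divisibility under dilations\<close>

definition vanish :: "nat \<Rightarrow> (real ^ 'n \<Rightarrow> real) \<Rightarrow> bool" where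
  "vanish N f \<longleftrightarrow> (\<forall>I. sum_list (map w I) < N \<longrightarrow> word_deriv Y I f 0 = 0)"

lemma vanish_mono: "vanish N f \<Longrightarrow> M \<le> N \<Longrightarrow> vanish M f"
  by (simp add: vanish_def)

text \<open>Differentiating along \<open>Y j\<close> first amounts to appending \<open>j\<close> to
  the word. When \<open>w j > N\<close> the truncated difference is 0, and \<open>vanish 0\<close>
  is vacuous.\<close>

lemma vanish_deriv:
  assumes "vanish N f" shows "vanish (N - w j) (\<lambda>x. FD f x (Y j x))"
  unfolding vanish_def
proof (intro allI impI)
  fix I assume "sum_list (map w I) < N - w j"
  then have "sum_list (map w (I @ [j])) < N" by simp
  then show "word_deriv Y I (\<lambda>x. FD f x (Y j x)) 0 = 0"
    using assms unfolding vanish_def word_deriv_snoc[symmetric] by blast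
qed

text \<open>The coefficient is \<open>Y j\<close> applied to the coordinate \<open>x $ k\<close>,
  which satisfies \<open>vanish (w k)\<close>. Here the order of the coordinates enters the
  construction of the model fields.\<close>

lemma vanish_coeff: "vanish (w k - w j) (\<lambda>x. Y j x $ k)"
proof -
  have "vanish (w k) (\<lambda>x. x $ k)" using coord_order by (simp add: vanish_def)
  from vanish_deriv[OF this, of j] show ?thesis
    unfolding FD_eq[OF bounded_linear_imp_has_derivative[OF bounded_linear_vec_nth]] .
qed

definition divisible :: "nat \<Rightarrow> (real ^ 'n \<Rightarrow> real) \<Rightarrow> bool" where
  "divisible N f \<longleftrightarrow> (\<exists>G. smooth_on (dilation_dom \<rho>) G \<and>
     (\<forall>(t, x)\<in>dilation_dom \<rho>. f (dilation w t x) = t ^ N * G (t, x)))"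

lemma divisibleE:
  assumes "divisible N f"
  obtains G where "smooth_on (dilation_dom \<rho>) G"
    "\<And>t x. (t, x) \<in> dilation_dom \<rho> \<Longrightarrow> f (dilation w t x) = t ^ N * G (t, x)"
  using assms unfolding divisible_def by blast

lemma in_ball: "(t, x) \<in> dilation_dom \<rho> \<Longrightarrow> dilation w t x \<in> ball 0 \<rho>"
  by (simp add: dilation_dom_def)

lemma tendsto_slice:
  assumes "continuous_on (dilation_dom \<rho>) G"
  shows "((\<lambda>t. G (t * c, x)) \<longlongrightarrow> G (0, x)) (at 0)"
proof -
  have "isCont G (0, x)"
    using assms zero_in_dilation_dom[OF \<rho>_pos] open_dilation_dom
    by (metis continuous_on_eq_continuous_at)
  moreover have "((\<lambda>t. (t * c, x)) \<longlongrightarrow> (0 * c, x)) (at 0)" by (intro tendsto_intros)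
  ultimately show ?thesis using isCont_tendsto_compose by fastforce
qed

lemma divisible_0: "smooth_on (ball 0 \<rho>) f \<Longrightarrow> divisible 0 f"
  unfolding divisible_def using smooth_on_comp_dilation
  by (intro exI[of _ "\<lambda>p. f (dilation w (fst p) (snd p))"]) auto

text \<open>\<open>A\<close> is component \<open>k\<close> of the rescaled \<open>Y j\<close>. For
  \<open>w k \<le> w j\<close> it arises by multiplication with a power of \<open>t\<close>, so its
  value at \<open>t = 0\<close> is known from \<open>Y_0\<close>: this gives triangularity before
  the model fields have been constructed.\<close>

lemma coeff_quotient:
  assumes "w k \<le> w j \<or> divisible (w k - w j) (\<lambda>x. Y j x $ k)"
  shows "\<exists>A. smooth_on (dilation_dom \<rho>) A \<and>
    (\<forall>(t, x)\<in>dilation_dom \<rho>. t ^ w k * A (t, x) = t ^ w j * Y j (dilation w t x) $ k) \<and>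
    (w k < w j \<longrightarrow> (\<forall>x. A (0, x) = 0)) \<and>
    (w k = w j \<longrightarrow> (\<forall>x. A (0, x) = (if j = k then 1 else 0)))"
proof (cases "w k \<le> w j")
  case True
  let ?A = "\<lambda>p. fst p ^ (w j - w k) * Y j (dilation w (fst p) (snd p)) $ k"
  have "smooth_on (dilation_dom \<rho>) ?A"
    by (intro smooth_on_mult smooth_on_power smooth_on_fst smooth_on_id open_dilation_dom
      smooth_on_vec_nth smooth_on_comp_dilation Y_smooth)
  moreover have "t ^ w k * (t ^ (w j - w k) * y) = t ^ w j * y" for t y :: real
    using True by (simp add: mult.assoc[symmetric] power_add[symmetric])
  ultimately show ?thesis
    by (intro exI[of _ ?A]) (auto simp: Y_0 axis_def zero_power)
next
  case False
  with assms obtain A where A: "smooth_on (dilation_dom \<rho>) A"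
    "\<And>t x. (t, x) \<in> dilation_dom \<rho> \<Longrightarrow> Y j (dilation w t x) $ k = t ^ (w k - w j) * A (t, x)"
    using divisibleE by metis
  then have "t ^ w k * A (t, x) = t ^ w j * Y j (dilation w t x) $ k" if "(t, x) \<in> dilation_dom \<rho>" for t x
    using False that by (simp add: mult.assoc[symmetric] power_add[symmetric])
  then show ?thesis using A(1) False by (intro exI[of _ A]) auto
qed

lemma eventually_in_dom:
  assumes "\<And>t. t \<noteq> 0 \<Longrightarrow> (t, x) \<in> dilation_dom \<rho> \<Longrightarrow> P t"
  shows "\<forall>\<^sub>F t in at 0. t \<noteq> 0 \<longrightarrow> P t"
  using eventually_in_dilation_dom[OF \<rho>_pos, of x] by eventually_elim (use assms in auto)

text \<open>The points \<open>(t, dilation w s x)\<close> and \<open>(t * s, x)\<close> stand for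
  the same argument of \<open>f\<close>. Both factorizations are compared, \<open>t ^ m\<close> is
  cancelled, and \<open>t\<close> tends to 0.\<close>

lemma divisible_homogeneous:
  assumes G: "continuous_on (dilation_dom \<rho>) G"
    and f: "\<And>t x. (t, x) \<in> dilation_dom \<rho> \<Longrightarrow> f (dilation w t x) = t ^ m * G (t, x)"
  shows "homogeneous m (\<lambda>x. G (0, x))"
  unfolding homogeneous_def
proof (intro allI)
  fix s x
  have e: "G (t * 1, dilation w s x) = s ^ m * G (t * s, x)"
    if "t \<noteq> 0" "(t, dilation w s x) \<in> dilation_dom \<rho>" for t
  proof -
    have "(t * s, x) \<in> dilation_dom \<rho>" using that dilation_dom_dilation_iff by blast
    from f[OF this] f[OF that(2)] have "t ^ m * G (t, dilation w s x) = (t * s) ^ m * G (t * s, x)"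
      by (simp only: dilation_dilation)
    then have "t ^ m * G (t * 1, dilation w s x) = t ^ m * (s ^ m * G (t * s, x))"
      by (simp only: power_mult_distrib mult.assoc mult_1_right)
    moreover have "t ^ m \<noteq> 0" using that(1) by simp
    ultimately show ?thesis by (rule mult_left_cancel[THEN iffD1, rotated])
  qed
  show "G (0, dilation w s x) = s ^ m * G (0, x)"
    by (rule eq_by_punctured_limit[OF tendsto_slice[OF G, of 1]
       tendsto_mult[OF tendsto_const tendsto_slice[OF G, of s]]])
      (rule eventually_in_dom[OF e])
qed

lemma slice_partial:
  assumes "smooth_on (dilation_dom \<rho>) G" "(t, x) \<in> dilation_dom \<rho>" "smooth_on (ball 0 \<rho>) f"
    and f: "\<And>t x. (t, x) \<in> dilation_dom \<rho> \<Longrightarrow> f (dilation w t x) = t ^ m * G (t, x)"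
  shows "t ^ w k * FD f (dilation w t x) (axis k 1) = t ^ m * FD G (t, x) (0, axis k 1)"
proof -
  have o: "open (Pair t -` dilation_dom \<rho>)"
    by (intro open_vimage open_dilation_dom continuous_intros)
  have "t ^ w k * FD f (dilation w t x) (axis k 1) = FD (\<lambda>x. f (dilation w t x)) x (axis k 1)"
    by (rule partial_dilation[symmetric])
       (rule smooth_on_differentiable[OF assms(3) in_ball[OF assms(2)]])
  also have "FD (\<lambda>x. f (dilation w t x)) x = FD (\<lambda>x. t ^ m * G (t, x)) x"
    by (rule FD_cong[OF o]) (use assms(2) f in auto)
  also have "FD (\<lambda>x. t ^ m * G (t, x)) x = (\<lambda>v. t ^ m * FD G (t, x) (0, v))"
    by (rule FD_eq[OF has_derivative_mult_right[OF smooth_on_has_derivative_snd[OF assms(1,2)]]])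
  finally show ?thesis .
qed

lemma FD_slice_0:
  assumes "smooth_on (dilation_dom \<rho>) G"
  shows "FD G (0, x) (0, v) = FD (\<lambda>x. G (0, x)) x v"
  using FD_eq[OF smooth_on_has_derivative_snd[OF assms zero_in_dilation_dom[OF \<rho>_pos]]] by simp

text \<open>The leading part \<open>g\<close> of \<open>f\<close> is homogeneous of degree \<open>m\<close>. Applying the induction hypothesis to the
  functions \<open>Y j f\<close> and to the coefficients of \<open>Y j\<close> shows that the leading parts of the fields annihilate
  \<open>g\<close>; since they are triangular with respect to the weights, \<open>g\<close> is constant.\<close>

lemma divisible_step:
  assumes IH: "\<And>M f. M \<le> m \<Longrightarrow> smooth_on (ball 0 \<rho>) f \<Longrightarrow> vanish M f \<Longrightarrow> divisible M f"
    and f: "smooth_on (ball 0 \<rho>) f" "vanish (Suc m) f"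
  shows "divisible (Suc m) f"
proof -
  let ?D = "dilation_dom \<rho>"
  note oD = open_dilation_dom[of \<rho>]
  obtain G where G: "smooth_on ?D G"
    and fG: "\<And>t x. (t, x) \<in> ?D \<Longrightarrow> f (dilation w t x) = t ^ m * G (t, x)"
    using divisibleE[OF IH[OF order_refl f(1) vanish_mono[OF f(2)]]] by auto
  define g where "g = (\<lambda>x. G (0, x))"
  have g: "smooth_on UNIV g" unfolding g_def
    by (rule smooth_on_compose[OF open_UNIV oD _ G])
      (auto intro!: smooth_on_Pair smooth_on_const smooth_on_id zero_in_dilation_dom \<rho>_pos)
  have hg: "homogeneous m g"
    unfolding g_def by (rule divisible_homogeneous[OF smooth_on_continuous[OF G] fG])
  have Yjk: "smooth_on (ball 0 \<rho>) (\<lambda>x. Y j x $ k)" for j k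
    by (intro smooth_on_vec_nth Y_smooth open_ball)
  \<comment> \<open>Heavier directions come first: once the partial derivatives of \<open>g\<close>
    at weights above \<open>w j\<close> vanish, the leading part of \<open>Y j\<close> acts on
    \<open>g\<close> as the partial derivative along \<open>axis j 1\<close>.\<close>
  have key: "FD g x (axis j 1) = 0" if hyp: "\<And>k. w j < w k \<Longrightarrow> FD g x (axis k 1) = 0" for j x
  proof -
    \<comment> \<open>The induction hypothesis divides the coefficient by
      \<open>t ^ (w k - w j)\<close> only if this exponent is at most \<open>m\<close>. Otherwise
      the coefficient is divided by \<open>t ^ m\<close>, and the remaining factor
      \<open>t ^ w j\<close> makes the term vanish at \<open>t = 0\<close>.\<close>
    define good where "good = (\<lambda>k. w k \<le> w j + m)"
    have "\<forall>k. \<exists>A. good k \<longrightarrow> smooth_on ?D A \<and>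
        (\<forall>(t, x)\<in>?D. t ^ w k * A (t, x) = t ^ w j * Y j (dilation w t x) $ k) \<and>
        (w k < w j \<longrightarrow> (\<forall>x. A (0, x) = 0)) \<and>
        (w k = w j \<longrightarrow> (\<forall>x. A (0, x) = (if j = k then 1 else 0)))"
    proof
      fix k
      have "good k \<Longrightarrow> divisible (w k - w j) (\<lambda>x. Y j x $ k)"
        by (rule IH[OF _ Yjk vanish_coeff]) (auto simp: good_def)
      then show "\<exists>A. good k \<longrightarrow> smooth_on ?D A \<and>
        (\<forall>(t, x)\<in>?D. t ^ w k * A (t, x) = t ^ w j * Y j (dilation w t x) $ k) \<and>
        (w k < w j \<longrightarrow> (\<forall>x. A (0, x) = 0)) \<and>
        (w k = w j \<longrightarrow> (\<forall>x. A (0, x) = (if j = k then 1 else 0)))"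
        using coeff_quotient[of k j] by blast
    qed
    from choice[OF this] obtain A where
      A: "\<And>k. good k \<Longrightarrow> smooth_on ?D (A k)"
      and AY: "\<And>k t x. good k \<Longrightarrow> (t, x) \<in> ?D \<Longrightarrow> t ^ w k * A k (t, x) = t ^ w j * Y j (dilation w t x) $ k"
      and A0: "\<And>k x. good k \<Longrightarrow> w k < w j \<Longrightarrow> A k (0, x) = 0"
      and A1: "\<And>k x. good k \<Longrightarrow> w k = w j \<Longrightarrow> A k (0, x) = (if j = k then 1 else 0)"
      by blast
    have "\<forall>k. \<exists>R. \<not> good k \<longrightarrow> smooth_on ?D R \<and>
        (\<forall>(t, x)\<in>?D. Y j (dilation w t x) $ k = t ^ m * R (t, x))"
    proof
      fix k
      have "\<not> good k \<Longrightarrow> divisible m (\<lambda>x. Y j x $ k)"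
        by (rule IH[OF _ Yjk vanish_mono[OF vanish_coeff]]) (auto simp: good_def)
      then show "\<exists>R. \<not> good k \<longrightarrow> smooth_on ?D R \<and>
        (\<forall>(t, x)\<in>?D. Y j (dilation w t x) $ k = t ^ m * R (t, x))"
        unfolding divisible_def by blast
    qed
    from choice[OF this] obtain R where
      R: "\<And>k. \<not> good k \<Longrightarrow> smooth_on ?D (R k)"
      and RY: "\<And>k t x. \<not> good k \<Longrightarrow> (t, x) \<in> ?D \<Longrightarrow> Y j (dilation w t x) $ k = t ^ m * R k (t, x)"
      by blast
    define h where "h = (\<lambda>x. FD f x (Y j x))"
    have hs: "smooth_on (ball 0 \<rho>) h"
      unfolding h_def by (rule smooth_on_FD_apply[OF open_ball f(1) Y_smooth])
    \<comment> \<open>\<open>Y j f\<close> has order at least \<open>Suc m - w j\<close>, which is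
      at most \<open>m\<close> as weights are positive, so the induction hypothesis covers it. The
      exponent \<open>Suc m\<close>, one more than in the expansion by the \<open>T k\<close>,
      forces the sum of the \<open>T k\<close> to vanish at \<open>t = 0\<close>.\<close>
    obtain S where S: "smooth_on ?D S"
      and hS: "\<And>t x. (t, x) \<in> ?D \<Longrightarrow> t ^ w j * h (dilation w t x) = t ^ Suc m * S (t, x)"
    proof (cases "w j \<le> Suc m")
      case True
      have "vanish (Suc m - w j) h" unfolding h_def by (rule vanish_deriv[OF f(2)])
      then have "divisible (Suc m - w j) h" using w_pos[of j] by (intro IH hs) auto
      then obtain S where S: "smooth_on ?D S"
        "\<And>t x. (t, x) \<in> ?D \<Longrightarrow> h (dilation w t x) = t ^ (Suc m - w j) * S (t, x)"
        using divisibleE by metis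
      have "t ^ w j * h (dilation w t x) = t ^ Suc m * S (t, x)" if "(t, x) \<in> ?D" for t x
        unfolding S(2)[OF that] mult.assoc[symmetric] power_add[symmetric] using True by simp
      then show ?thesis using that S(1) by blast
    next
      case False
      let ?S = "\<lambda>p. fst p ^ (w j - Suc m) * h (dilation w (fst p) (snd p))"
      have "smooth_on ?D ?S"
        by (intro smooth_on_mult smooth_on_power smooth_on_fst smooth_on_id oD smooth_on_comp_dilation hs)
      moreover have "t ^ w j * h (dilation w t x) = t ^ Suc m * ?S (t, x)" for t x
        unfolding mult.assoc[symmetric] fst_conv snd_conv power_add[symmetric] using False by simp
      ultimately show ?thesis using that by blast
    qed
    define T where "T = (\<lambda>k p. if good k then A k p * FD G p (0, axis k 1)
       else fst p ^ w j * R k p * FD f (dilation w (fst p) (snd p)) (axis k 1))"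
    have T: "continuous_on ?D (T k)" for k
    proof (cases "good k")
      case True
      then show ?thesis unfolding T_def
        by (auto intro!: smooth_on_continuous smooth_on_mult oD A smooth_on_FD[OF G])
    next
      case False
      then show ?thesis unfolding T_def
        by (auto intro!: smooth_on_continuous smooth_on_mult oD R smooth_on_power smooth_on_fst
          smooth_on_id smooth_on_comp_dilation smooth_on_FD[OF f(1)])
    qed
    have hT: "t ^ w j * h (dilation w t x) = t ^ m * (\<Sum>k\<in>UNIV. T k (t, x))" if tx: "(t, x) \<in> ?D" for t x
    proof -
      have "h (dilation w t x) = (\<Sum>k\<in>UNIV. Y j (dilation w t x) $ k * FD f (dilation w t x) (axis k 1))"
        unfolding h_def real_scaleR_def[symmetric]
        by (rule FD_linear_sum[OF smooth_on_differentiable[OF f(1) in_ball[OF tx]]])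
      moreover have "t ^ w j * (Y j (dilation w t x) $ k * FD f (dilation w t x) (axis k 1)) = t ^ m * T k (t, x)" for k
      proof (cases "good k")
        case True
        have "t ^ w j * (Y j (dilation w t x) $ k * FD f (dilation w t x) (axis k 1)) =
           (t ^ w j * Y j (dilation w t x) $ k) * FD f (dilation w t x) (axis k 1)"
          by (rule mult.assoc[symmetric])
        also have "\<dots> = A k (t, x) * (t ^ w k * FD f (dilation w t x) (axis k 1))"
          unfolding AY[OF True tx, symmetric] by (simp only: mult_ac)
        also have "\<dots> = A k (t, x) * (t ^ m * FD G (t, x) (0, axis k 1))"
          by (simp only: slice_partial[OF G tx f(1) fG])
        also have "\<dots> = t ^ m * T k (t, x)" using True by (simp add: T_def)
        finally show ?thesis .
      next
        case False
        then show ?thesis unfolding RY[OF False tx] by (simp add: T_def mult_ac)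
      qed
      ultimately show ?thesis by (simp add: sum_distrib_left)
    qed
    have e: "(\<Sum>k\<in>UNIV. T k (t * 1, x)) = t * S (t * 1, x)" if "t \<noteq> 0" "(t, x) \<in> ?D" for t
      using hT[OF that(2)] hS[OF that(2)] that(1) by simp
    have "(\<Sum>k\<in>UNIV. T k (0, x)) = 0 * S (0, x)"
      by (rule eq_by_punctured_limit[OF tendsto_sum[OF tendsto_slice[OF T]]
        tendsto_mult[OF tendsto_ident_at tendsto_slice[OF smooth_on_continuous[OF S]]] eventually_in_dom[OF e]])
    moreover have "T k (0, x) = (if k = j then FD g x (axis j 1) else 0)" for k
    proof (cases "good k")
      case True
      then have "T k (0, x) = A k (0, x) * FD g x (axis k 1)"
        unfolding T_def g_def using FD_slice_0[OF G] by simp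
      moreover consider "w k < w j" | "w k = w j" | "w j < w k" by linarith
      then have "A k (0, x) * FD g x (axis k 1) = (if k = j then FD g x (axis j 1) else 0)"
        by cases (use A0[OF True] A1[OF True] hyp in auto)
      ultimately show ?thesis by simp
    next
      case False
      then show ?thesis using w_pos[of j] by (auto simp: T_def good_def zero_power)
    qed
    ultimately show ?thesis by simp
  qed
  have part: "FD g x (axis j 1) = 0" for j x
  \<comment> \<open>Descending induction on the weight: for \<open>w j > m\<close> the degree of
    \<open>g\<close> suffices, and for \<open>w j \<le> m\<close> every larger weight has a smaller
    measure.\<close>
  proof (induction "Suc m - w j" arbitrary: j rule: less_induct)
    case less
    show ?case
    proof (cases "m < w j")
      case True
      then show ?thesis by (rule homogeneous_partial_high[OF g hg])
    next
      case False
      show ?thesis by (rule key, rule less) (use False in auto)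
    qed
  qed
  have "g x = 0" for x
  proof -
    have "g x = g 0" by (rule constant_if_partials_0[OF g part])
    also have "g 0 = 0"
    proof (cases "m = 0")
      case True
      \<comment> \<open>In degree 0 the constant \<open>g\<close> equals \<open>f 0\<close>, which
        the order condition for the empty word annihilates.\<close>
      have "word_deriv Y [] f 0 = 0" using f(2) unfolding vanish_def
        by (metis list.map(1) sum_list.Nil zero_less_Suc)
      then show ?thesis using fG[OF zero_in_dilation_dom[OF \<rho>_pos], of 0] True by (simp add: g_def)
    next
      case False
      then show ?thesis by (rule homogeneous_at_0[OF hg])
    qed
    finally show ?thesis .
  qed
  then obtain G' where G': "smooth_on ?D G'" "\<And>t x. (t, x) \<in> ?D \<Longrightarrow> G (t, x) = t *\<^sub>R G' (t, x)"
    using smooth_on_hadamard[OF oD G dilation_dom_star] by (metis g_def)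
  then show ?thesis unfolding divisible_def
    by (intro exI[of _ G']) (auto simp: fG mult_ac)
qed

lemma vanish_imp_divisible:
  "smooth_on (ball 0 \<rho>) f \<Longrightarrow> vanish N f \<Longrightarrow> divisible N f"
proof (induction N arbitrary: f rule: less_induct)
  case (less N)
  show ?case
  proof (cases N)
    case 0
    then show ?thesis using divisible_0 less.prems by simp
  next
    case (Suc m)
    show ?thesis unfolding Suc
      by (rule divisible_step) (use less Suc in auto)
  qed
qed

text \<open>The field \<open>t\<^bsup>w\<^sub>j\<^esup> \<delta>\<^sub>t\<^sup>* Y\<^sub>j\<close>, extended to \<open>t = 0\<close>.\<close>

definition blowup :: "'n \<Rightarrow> real \<times> (real ^ 'n) \<Rightarrow> real ^ 'n" where
  "blowup = (SOME Q. \<forall>j. smooth_on (dilation_dom \<rho>) (Q j) \<and>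
     (\<forall>(t, x)\<in>dilation_dom \<rho>. \<forall>k. t ^ w k * Q j (t, x) $ k = t ^ w j * Y j (dilation w t x) $ k))"

lemma blowup_ex:
  "\<exists>Q. \<forall>j. smooth_on (dilation_dom \<rho>) (Q j) \<and>
     (\<forall>(t, x)\<in>dilation_dom \<rho>. \<forall>k. t ^ w k * Q j (t, x) $ k = t ^ w j * Y j (dilation w t x) $ k)"
proof (rule choice, rule allI)
  fix j
  have "\<forall>k. \<exists>A. smooth_on (dilation_dom \<rho>) A \<and>
    (\<forall>(t, x)\<in>dilation_dom \<rho>. t ^ w k * A (t, x) = t ^ w j * Y j (dilation w t x) $ k)"
    using coeff_quotient vanish_imp_divisible[OF smooth_on_vec_nth[OF open_ball Y_smooth] vanish_coeff]
    by blast
  from choice[OF this] obtain A where A: "\<And>k. smooth_on (dilation_dom \<rho>) (A k)"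
    "\<And>k t x. (t, x)\<in>dilation_dom \<rho> \<Longrightarrow> t ^ w k * A k (t, x) = t ^ w j * Y j (dilation w t x) $ k"
    by blast
  show "\<exists>Q. smooth_on (dilation_dom \<rho>) Q \<and>
     (\<forall>(t, x)\<in>dilation_dom \<rho>. \<forall>k. t ^ w k * Q (t, x) $ k = t ^ w j * Y j (dilation w t x) $ k)"
    by (rule exI[of _ "\<lambda>p. \<chi> k. A k p"]) (auto intro!: smooth_on_vec_lambda open_dilation_dom A)
qed

lemma blowup_smooth: "smooth_on (dilation_dom \<rho>) (blowup j)"
  and blowup_eq: "(t, x) \<in> dilation_dom \<rho> \<Longrightarrow>
    t ^ w k * blowup j (t, x) $ k = t ^ w j * Y j (dilation w t x) $ k"
proof -
  have "\<forall>j. smooth_on (dilation_dom \<rho>) (blowup j) \<and>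
     (\<forall>(t, x)\<in>dilation_dom \<rho>. \<forall>k. t ^ w k * blowup j (t, x) $ k = t ^ w j * Y j (dilation w t x) $ k)"
    unfolding blowup_def by (rule someI_ex[OF blowup_ex])
  from this[THEN spec, of j] show "smooth_on (dilation_dom \<rho>) (blowup j)"
    "(t, x) \<in> dilation_dom \<rho> \<Longrightarrow> t ^ w k * blowup j (t, x) $ k = t ^ w j * Y j (dilation w t x) $ k"
    by auto
qed

text \<open>The value does not depend on the choice made in \<open>blowup\<close>: on the domain the
  field is forced for \<open>t \<noteq> 0\<close>, and \<open>(0, x)\<close> is a limit of such
  points.\<close>

definition model :: "'n \<Rightarrow> real ^ 'n \<Rightarrow> real ^ 'n" where
  "model j x = blowup j (0, x)"

lemma blowup_tendsto: "((\<lambda>t. blowup j (t * c, x)) \<longlongrightarrow> model j x) (at 0)"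
  unfolding model_def by (rule tendsto_slice[OF smooth_on_continuous[OF blowup_smooth]])

lemma model_smooth: "smooth_on UNIV (model j)"
  unfolding model_def[abs_def]
  by (rule smooth_on_compose[OF open_UNIV open_dilation_dom _ blowup_smooth])
    (auto intro!: smooth_on_Pair smooth_on_const smooth_on_id zero_in_dilation_dom \<rho>_pos)

text \<open>\<open>blowup\<close> at \<open>(t, dilation w s x)\<close> and at
  \<open>(t * s, x)\<close> rescales the same value of \<open>Y j\<close>. In the limit component
  \<open>k\<close> has degree \<open>w k - w j\<close>; products are used since this may be
  negative.\<close>

lemma model_scaling:
  "s ^ w j * model j (dilation w s x) $ k = s ^ w k * model j x $ k"
proof -
  have e: "s ^ w j * blowup j (t * 1, dilation w s x) $ k = s ^ w k * blowup j (t * s, x) $ k"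
    if "t \<noteq> 0" "(t, dilation w s x) \<in> dilation_dom \<rho>" for t
  proof -
    have "(t * s, x) \<in> dilation_dom \<rho>" using that dilation_dom_dilation_iff by blast
    from blowup_eq[OF this, of k j] blowup_eq[OF that(2), of k j]
    have "t ^ w k * (s ^ w j * blowup j (t, dilation w s x) $ k) = t ^ w k * (s ^ w k * blowup j (t * s, x) $ k)"
      by (simp add: dilation_dilation power_mult_distrib mult_ac)
    then show ?thesis using that by simp
  qed
  show ?thesis
    by (rule eq_by_punctured_limit[OF tendsto_mult[OF tendsto_const tendsto_vec_nth[OF blowup_tendsto]]
       tendsto_mult[OF tendsto_const tendsto_vec_nth[OF blowup_tendsto]] eventually_in_dom[OF e]])
qed

lemma model_0: "model j 0 = axis j 1"
  unfolding vec_eq_iff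
proof
  fix k
  have e: "blowup j (t * 1, 0) $ k = axis j 1 $ k" if "t \<noteq> 0" "(t, 0) \<in> dilation_dom \<rho>" for t
    using blowup_eq[OF that(2), of k j] that(1) by (cases "j = k") (auto simp: Y_0 axis_def)
  show "model j 0 $ k = axis j 1 $ k"
    by (rule eq_by_punctured_limit[OF tendsto_vec_nth[OF blowup_tendsto] tendsto_const eventually_in_dom[OF e]])
qed

text \<open>Rescaling turns \<open>t ^ w j\<close> times \<open>Y j\<close> into the smooth field
  \<open>blowup j\<close>, so a derivative along \<open>Y j\<close> costs at most \<open>w j\<close>
  powers of \<open>t\<close>. They are cancelled for \<open>t \<noteq> 0\<close>; continuity
  supplies \<open>t = 0\<close>.\<close>

lemma divisible_deriv:
  assumes f: "smooth_on (ball 0 \<rho>) f" "divisible N f"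
  shows "divisible (N - w j) (\<lambda>x. FD f x (Y j x))"
proof (cases "w j \<le> N")
  case True
  let ?D = "dilation_dom \<rho>"
  note oD = open_dilation_dom[of \<rho>]
  obtain G where G: "smooth_on ?D G"
    and fG: "\<And>t x. (t, x) \<in> ?D \<Longrightarrow> f (dilation w t x) = t ^ N * G (t, x)"
    using divisibleE[OF f(2)] by metis
  define S where "S = (\<lambda>p. \<Sum>k\<in>UNIV. blowup j p $ k * FD G p (0, axis k 1))"
  have S: "smooth_on ?D S" unfolding S_def
    by (intro smooth_on_sum smooth_on_mult smooth_on_vec_nth smooth_on_FD G blowup_smooth oD)
  define h where "h = (\<lambda>x. FD f x (Y j x))"
  have h: "smooth_on (ball 0 \<rho>) h"
    unfolding h_def by (rule smooth_on_FD_apply[OF open_ball f(1) Y_smooth])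
  have e: "h (dilation w t x) = t ^ (N - w j) * S (t, x)" if "t \<noteq> 0" and tx: "(t, x) \<in> ?D" for t x
  proof -
    have "h (dilation w t x) = (\<Sum>k\<in>UNIV. Y j (dilation w t x) $ k * FD f (dilation w t x) (axis k 1))"
      unfolding h_def real_scaleR_def[symmetric]
      by (rule FD_linear_sum[OF smooth_on_differentiable[OF f(1) in_ball[OF tx]]])
    moreover have "t ^ w j * (Y j (dilation w t x) $ k * FD f (dilation w t x) (axis k 1)) =
      t ^ N * (blowup j (t, x) $ k * FD G (t, x) (0, axis k 1))" for k
    proof -
      have "t ^ w j * (Y j (dilation w t x) $ k * FD f (dilation w t x) (axis k 1)) =
           (t ^ w j * Y j (dilation w t x) $ k) * FD f (dilation w t x) (axis k 1)"
        by (rule mult.assoc[symmetric])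
      also have "\<dots> = blowup j (t, x) $ k * (t ^ w k * FD f (dilation w t x) (axis k 1))"
        unfolding blowup_eq[OF tx, symmetric] by (simp only: mult_ac)
      also have "\<dots> = blowup j (t, x) $ k * (t ^ N * FD G (t, x) (0, axis k 1))"
        by (simp only: slice_partial[OF G tx f(1) fG])
      finally show ?thesis by (simp only: mult_ac)
    qed
    ultimately have "t ^ w j * h (dilation w t x) = t ^ N * S (t, x)"
      by (simp add: sum_distrib_left S_def)
    also have "t ^ N = t ^ w j * t ^ (N - w j)" using True by (simp add: power_add[symmetric])
    finally have "t ^ w j * h (dilation w t x) = t ^ w j * (t ^ (N - w j) * S (t, x))"
      by (simp only: mult.assoc)
    moreover have "t ^ w j \<noteq> 0" using that(1) by simp
    ultimately show ?thesis by (rule mult_left_cancel[THEN iffD1, rotated])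
  qed
  have "h (dilation w t x) = t ^ (N - w j) * S (t, x)" if tx: "(t, x) \<in> ?D" for t x
  proof (cases "t = 0")
    case True
    have "h (dilation w 0 x) = 0 ^ (N - w j) * S (0, x)"
    proof (rule eq_by_punctured_limit)
      show "((\<lambda>t. (\<lambda>p. h (dilation w (fst p) (snd p))) (t * 1, x)) \<longlongrightarrow> h (dilation w 0 x)) (at 0)"
        using tendsto_slice[OF smooth_on_continuous[OF smooth_on_comp_dilation[OF h]], of 1 x] by simp
      show "((\<lambda>t. t ^ (N - w j) * S (t * 1, x)) \<longlongrightarrow> 0 ^ (N - w j) * S (0, x)) (at 0)"
        by (intro tendsto_intros tendsto_slice smooth_on_continuous S)
      show "\<forall>\<^sub>F t in at 0. t \<noteq> 0 \<longrightarrow> h (dilation w (fst (t * 1, x)) (snd (t * 1, x))) = t ^ (N - w j) * S (t * 1, x)"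
        by (rule eventually_in_dom[of x]) (simp add: e)
    qed
    then show ?thesis using True by simp
  qed (use e tx in simp)
  then show ?thesis using S unfolding divisible_def h_def by blast
next
  case False
  then show ?thesis
    using divisible_0[OF smooth_on_FD_apply[OF open_ball f(1) Y_smooth]] by simp
qed

text \<open>Each letter of a word lowers divisibility by its weight, so a word lighter than
  \<open>N\<close> leaves a positive power of \<open>t\<close>. This converse of
  \<open>vanish_imp_divisible\<close> serves to find the orders of the components of
  \<open>Log\<close>.\<close>

lemma divisible_imp_vanish:
  assumes "smooth_on (ball 0 \<rho>) f" "divisible N f"
  shows "vanish N f"
proof -
  have "word_deriv Y I f 0 = 0" if "sum_list (map w I) < N" for I
    using that assms
  proof (induction I arbitrary: f N rule: rev_induct)
    case Nil
    obtain G where "\<And>t x. (t, x) \<in> dilation_dom \<rho> \<Longrightarrow> f (dilation w t x) = t ^ N * G (t, x)"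
      using divisibleE[OF Nil(3)] by metis
    from this[OF zero_in_dilation_dom[OF \<rho>_pos], of 0] show ?case using Nil by (simp add: zero_power)
  next
    case (snoc j I)
    show ?case unfolding word_deriv_snoc
      by (rule snoc.IH[OF _ smooth_on_FD_apply[OF open_ball snoc.prems(2) Y_smooth]
         divisible_deriv[OF snoc.prems(2,3)]]) (use snoc.prems(1) in simp)
  qed
  then show ?thesis by (simp add: vanish_def)
qed

lemma homogeneous_imp_vanish:
  assumes "smooth_on UNIV f" "homogeneous m f"
  shows "vanish m f"
proof (rule divisible_imp_vanish)
  show "smooth_on (ball 0 \<rho>) f" by (rule smooth_on_subset[OF assms(1)]) simp
  have "smooth_on (dilation_dom \<rho>) (\<lambda>p. f (snd p))"
    by (rule smooth_on_compose[OF open_dilation_dom open_UNIV _ assms(1)])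
      (auto intro!: smooth_on_snd smooth_on_id open_dilation_dom)
  then show "divisible m f" unfolding divisible_def
    using homogeneousD[OF assms(2)] by (intro exI[of _ "\<lambda>p. f (snd p)"]) auto
qed

section \<open>Brackets of the rescaled fields\<close>

lemma blowup_partial:
  assumes tx: "(t, x) \<in> dilation_dom \<rho>"
  shows "t ^ w k * FD (blowup j) (t, x) (0, v) $ k =
    t ^ w j * FD (Y j) (dilation w t x) (dilation w t v) $ k"
proof -
  have o: "open (Pair t -` dilation_dom \<rho>)"
    by (intro open_vimage open_dilation_dom continuous_intros)
  have d1: "((\<lambda>x. t ^ w k * blowup j (t, x) $ k) has_derivative
     (\<lambda>v. t ^ w k * FD (blowup j) (t, x) (0, v) $ k)) (at x)"
    by (intro has_derivative_mult_right bounded_linear.has_derivative[OF bounded_linear_vec_nth]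
      smooth_on_has_derivative_snd[OF blowup_smooth tx])
  have "((\<lambda>x. Y j (dilation w t x)) has_derivative (\<lambda>v. FD (Y j) (dilation w t x) (dilation w t v))) (at x)"
    using diff_chain_at[OF has_derivative_dilation smooth_on_has_derivative[OF Y_smooth in_ball[OF tx]]]
    by (simp add: o_def)
  then have d2: "((\<lambda>x. t ^ w j * Y j (dilation w t x) $ k) has_derivative
     (\<lambda>v. t ^ w j * FD (Y j) (dilation w t x) (dilation w t v) $ k)) (at x)"
    by (intro has_derivative_mult_right bounded_linear.has_derivative[OF bounded_linear_vec_nth])
  have "FD (\<lambda>x. t ^ w k * blowup j (t, x) $ k) x = FD (\<lambda>x. t ^ w j * Y j (dilation w t x) $ k) x"
    by (rule FD_cong[OF o]) (use tx blowup_eq in auto)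
  then show ?thesis unfolding FD_eq[OF d1] FD_eq[OF d2] by (rule fun_cong)
qed

definition blowup_bracket :: "'n \<Rightarrow> 'n \<Rightarrow> real \<times> (real ^ 'n) \<Rightarrow> real ^ 'n" where
  "blowup_bracket i j p = FD (blowup j) p (0, blowup i p) - FD (blowup i) p (0, blowup j p)"

lemma blowup_bracket_continuous: "continuous_on (dilation_dom \<rho>) (blowup_bracket i j)"
proof -
  have "continuous_on (dilation_dom \<rho>) (\<lambda>p. FD (blowup j) p (0, blowup i p))" for i j
  proof -
    have "FD (blowup j) p (0, blowup i p) = (\<Sum>k\<in>UNIV. blowup i p $ k *\<^sub>R FD (blowup j) p (0, axis k 1))"
      if "p \<in> dilation_dom \<rho>" for p
    proof -
      note lin = linear_frechet_derivative[OF smooth_on_differentiable[OF blowup_smooth that]]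
      have "(0, blowup i p) = (\<Sum>k\<in>UNIV. blowup i p $ k *\<^sub>R (0::real, axis k (1::real)))"
        by (simp add: prod_eq_iff fst_sum snd_sum vec_eq_sum_axis[symmetric])
      then show ?thesis using lin by (simp only: linear_sum linear_scale)
    qed
    moreover have "continuous_on (dilation_dom \<rho>)
        (\<lambda>p. \<Sum>k\<in>UNIV. blowup i p $ k *\<^sub>R FD (blowup j) p (0, axis k 1))"
      by (intro smooth_on_continuous smooth_on_sum smooth_on_scaleR smooth_on_vec_nth smooth_on_FD
        blowup_smooth open_dilation_dom)
    ultimately show ?thesis by (simp cong: continuous_on_cong)
  qed
  then show ?thesis unfolding blowup_bracket_def[abs_def] by (intro continuous_on_diff)
qed

lemma blowup_bracket_0: "blowup_bracket i j (0, x) = vfield_bracket (model i) (model j) x"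
  unfolding blowup_bracket_def vfield_bracket_def model_def
  using FD_eq[OF smooth_on_has_derivative_snd[OF blowup_smooth zero_in_dilation_dom[OF \<rho>_pos]]]
  by (simp add: model_def[abs_def])

text \<open>Pullback by a dilation commutes with brackets, and the factors \<open>t ^ w i\<close>
  and \<open>t ^ w j\<close> of the two fields multiply.\<close>

lemma blowup_bracket_eq:
  assumes tx: "(t, x) \<in> dilation_dom \<rho>"
  shows "t ^ w k * blowup_bracket i j (t, x) $ k =
    t ^ (w i + w j) * vfield_bracket (Y i) (Y j) (dilation w t x) $ k"
proof -
  have "t ^ w k * FD (blowup j) (t, x) (0, blowup i (t, x)) $ k =
      t ^ (w i + w j) * FD (Y j) (dilation w t x) (Y i (dilation w t x)) $ k" for i j
  proof -
    have "dilation w t (blowup i (t, x)) = t ^ w i *\<^sub>R Y i (dilation w t x)"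
      using blowup_eq[OF tx] by (simp add: vec_eq_iff)
    then show ?thesis
      using linear_scale[OF linear_frechet_derivative[OF smooth_on_differentiable[OF Y_smooth in_ball[OF tx]]]]
      by (simp add: blowup_partial[OF tx] power_add)
  qed
  from this[of j i] this[of i j] show ?thesis
    by (simp add: blowup_bracket_def vfield_bracket_def right_diff_distrib add.commute)
qed

end

text \<open>The coefficients will be chosen point by point, so their convergence must come from that
  of the frame. Once the deviation \<open>\<epsilon>\<close> of the frame from the standard basis is
  below \<open>1 / 2\<close>, the coefficient vector has norm at most \<open>2 * norm (V t)\<close>,
  and \<open>2 * norm (V t) * \<epsilon> t\<close> bounds its distance from
  \<open>V t\<close>.\<close>

lemma frame_coeff_tendsto:
  fixes c :: "'t \<Rightarrow> 'n::finite \<Rightarrow> real"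
  assumes e: "\<And>l. (e l \<longlongrightarrow> axis l 1) F" and V: "(V \<longlongrightarrow> v) F"
    and eq: "\<forall>\<^sub>F t in F. V t = (\<Sum>l\<in>UNIV. c t l *\<^sub>R e l t)"
  shows "((\<lambda>t. c t l) \<longlongrightarrow> v $ l) F"
proof -
  define C where "C = (\<lambda>t. \<chi> l. c t l)"
  define \<epsilon> where "\<epsilon> = (\<lambda>t. \<Sum>l\<in>UNIV. norm (e l t - axis l 1))"
  have "(\<epsilon> \<longlongrightarrow> (\<Sum>l\<in>UNIV. norm (axis l (1::real) - axis l 1 :: real ^ 'n))) F"
    unfolding \<epsilon>_def by (intro tendsto_intros e)
  then have \<epsilon>0: "(\<epsilon> \<longlongrightarrow> 0) F" by simp
  have small: "\<forall>\<^sub>F t in F. \<epsilon> t < 1 / 2" using order_tendstoD(2)[OF \<epsilon>0, of "1/2"] by simp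
  have "\<forall>\<^sub>F t in F. norm (V t - C t) \<le> 2 * norm (V t) * \<epsilon> t"
    using small eq
  proof eventually_elim
    case (elim t)
    have "V t - C t = (\<Sum>l\<in>UNIV. c t l *\<^sub>R (e l t - axis l 1))"
      unfolding elim(2) by (subst (2) vec_eq_sum_axis) (simp add: C_def scaleR_diff_right sum_subtractf)
    also have "norm \<dots> \<le> (\<Sum>l\<in>UNIV. norm (C t) * norm (e l t - axis l 1))"
    proof (rule sum_norm_le)
      fix l
      have "\<bar>c t l\<bar> \<le> norm (C t)" using component_le_norm_cart[of "C t" l] by (simp add: C_def)
      then show "norm (c t l *\<^sub>R (e l t - axis l 1)) \<le> norm (C t) * norm (e l t - axis l 1)"
        by (simp add: mult_right_mono)
    qed
    finally have 1: "norm (V t - C t) \<le> norm (C t) * \<epsilon> t"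
      by (simp add: \<epsilon>_def sum_distrib_left)
    have "norm (C t) \<le> norm (V t) + norm (V t - C t)"
      using norm_triangle_ineq4[of "V t" "V t - C t"] by simp
    also have "norm (V t - C t) \<le> norm (C t) * (1 / 2)"
      using 1 elim(1) mult_left_mono[of "\<epsilon> t" "1/2" "norm (C t)"] by simp
    finally have "norm (C t) \<le> 2 * norm (V t)" by simp
    moreover have "0 \<le> \<epsilon> t" unfolding \<epsilon>_def by (intro sum_nonneg) auto
    ultimately show ?case using 1 mult_right_mono[of "norm (C t)" "2 * norm (V t)" "\<epsilon> t"] by linarith
  qed
  moreover have "((\<lambda>t. 2 * norm (V t) * \<epsilon> t) \<longlongrightarrow> 2 * norm v * 0) F"
    by (intro tendsto_intros V \<epsilon>0)
  ultimately have "((\<lambda>t. V t - C t) \<longlongrightarrow> 0) F"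
    unfolding mult_zero_right by (rule Lim_null_comparison)
  from tendsto_diff[OF V this] have "(C \<longlongrightarrow> v) F" by simp
  from tendsto_vec_nth[OF this, of l] show ?thesis by (simp add: C_def)
qed

context privileged_fields
begin

lemma vfield_bracket_tendsto:
  "((\<lambda>t. vfield_bracket (Y i) (Y j) (dilation w t x)) \<longlongrightarrow> vfield_bracket (Y i) (Y j) 0) (at 0)"
proof -
  have "continuous_on (ball 0 \<rho>) (vfield_bracket (Y i) (Y j))"
    unfolding vfield_bracket_def[abs_def]
    by (intro smooth_on_continuous smooth_on_diff smooth_on_FD_apply Y_smooth open_ball)
  then have "isCont (vfield_bracket (Y i) (Y j)) 0"
    using \<rho>_pos by (simp add: continuous_on_eq_continuous_at)
  then show ?thesis by (rule isCont_tendsto_compose[OF _ dilation_tendsto_0])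
qed

lemma Y_tendsto: "((\<lambda>t. Y j (dilation w t x)) \<longlongrightarrow> axis j 1) (at 0)"
proof -
  have "isCont (Y j) 0"
    using \<rho>_pos smooth_on_continuous[OF Y_smooth[of j]] by (simp add: continuous_on_eq_continuous_at)
  from isCont_tendsto_compose[OF this dilation_tendsto_0] show ?thesis by (simp add: Y_0)
qed

text \<open>Component \<open>k\<close> of the rescaled bracket retains the positive power
  \<open>w i + w j - w k\<close> of \<open>t\<close>, which makes the limit zero.\<close>

lemma model_bracket_high:
  assumes "\<And>k. w k < w i + w j"
  shows "vfield_bracket (model i) (model j) x = 0"
  unfolding vec_eq_iff
proof
  fix k
  let ?V = "vfield_bracket (Y i) (Y j)"
  have e: "blowup_bracket i j (t * 1, x) $ k = t ^ (w i + w j - w k) * ?V (dilation w t x) $ k"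
    if "t \<noteq> 0" "(t, x) \<in> dilation_dom \<rho>" for t
  proof -
    have "t ^ (w i + w j) = t ^ w k * t ^ (w i + w j - w k)"
      using assms[of k] by (simp add: power_add[symmetric])
    with blowup_bracket_eq[OF that(2), of k i j]
    have "t ^ w k * blowup_bracket i j (t * 1, x) $ k = t ^ w k * (t ^ (w i + w j - w k) * ?V (dilation w t x) $ k)"
      by (simp only: mult.assoc mult_1_right)
    moreover have "t ^ w k \<noteq> 0" using that(1) by simp
    ultimately show ?thesis by (rule mult_left_cancel[THEN iffD1, rotated])
  qed
  have "blowup_bracket i j (0, x) $ k = 0 ^ (w i + w j - w k) * ?V 0 $ k"
    by (rule eq_by_punctured_limit[OF tendsto_vec_nth[OF tendsto_slice[OF blowup_bracket_continuous]]
       tendsto_mult[OF tendsto_power[OF tendsto_ident_at] tendsto_vec_nth[OF vfield_bracket_tendsto]]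
       eventually_in_dom[OF e]])
  then show "vfield_bracket (model i) (model j) x $ k = 0 $ k"
    using assms[of k] by (simp add: blowup_bracket_0 zero_power)
qed

text \<open>The frame expansion of the bracket is rescaled term by term. A term of weight below
  \<open>w i + w j\<close> keeps a positive power of \<open>t\<close> and disappears,
  \<open>c0\<close> excludes the weights above, and the others converge with coefficients taken at
  0, where the frame is the standard basis.\<close>

lemma model_bracket_low:
  assumes c: "\<And>x. x \<in> ball 0 \<rho> \<Longrightarrow> vfield_bracket (Y i) (Y j) x = (\<Sum>l\<in>UNIV. c x l *\<^sub>R Y l x)"
    and c0: "\<And>x l. x \<in> ball 0 \<rho> \<Longrightarrow> w i + w j < w l \<Longrightarrow> c x l = 0"
  shows "vfield_bracket (model i) (model j) x =
    (\<Sum>l | w l = w i + w j. vfield_bracket (Y i) (Y j) 0 $ l *\<^sub>R model l x)"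
  unfolding vec_eq_iff
proof
  fix k
  let ?V = "vfield_bracket (Y i) (Y j)" and ?s = "w i + w j"
  define T where "T = (\<lambda>l t. if w l \<le> ?s then t ^ (?s - w l) * c (dilation w t x) l * blowup l (t * 1, x) $ k else 0)"
  have e: "blowup_bracket i j (t * 1, x) $ k = (\<Sum>l\<in>UNIV. T l t)"
    if "t \<noteq> 0" and tx: "(t, x) \<in> dilation_dom \<rho>" for t
  proof -
    have "t ^ w k * blowup_bracket i j (t, x) $ k = t ^ ?s * (\<Sum>l\<in>UNIV. c (dilation w t x) l * Y l (dilation w t x) $ k)"
      unfolding blowup_bracket_eq[OF tx] c[OF in_ball[OF tx]] by simp
    also have "\<dots> = t ^ w k * (\<Sum>l\<in>UNIV. T l t)"
      unfolding sum_distrib_left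
    proof (rule sum.cong[OF refl])
      fix l
      show "t ^ ?s * (c (dilation w t x) l * Y l (dilation w t x) $ k) = t ^ w k * T l t"
      proof (cases "w l \<le> ?s")
        case True
        then have "t ^ ?s = t ^ (?s - w l) * t ^ w l" by (simp add: power_add[symmetric])
        then have "t ^ ?s * (c (dilation w t x) l * Y l (dilation w t x) $ k) =
          t ^ (?s - w l) * c (dilation w t x) l * (t ^ w l * Y l (dilation w t x) $ k)"
          by (simp only: mult_ac)
        also have "\<dots> = t ^ (?s - w l) * c (dilation w t x) l * (t ^ w k * blowup l (t, x) $ k)"
          by (simp only: blowup_eq[OF tx])
        finally show ?thesis using True by (simp add: T_def mult_ac)
      next
        case False
        then show ?thesis using c0[OF in_ball[OF tx], of l] by (simp add: T_def)
      qed
    qed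
    finally have "t ^ w k * blowup_bracket i j (t * 1, x) $ k = t ^ w k * (\<Sum>l\<in>UNIV. T l t)"
      by (simp only: mult_1_right)
    moreover have "t ^ w k \<noteq> 0" using that(1) by simp
    ultimately show ?thesis by (rule mult_left_cancel[THEN iffD1, rotated])
  qed
  have clim: "((\<lambda>t. c (dilation w t x) l) \<longlongrightarrow> ?V 0 $ l) (at 0)" for l
  proof (rule frame_coeff_tendsto[OF Y_tendsto vfield_bracket_tendsto])
    show "\<forall>\<^sub>F t in at 0. ?V (dilation w t x) = (\<Sum>l\<in>UNIV. c (dilation w t x) l *\<^sub>R Y l (dilation w t x))"
      using eventually_in_dilation_dom[OF \<rho>_pos, of x]
      by eventually_elim (rule c[OF in_ball])
  qed
  have "(T l \<longlongrightarrow> (if w l = ?s then ?V 0 $ l * model l x $ k else 0)) (at 0)" for l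
  proof (cases "w l \<le> ?s")
    case True
    have "((\<lambda>t. t ^ (?s - w l) * c (dilation w t x) l * blowup l (t * 1, x) $ k) \<longlongrightarrow>
       0 ^ (?s - w l) * ?V 0 $ l * model l x $ k) (at 0)"
      by (intro tendsto_intros clim blowup_tendsto)
    then show ?thesis using True by (cases "w l = ?s") (simp_all add: T_def zero_power)
  next
    case False
    then show ?thesis by (simp add: T_def)
  qed
  then have "((\<lambda>t. \<Sum>l\<in>UNIV. T l t) \<longlongrightarrow> (\<Sum>l\<in>UNIV. if w l = ?s then ?V 0 $ l * model l x $ k else 0)) (at 0)"
    by (intro tendsto_sum)
  from eq_by_punctured_limit[OF tendsto_vec_nth[OF tendsto_slice[OF blowup_bracket_continuous]] this
    eventually_in_dom[OF e]]
  have "blowup_bracket i j (0, x) $ k = (\<Sum>l\<in>UNIV. if w l = ?s then ?V 0 $ l * model l x $ k else 0)" .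
  then show "vfield_bracket (model i) (model j) x $ k = (\<Sum>l | w l = ?s. ?V 0 $ l *\<^sub>R model l x) $ k"
    by (simp add: blowup_bracket_0 sum.inter_filter[symmetric])
qed

end

section \<open>The exponential map of a graded family of vector fields\<close>

context weighted
begin

text \<open>Induction on the weight: once the lighter components vanish identically, component
  \<open>k\<close> has derivative 0 and starts at 0. This is the uniqueness principle for the
  differential equations below; the bound \<open>m\<close> admits equations that are controlled only
  up to some weight.\<close>

lemma triangular_ode_zero:
  fixes \<Delta> :: "real \<Rightarrow> real ^ 'n"
  assumes "\<Delta> 0 = 0"
    and d: "\<And>t. t \<in> {0..1} \<Longrightarrow> (\<Delta> has_vector_derivative D t) (at t within {0..1})"
    and tri: "\<And>k t. w k \<le> m \<Longrightarrow> t \<in> {0..1} \<Longrightarrow> (\<And>l. w l < w k \<Longrightarrow> \<Delta> t $ l = 0) \<Longrightarrow> D t $ k = 0"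
    and "w k \<le> m" "t \<in> {0..1}"
  shows "\<Delta> t $ k = 0"
  using assms(4,5)
proof (induction "w k" arbitrary: k t rule: less_induct)
  case less
  have "((\<lambda>t. \<Delta> t $ k) has_derivative (\<lambda>h. 0)) (at s within {0..1})" if s: "s \<in> {0..1}" for s
  proof -
    have "D s $ k = 0" using less s by (intro tri) auto
    moreover have "((\<lambda>t. \<Delta> t $ k) has_vector_derivative D s $ k) (at s within {0..1})"
      by (rule bounded_linear.has_vector_derivative[OF bounded_linear_vec_nth d[OF s]])
    ultimately show ?thesis by (simp add: has_vector_derivative_def)
  qed
  then have "\<Delta> t $ k = \<Delta> 0 $ k"
    by (intro has_derivative_zero_unique[of "{0..1}" "\<lambda>t. \<Delta> t $ k"]) (use less.prems in auto)
  then show ?case using assms(1) by simp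
qed

end

locale graded_fields = weighted w for w :: "'n::finite \<Rightarrow> nat" +
  fixes Z :: "'n \<Rightarrow> real ^ 'n \<Rightarrow> real ^ 'n" and r :: nat
  assumes Z_smooth: "smooth_on UNIV (Z j)"
    and Z_scaling: "s ^ w j * Z j (dilation w s x) $ k = s ^ w k * Z j x $ k"
    and Z_0: "Z j 0 = axis j 1"
    and w_le: "w j \<le> r"
begin

lemma Z_nth_smooth: "smooth_on UNIV (\<lambda>x. Z j x $ k)"
  by (intro smooth_on_vec_nth Z_smooth open_UNIV)

lemma Z_low: "w k < w j \<Longrightarrow> Z j x $ k = 0"
  by (rule scaling_zero[OF smooth_on_continuous[OF Z_nth_smooth] Z_scaling])

lemma Z_homogeneous: "w j \<le> w k \<Longrightarrow> homogeneous (w k - w j) (\<lambda>x. Z j x $ k)"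
  by (rule scaling_homogeneous[OF smooth_on_continuous[OF Z_nth_smooth] Z_scaling])

lemma Z_same: "w k = w j \<Longrightarrow> Z j x $ k = (if j = k then 1 else 0)"
  using homogeneous_0_const[of "\<lambda>x. Z j x $ k" x] Z_homogeneous[of j k] by (simp add: Z_0 axis_def)

text \<open>Component \<open>k\<close> of \<open>Z j\<close> has degree \<open>w k - w j\<close>,
  less than \<open>w k\<close> as weights are positive, so it involves only coordinates of smaller
  weight.\<close>

lemma Z_depends:
  assumes "\<And>l. w l < w k \<Longrightarrow> x $ l = y $ l" shows "Z j x $ k = Z j y $ k"
proof (cases "w k < w j")
  case False
  then show ?thesis using w_pos[of j]
    by (intro homogeneous_depends[OF Z_nth_smooth Z_homogeneous] assms) auto
qed (simp add: Z_low)

lemma FD_Z_depends: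
  assumes "\<And>l. w l < w k \<Longrightarrow> v $ l = 0" shows "FD (Z j) x v $ k = 0"
proof -
  have "FD (\<lambda>x. Z j x $ k) x v = (\<Sum>l\<in>UNIV. v $ l *\<^sub>R FD (\<lambda>x. Z j x $ k) x (axis l 1))"
    by (rule FD_linear_sum[OF smooth_on_differentiable[OF Z_nth_smooth UNIV_I]])
  also have "\<dots> = 0"
  proof (rule sum.neutral, rule ballI)
    fix l
    show "v $ l *\<^sub>R FD (\<lambda>x. Z j x $ k) x (axis l 1) = 0"
    proof (cases "w k < w j")
      case True
      then show ?thesis by (simp add: Z_low)
    next
      case False
      show ?thesis
      proof (cases "w k - w j < w l")
        case True
        then show ?thesis using False homogeneous_partial_high[OF Z_nth_smooth Z_homogeneous] by simp
      next
        case f: False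
        then have "w l < w k" using False w_pos[of j] by linarith
        then show ?thesis using assms by simp
      qed
    qed
  qed
  finally show ?thesis
    unfolding FD_vec_nth[OF smooth_on_differentiable[OF Z_smooth UNIV_I]] .
qed

definition comb :: "real ^ 'n \<Rightarrow> real ^ 'n \<Rightarrow> real ^ 'n" where
  "comb x y = (\<Sum>j\<in>UNIV. x $ j *\<^sub>R Z j y)"

lemma comb_nth: "comb x y $ k = (\<Sum>j\<in>UNIV. x $ j * Z j y $ k)"
  by (simp add: comb_def)

lemma comb_axis: "comb (axis j 1) y = Z j y"
  by (simp add: comb_def axis_def if_distrib[of "\<lambda>c. c *\<^sub>R _"] cong: if_cong)

lemma bounded_linear_comb: "bounded_linear (\<lambda>x. comb x y)"
  unfolding comb_def
  by (intro bounded_linear_sum bounded_linear_compose[OF bounded_linear_scaleR_left bounded_linear_vec_nth])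

lemma smooth_on_comb:
  assumes "open S" "smooth_on S f" "smooth_on S g"
  shows "smooth_on S (\<lambda>p. comb (f p) (g p))"
  unfolding comb_def
  by (intro smooth_on_sum smooth_on_scaleR smooth_on_vec_nth assms
    smooth_on_compose[OF assms(1) open_UNIV assms(3) Z_smooth] UNIV_I)

lemma comb_has_derivative:
  "(comb x has_derivative (\<lambda>v. \<Sum>j\<in>UNIV. x $ j *\<^sub>R FD (Z j) y v)) (at y)"
  unfolding comb_def[abs_def]
  by (intro has_derivative_sum has_derivative_scaleR_right smooth_on_has_derivative[OF Z_smooth] UNIV_I)

lemma FD_comb: "FD (comb x) y v = (\<Sum>j\<in>UNIV. x $ j *\<^sub>R FD (Z j) y v)"
  by (simp add: FD_eq[OF comb_has_derivative])

lemma FD_comb_has_derivative: "(comb x has_derivative FD (comb x) y) (at y)"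
  unfolding FD_eq[OF comb_has_derivative] by (rule comb_has_derivative)

lemma FD_comb_depends:
  "(\<And>l. w l < w k \<Longrightarrow> v $ l = 0) \<Longrightarrow> FD (comb x) y v $ k = 0"
  by (simp add: FD_comb FD_Z_depends)

text \<open>By \<open>Z_same\<close> and \<open>Z_low\<close> the coordinate \<open>x $ k\<close>
  enters through the single term \<open>j = k\<close>, with coefficient 1; the rest of component
  \<open>k\<close> depends on lighter coordinates. Hence each Picard step settles the components of
  at least one more weight.\<close>

lemma comb_depends:
  assumes "\<And>l. w l < w k \<Longrightarrow> x $ l = x' $ l" "\<And>l. w l < w k \<Longrightarrow> y $ l = y' $ l"
  shows "comb x y $ k - comb x' y' $ k = x $ k - x' $ k"
proof -
  have "x $ j * Z j y $ k - x' $ j * Z j y' $ k = (if j = k then x $ k - x' $ k else 0)" for j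
  proof -
    consider "w j < w k" | "w j = w k" | "w k < w j" by linarith
    then show ?thesis
    proof cases
      case 1
      then show ?thesis using assms(1)[OF 1] Z_depends[of k y y' j] assms(2) by auto
    qed (auto simp: Z_same Z_low)
  qed
  then show ?thesis by (simp add: comb_nth sum_subtractf[symmetric])
qed

text \<open>Since the fields are triangular, the Picard iteration becomes stationary after \<open>r\<close> steps; the same
  holds for the iteration that inverts the exponential map.\<close>

fun picard :: "nat \<Rightarrow> real \<times> (real ^ 'n) \<Rightarrow> real ^ 'n" where
  "picard 0 = (\<lambda>p. 0)"
| "picard (Suc m) = t_primitive (\<lambda>p. comb (snd p) (picard m p))"

lemma smooth_on_picard: "smooth_on UNIV (picard m)"
proof (induction m)
  case (Suc m)
  then show ?case unfolding picard.simps
    by (intro smooth_on_t_primitive smooth_on_comb smooth_on_snd smooth_on_id open_UNIV)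
qed (auto intro: smooth_on_const)

lemma picard_stable: "w k \<le> m \<Longrightarrow> picard m p $ k = picard (Suc m) p $ k"
proof (induction m arbitrary: k p)
  case 0
  then show ?case using w_pos[of k] by simp
next
  case (Suc m)
  have nth: "t_primitive h p $ k = t_primitive (\<lambda>p. h p $ k) p"
    if "smooth_on UNIV h" for h :: "real \<times> (real ^ 'n) \<Rightarrow> real ^ 'n"
  proof -
    have "(\<lambda>s. h (s * fst p, snd p)) integrable_on {0..1}"
      by (intro integrable_continuous_interval continuous_on_compose2[OF smooth_on_continuous[OF that]]
        continuous_intros) auto
    from integral_linear[OF this bounded_linear_vec_nth[of k]] show ?thesis
      by (simp add: t_primitive_def o_def)
  qed
  have s: "smooth_on UNIV (\<lambda>p. comb (snd p) (picard m p))" for m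
    by (intro smooth_on_comb smooth_on_snd smooth_on_id open_UNIV smooth_on_picard)
  have "comb (snd p) (picard m p) $ k - comb (snd p) (picard (Suc m) p) $ k = snd p $ k - snd p $ k" for p
    by (rule comb_depends) (use Suc in auto)
  then have "(\<lambda>p. comb (snd p) (picard m p) $ k) = (\<lambda>p. comb (snd p) (picard (Suc m) p) $ k)"
    by auto
  then show ?case unfolding picard.simps(2)[of "Suc m"] picard.simps(2)[of m] nth[OF s]
    unfolding picard.simps(2)[of m, symmetric] nth[OF s] by simp
qed

definition flow :: "real \<times> (real ^ 'n) \<Rightarrow> real ^ 'n" where
  "flow = picard r"

lemma smooth_on_flow: "smooth_on UNIV flow"
  unfolding flow_def by (rule smooth_on_picard)

lemma smooth_on_flow_field: "smooth_on UNIV (\<lambda>p. comb (snd p) (flow p))"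
  by (intro smooth_on_comb smooth_on_snd smooth_on_id open_UNIV smooth_on_flow)

lemma flow_eq: "flow = t_primitive (\<lambda>p. comb (snd p) (flow p))"
proof -
  have "picard r = picard (Suc r)" using picard_stable[OF w_le] by (auto simp: vec_eq_iff)
  then show ?thesis by (simp add: flow_def)
qed

lemma flow_0: "flow (0, x) = 0"
  by (subst flow_eq) (rule t_primitive_0)

lemma flow_has_vector_derivative:
  "((\<lambda>t. flow (t, x)) has_vector_derivative comb x (flow (t, x))) (at t)"
  using t_primitive_has_vector_derivative[OF smooth_on_flow_field, of x t]
  unfolding flow_eq[symmetric] by simp

section \<open>The exponential map and its inverse\<close>

definition Exp :: "real ^ 'n \<Rightarrow> real ^ 'n" where
  "Exp x = flow (1, x)"

lemma smooth_on_Exp: "smooth_on UNIV Exp"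
  unfolding Exp_def[abs_def]
  by (rule smooth_on_compose[OF open_UNIV open_UNIV _ smooth_on_flow])
    (auto intro!: smooth_on_Pair smooth_on_const smooth_on_id)

lemma flow_unique:
  assumes "\<gamma> 0 = 0" "\<And>t. t \<in> {0..1} \<Longrightarrow> (\<gamma> has_vector_derivative comb x (\<gamma> t)) (at t within {0..1})"
    and t: "t \<in> {0..1}"
  shows "\<gamma> t = flow (t, x)"
  unfolding vec_eq_iff
proof
  fix k
  have "(\<lambda>t. \<gamma> t - flow (t, x)) t $ k = 0"
  proof (rule triangular_ode_zero[where m=r])
    show "((\<lambda>t. \<gamma> t - flow (t, x)) has_vector_derivative comb x (\<gamma> t) - comb x (flow (t, x))) (at t within {0..1})"
      if "t \<in> {0..1}" for t
      by (intro has_vector_derivative_diff assms(2) that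
        has_vector_derivative_at_within[OF flow_has_vector_derivative])
    show "(comb x (\<gamma> t) - comb x (flow (t, x))) $ k = 0"
      if "\<And>l. w l < w k \<Longrightarrow> (\<gamma> t - flow (t, x)) $ l = 0" for k t
      using comb_depends[of k x x "\<gamma> t" "flow (t, x)"] that by simp
  qed (use assms flow_0 w_le in auto)
  then show "\<gamma> t $ k = flow (t, x) $ k" by simp
qed

lemma exp_map_eq: "exp_map Z = Exp"
proof
  fix x
  show "exp_map Z x = Exp x"
    unfolding exp_map_def time_one_flow_def comb_def[symmetric]
  proof (rule the_equality)
    show "\<exists>\<gamma>. \<gamma> 0 = 0 \<and> \<gamma> 1 = Exp x \<and>
      (\<forall>t\<in>{0..1}. (\<gamma> has_vector_derivative comb x (\<gamma> t)) (at t within {0..1}))"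
      by (rule exI[of _ "\<lambda>t. flow (t, x)"])
        (auto simp: flow_0 Exp_def intro: has_vector_derivative_at_within[OF flow_has_vector_derivative])
    show "y = Exp x" if "\<exists>\<gamma>. \<gamma> 0 = 0 \<and> \<gamma> 1 = y \<and>
      (\<forall>t\<in>{0..1}. (\<gamma> has_vector_derivative comb x (\<gamma> t)) (at t within {0..1}))" for y
    proof -
      from that obtain \<gamma> where "\<gamma> 0 = 0" "\<gamma> 1 = y"
        "\<And>t. t \<in> {0..1} \<Longrightarrow> (\<gamma> has_vector_derivative comb x (\<gamma> t)) (at t within {0..1})" by blast
      then show ?thesis using flow_unique[of \<gamma> x 1] by (simp add: Exp_def)
    qed
  qed
qed

text \<open>The dilated flow of \<open>x\<close> solves the equation for
  \<open>dilation w s x\<close>, because the weights of the coefficients \<open>x $ j\<close>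
  compensate those of the fields \<open>Z j\<close>; uniqueness identifies the two curves.\<close>

lemma Exp_homogeneous: "w_homogeneous w Exp"
  unfolding w_homogeneous_def
proof (intro allI)
  fix s x
  have "dilation w s (flow (1, x)) = flow (1, dilation w s x)"
  proof (rule flow_unique)
    fix t :: real
    have "comb (dilation w s x) (dilation w s y) = dilation w s (comb x y)" for y
      unfolding vec_eq_iff
    proof
      fix k
      have "(s ^ w j * x $ j) * Z j (dilation w s y) $ k = s ^ w k * (x $ j * Z j y $ k)" for j
        using arg_cong[OF Z_scaling[of s j y k], of "\<lambda>z. x $ j * z"] by (simp only: mult_ac)
      then show "comb (dilation w s x) (dilation w s y) $ k = dilation w s (comb x y) $ k"
        unfolding comb_nth dilation_nth sum_distrib_left by (rule sum.cong[OF refl])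
    qed
    then show "((\<lambda>t. dilation w s (flow (t, x))) has_vector_derivative
        comb (dilation w s x) (dilation w s (flow (t, x)))) (at t within {0..1})"
      using bounded_linear.has_vector_derivative[OF bounded_linear_dilation
        has_vector_derivative_at_within[OF flow_has_vector_derivative]] by simp
  qed (auto simp: flow_0)
  then show "Exp (dilation w s x) = dilation w s (Exp x)" by (simp add: Exp_def)
qed

lemma Exp_triangular:
  assumes "\<And>l. w l < w k \<Longrightarrow> x $ l = x' $ l"
  shows "Exp x $ k - x $ k = Exp x' $ k - x' $ k"
proof -
  \<comment> \<open>Subtracting the linear term removes the diagonal contribution found in
    \<open>comb_depends\<close>, which makes the equation for \<open>\<Delta>\<close> triangular up
    to weight \<open>w k\<close>.\<close>
  define \<Delta> where "\<Delta> = (\<lambda>t. flow (t, x) - flow (t, x') - t *\<^sub>R (x - x'))"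
  have "\<Delta> 1 $ k = 0"
  proof (rule triangular_ode_zero[where m="w k"])
    show "(\<Delta> has_vector_derivative comb x (flow (t, x)) - comb x' (flow (t, x')) - (x - x')) (at t within {0..1})"
      for t unfolding \<Delta>_def
      by (intro has_vector_derivative_diff has_vector_derivative_at_within[OF flow_has_vector_derivative])
        (auto intro!: derivative_eq_intros)
    show "(comb x (flow (t, x)) - comb x' (flow (t, x')) - (x - x')) $ j = 0"
      if "w j \<le> w k" "\<And>l. w l < w j \<Longrightarrow> \<Delta> t $ l = 0" for j t
    proof -
      have "comb x (flow (t, x)) $ j - comb x' (flow (t, x')) $ j = x $ j - x' $ j"
      proof (rule comb_depends)
        fix l assume l: "w l < w j"
        then show "x $ l = x' $ l" using assms that(1) by simp
        then show "flow (t, x) $ l = flow (t, x') $ l" using that(2)[OF l] by (simp add: \<Delta>_def)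
      qed
      then show ?thesis by simp
    qed
  qed (auto simp: \<Delta>_def flow_0)
  then show ?thesis by (simp add: \<Delta>_def Exp_def)
qed

text \<open>A fixed point of \<open>x \<mapsto> y - (Exp x - x)\<close> is a preimage of
  \<open>y\<close>; by \<open>Exp_triangular\<close> each component of \<open>Exp x - x\<close>
  depends on lighter coordinates only.\<close>

fun Log_iter :: "nat \<Rightarrow> real ^ 'n \<Rightarrow> real ^ 'n" where
  "Log_iter 0 = (\<lambda>y. 0)"
| "Log_iter (Suc m) = (\<lambda>y. y - (Exp (Log_iter m y) - Log_iter m y))"

lemma smooth_on_Log_iter: "smooth_on UNIV (Log_iter m)"
proof (induction m)
  case (Suc m)
  then show ?case unfolding Log_iter.simps
    by (intro smooth_on_diff smooth_on_id open_UNIV smooth_on_compose[OF _ open_UNIV _ smooth_on_Exp] UNIV_I)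
qed (auto intro: smooth_on_const)

lemma Log_iter_stable: "w k \<le> m \<Longrightarrow> Log_iter m y $ k = Log_iter (Suc m) y $ k"
proof (induction m arbitrary: k)
  case 0
  then show ?case using w_pos[of k] by simp
next
  case (Suc m)
  have "Exp (Log_iter m y) $ k - Log_iter m y $ k = Exp (Log_iter (Suc m) y) $ k - Log_iter (Suc m) y $ k"
    by (rule Exp_triangular, rule Suc.IH) (use Suc.prems in simp)
  then show ?case unfolding Log_iter.simps(2)[of "Suc m"] by simp
qed

definition Log :: "real ^ 'n \<Rightarrow> real ^ 'n" where
  "Log = Log_iter r"

lemma Exp_Log: "Exp (Log y) = y"
proof -
  have "Log y = Log_iter (Suc r) y" unfolding Log_def using Log_iter_stable[OF w_le] by (simp add: vec_eq_iff)
  then have "Log y = y - (Exp (Log y) - Log y)" by (simp add: Log_def)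
  then show ?thesis by simp
qed

lemma inj_Exp: "inj Exp"
proof (rule injI)
  fix x x' assume e: "Exp x = Exp x'"
  have "x $ k = x' $ k" for k
  proof (induction "w k" arbitrary: k rule: less_induct)
    case less
    show ?case using Exp_triangular[of k x x'] less e by simp
  qed
  then show "x = x'" by (simp add: vec_eq_iff)
qed

lemma bij_Exp: "bij Exp"
  using inj_Exp Exp_Log by (metis bijI surjI)

lemma inv_Exp: "inv Exp = Log"
  using inj_Exp Exp_Log by (metis inv_f_eq ext)

lemma Log_Exp: "Log (Exp x) = x"
  using inv_Exp inj_Exp by (metis inv_f_f)

lemma smooth_on_Log: "smooth_on UNIV Log"
  unfolding Log_def by (rule smooth_on_Log_iter)

lemma bij_Log: "bij Log"
  using bij_Exp inv_Exp bij_imp_bij_inv by metis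

lemma inv_Log: "inv Log = Exp"
  using bij_Exp inv_Exp inv_inv_eq by metis

lemma Log_homogeneous: "w_homogeneous w Log"
  using Exp_homogeneous Exp_Log Log_Exp unfolding w_homogeneous_def by metis

lemma diffeomorphism_Log: "diffeomorphism Log"
  unfolding diffeomorphism_def inv_Log by (intro conjI bij_Log smooth_on_Log smooth_on_Exp)

lemma polynomial_Log: "polynomial_function Log"
  by (rule w_homogeneous_imp_polynomial[OF smooth_on_Log Log_homogeneous])

end

text \<open>The form of the bracket is that of \<^const>\<open>model_bracket\<close>.\<close>

locale graded_algebra = graded_fields w Z r for w :: "'n::finite \<Rightarrow> nat" and Z r +
  fixes L :: "'n \<Rightarrow> 'n \<Rightarrow> 'n \<Rightarrow> real"
  assumes Z_bracket: "vfield_bracket (Z i) (Z j) y = (\<Sum>l | w l = w i + w j. L i j l *\<^sub>R Z l y)"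
begin

definition br :: "real ^ 'n \<Rightarrow> real ^ 'n \<Rightarrow> real ^ 'n" where
  "br x y = (\<chi> k. \<Sum>(i, j) | w k = w i + w j. x $ i * y $ j * L i j k)"

lemma br_nth: "br x y $ k = (\<Sum>i\<in>UNIV. \<Sum>j\<in>UNIV. x $ i * (y $ j * (if w k = w i + w j then L i j k else 0)))"
proof -
  have "br x y $ k = (\<Sum>(i, j)\<in>UNIV. if w k = w i + w j then x $ i * y $ j * L i j k else 0)"
    by (simp add: br_def sum.inter_filter[symmetric] case_prod_unfold)
  also have "\<dots> = (\<Sum>i\<in>UNIV. \<Sum>j\<in>UNIV. if w k = w i + w j then x $ i * y $ j * L i j k else 0)"
    unfolding UNIV_Times_UNIV[symmetric] sum.cartesian_product[symmetric] by simp
  also have "\<dots> = (\<Sum>i\<in>UNIV. \<Sum>j\<in>UNIV. x $ i * (y $ j * (if w k = w i + w j then L i j k else 0)))"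
    by (intro sum.cong refl) simp
  finally show ?thesis .
qed

lemma bounded_bilinear_br: "bounded_bilinear br"
proof -
  have "bilinear br" unfolding bilinear_def
    by (auto intro!: linearI simp: vec_eq_iff br_nth algebra_simps sum.distrib sum_distrib_left)
  then show ?thesis by (simp add: bilinear_conv_bounded_bilinear)
qed

lemma comb_br: "vfield_bracket (comb u) (comb v) y = comb (br u v) y"
proof -
  have lin: "FD (Z j) y (comb u y) = (\<Sum>i\<in>UNIV. u $ i *\<^sub>R FD (Z j) y (Z i y))" for j u
    using linear_frechet_derivative[OF smooth_on_differentiable[OF Z_smooth UNIV_I]]
    by (simp add: comb_def linear_sum linear_scale)
  have fd: "FD (comb v) y (comb u y) = (\<Sum>j\<in>UNIV. \<Sum>i\<in>UNIV. (u $ i * v $ j) *\<^sub>R FD (Z j) y (Z i y))" for u v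
    by (simp add: FD_comb lin scaleR_sum_right mult.commute)
  have "vfield_bracket (comb u) (comb v) y =
    (\<Sum>i\<in>UNIV. \<Sum>j\<in>UNIV. (u $ i * v $ j) *\<^sub>R FD (Z j) y (Z i y)) -
    (\<Sum>i\<in>UNIV. \<Sum>j\<in>UNIV. (u $ i * v $ j) *\<^sub>R FD (Z i) y (Z j y))"
    unfolding vfield_bracket_def fd by (subst sum.swap) (simp add: mult.commute)
  also have "\<dots> = (\<Sum>i\<in>UNIV. \<Sum>j\<in>UNIV. (u $ i * v $ j) *\<^sub>R vfield_bracket (Z i) (Z j) y)"
    by (simp add: vfield_bracket_def scaleR_diff_right sum_subtractf)
  also have "\<dots> = (\<Sum>i\<in>UNIV. \<Sum>j\<in>UNIV. \<Sum>k\<in>UNIV.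
      (u $ i * (v $ j * (if w k = w i + w j then L i j k else 0))) *\<^sub>R Z k y)"
  proof (intro sum.cong refl)
    fix i j
    have "vfield_bracket (Z i) (Z j) y = (\<Sum>k\<in>UNIV. (if w k = w i + w j then L i j k else 0) *\<^sub>R Z k y)"
      unfolding Z_bracket by (rule sum.mono_neutral_cong_left) auto
    then show "(u $ i * v $ j) *\<^sub>R vfield_bracket (Z i) (Z j) y =
        (\<Sum>k\<in>UNIV. (u $ i * (v $ j * (if w k = w i + w j then L i j k else 0))) *\<^sub>R Z k y)"
      by (simp only: scaleR_sum_right scaleR_scaleR mult.assoc)
  qed
  also have "\<dots> = (\<Sum>k\<in>UNIV. br u v $ k *\<^sub>R Z k y)"
    unfolding br_nth scaleR_sum_left
    by (rule trans[OF sum.cong[OF refl sum.swap] sum.swap])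
  finally show ?thesis by (simp add: comb_def)
qed

section \<open>The differential of the exponential map\<close>

definition ad :: "real ^ 'n \<Rightarrow> nat \<Rightarrow> real ^ 'n \<Rightarrow> real ^ 'n" where
  "ad x k = br x ^^ k"

lemma ad_0 [simp]: "ad x 0 u = u"
  and ad_Suc: "ad x (Suc k) u = br x (ad x k u)"
  by (simp_all add: ad_def)

lemma linear_ad: "linear (ad x k)"
proof (induction k)
  case (Suc k)
  have "linear (br x)" using bounded_bilinear_br
    by (simp add: bilinear_conv_bounded_bilinear[symmetric] bilinear_def)
  from linear_compose[OF Suc this] show ?case by (simp add: ad_Suc[abs_def] o_def)
qed (simp add: linear_iff)

text \<open>Each bracket with \<open>x\<close> raises the weight by at least 1.\<close>

lemma ad_low: "w j \<le> k \<Longrightarrow> ad x k u $ j = 0"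
proof (induction k arbitrary: j)
  case 0
  then show ?case using w_pos[of j] by simp
next
  case (Suc k)
  have "x $ i * (ad x k u $ l * (if w j = w i + w l then L i l j else 0)) = 0" for i l
    using Suc w_pos[of i] by auto
  then show ?case unfolding ad_Suc br_nth by (intro sum.neutral ballI)
qed

lemma ad_nilpotent: "r \<le> k \<Longrightarrow> ad x k u = 0"
  using ad_low w_le by (simp add: vec_eq_iff) (meson le_trans)

text \<open>The integral of \<open>exp (- s * ad x) u\<close> over \<open>s\<close> from 0 to
  \<open>t\<close>, a finite sum by nilpotency; at \<open>t = 1\<close> it is
  \<open>(1 - exp (- ad x)) / ad x\<close> applied to \<open>u\<close>.\<close>

definition dexp_curve :: "real ^ 'n \<Rightarrow> real ^ 'n \<Rightarrow> real \<Rightarrow> real ^ 'n" where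
  "dexp_curve x u t = (\<Sum>k<r. ((- 1) ^ k * t ^ Suc k / fact (Suc k)) *\<^sub>R ad x k u)"

lemma dexp_curve_has_vector_derivative:
  "(dexp_curve x u has_vector_derivative u - br x (dexp_curve x u t)) (at t)"
proof -
  have br: "br x (\<Sum>k<r. c k *\<^sub>R ad x k u) = (\<Sum>k<r. c k *\<^sub>R ad x (Suc k) u)" for c
    using bounded_bilinear_br by (simp add: bounded_bilinear.sum_right bounded_bilinear.scaleR_right ad_Suc)
  let ?f = "\<lambda>k. ((- 1) ^ k * t ^ k / fact k) *\<^sub>R ad x k u"
  have d: "(dexp_curve x u has_vector_derivative (\<Sum>k<r. ?f k)) (at t)"
    unfolding dexp_curve_def[abs_def]
  proof (intro has_vector_derivative_sum)
    fix k
    have "((\<lambda>t. (- 1) ^ k * t ^ Suc k / fact (Suc k)) has_real_derivative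
        (- 1) ^ k * (real (Suc k) * t ^ k) / fact (Suc k)) (at t)"
      using DERIV_cdivide[OF DERIV_cmult[OF DERIV_pow[of "Suc k" t UNIV]], of "(- 1) ^ k" "fact (Suc k)"]
      by (simp only: diff_Suc_Suc diff_zero)
    also have "(- 1) ^ k * (real (Suc k) * t ^ k) / fact (Suc k) = (- 1) ^ k * t ^ k / fact k"
      by (simp add: divide_simps del: of_nat_Suc)
    finally show "((\<lambda>t. ((- 1) ^ k * t ^ Suc k / fact (Suc k)) *\<^sub>R ad x k u) has_vector_derivative ?f k) (at t)"
      using has_vector_derivative_scaleR[OF _ has_vector_derivative_const[of "ad x k u"]] by fastforce
  qed
  \<comment> \<open>The added term \<open>k = r\<close> is zero by nilpotency and makes room for the
    index shift.\<close>
  have "(\<Sum>k<r. ?f k) = (\<Sum>k<Suc r. ?f k)" by (simp add: ad_nilpotent)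
  also have "\<dots> = u + (\<Sum>k<r. ?f (Suc k))" unfolding sum.lessThan_Suc_shift by simp
  also have "\<dots> = u - br x (dexp_curve x u t)"
    unfolding dexp_curve_def br by (simp add: sum_negf[symmetric] del: fact_Suc)
  finally show ?thesis using d by simp
qed

text \<open>The differential of the exponential map: both sides, along the flow, solve the same linear
  differential equation, which is triangular with respect to the weights.\<close>

lemma FD_Exp: "FD Exp x u = comb (dexp_curve x u 1) (Exp x)"
proof -
  define h where "h = (\<lambda>p. comb (snd p) (flow p))"
  \<comment> \<open>\<open>J\<close> is the variation of the flow when its parameter moves in the
    direction \<open>u\<close>; \<open>K\<close> is the candidate for it.\<close>
  define J where "J = (\<lambda>t. FD flow (t, x) (0, u))"
  define K where "K = (\<lambda>t. comb (dexp_curve x u t) (flow (t, x)))"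
  have hs: "smooth_on UNIV h" unfolding h_def by (rule smooth_on_flow_field)
  have flow_h: "flow = t_primitive h" unfolding h_def by (rule flow_eq)
  have J_h: "J t = t_primitive (\<lambda>p. FD h p (0, u)) (t, x)" for t
    unfolding J_def flow_h by (rule FD_t_primitive_snd[OF hs])
  have FDh: "FD h (t, x) (0, u) = comb u (flow (t, x)) + FD (comb x) (flow (t, x)) (J t)" for t
  proof -
    have "((\<lambda>y. comb y (flow (t, y))) has_derivative
       (\<lambda>v. \<Sum>j\<in>UNIV. x $ j *\<^sub>R FD (Z j) (flow (t, x)) (FD flow (t, x) (0, v)) + v $ j *\<^sub>R Z j (flow (t, x)))) (at x)"
      unfolding comb_def
      by (intro has_derivative_sum has_derivative_scaleR
        bounded_linear_imp_has_derivative[OF bounded_linear_vec_nth]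
        diff_chain_at[unfolded o_def, OF smooth_on_has_derivative_snd[OF smooth_on_flow UNIV_I]
          smooth_on_has_derivative[OF Z_smooth UNIV_I]])
    from FD_eq[OF this] FD_eq[OF smooth_on_has_derivative_snd[OF hs UNIV_I], of t x]
    have "FD h (t, x) (0, u) =
       (\<Sum>j\<in>UNIV. x $ j *\<^sub>R FD (Z j) (flow (t, x)) (FD flow (t, x) (0, u)) + u $ j *\<^sub>R Z j (flow (t, x)))"
      by (simp add: h_def) metis
    then show ?thesis by (simp add: FD_comb comb_def J_def sum.distrib add.commute)
  qed
  have dJ: "(J has_vector_derivative comb u (flow (t, x)) + FD (comb x) (flow (t, x)) (J t)) (at t)" for t
    using t_primitive_has_vector_derivative[OF smooth_on_FD[OF hs], of "(0, u)" x t]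
    unfolding J_h[symmetric] FDh .
  have dK: "(K has_vector_derivative comb u (flow (t, x)) + FD (comb x) (flow (t, x)) (K t)) (at t)" for t
  proof -
    let ?a = "dexp_curve x u" and ?y = "flow (t, x)"
    have "((\<lambda>t. \<Sum>j\<in>UNIV. ?a t $ j *\<^sub>R Z j (flow (t, x))) has_vector_derivative
      (\<Sum>j\<in>UNIV. ?a t $ j *\<^sub>R FD (Z j) ?y (comb x ?y) + (u - br x (?a t)) $ j *\<^sub>R Z j ?y)) (at t)"
    proof (intro has_vector_derivative_sum has_vector_derivative_scaleR)
      fix j
      show "((\<lambda>t. ?a t $ j) has_real_derivative (u - br x (?a t)) $ j) (at t)"
        unfolding has_real_derivative_iff_has_vector_derivative
        by (rule bounded_linear.has_vector_derivative[OF bounded_linear_vec_nth dexp_curve_has_vector_derivative])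
      show "((\<lambda>t. Z j (flow (t, x))) has_vector_derivative FD (Z j) ?y (comb x ?y)) (at t)"
        using vector_derivative_diff_chain_within[OF flow_has_vector_derivative,
          of "Z j" "FD (Z j) ?y"] smooth_on_has_derivative[OF Z_smooth UNIV_I, of j ?y]
        by (auto simp: o_def intro: has_derivative_at_withinI)
    qed
    then have "(K has_vector_derivative FD (comb (?a t)) ?y (comb x ?y) + comb (u - br x (?a t)) ?y) (at t)"
      by (simp add: K_def comb_def FD_comb sum.distrib)
    \<comment> \<open>Exchanging the two fields costs \<open>comb (br x (?a t))\<close>, which the
      term \<open>- br x (?a t)\<close> in the derivative of \<open>dexp_curve\<close>
      cancels.\<close>
    moreover have "FD (comb (?a t)) ?y (comb x ?y) = comb (br x (?a t)) ?y + FD (comb x) ?y (comb (?a t) ?y)"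
      using comb_br[of x "?a t" ?y] by (simp add: vfield_bracket_def algebra_simps)
    moreover have "comb (u - br x (?a t)) ?y = comb u ?y - comb (br x (?a t)) ?y"
      by (rule linear_diff[OF bounded_linear.linear[OF bounded_linear_comb]])
    ultimately show ?thesis by (simp add: K_def add.commute)
  qed
  have "(J 1 - K 1) $ k = 0" for k
  proof (rule triangular_ode_zero[where m=r and \<Delta>="\<lambda>t. J t - K t"])
    show "J 0 - K 0 = 0" unfolding J_h t_primitive_0 K_def dexp_curve_def by (simp add: comb_def)
    show "((\<lambda>t. J t - K t) has_vector_derivative FD (comb x) (flow (t, x)) (J t - K t)) (at t within {0..1})" for t
      using has_vector_derivative_diff[OF dJ dK, of t]
        linear_diff[OF has_derivative_linear[OF FD_comb_has_derivative]]
      by (simp add: has_vector_derivative_at_within)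
    show "FD (comb x) (flow (t, x)) (J t - K t) $ k = 0"
      if "\<And>l. w l < w k \<Longrightarrow> (J t - K t) $ l = 0" for k t
      by (rule FD_comb_depends) (rule that)
  qed (use w_le in auto)
  then have "J 1 = K 1" by (simp add: vec_eq_iff)
  moreover have "FD Exp x u = J 1"
    unfolding Exp_def[abs_def] J_def FD_eq[OF smooth_on_has_derivative_snd[OF smooth_on_flow UNIV_I]] ..
  ultimately show ?thesis by (simp add: K_def Exp_def)
qed

end

section \<open>The linear part of the Dynkin product\<close>

abbreviation fps_coeff :: "real fps \<Rightarrow> nat \<Rightarrow> real" (infixl "$$" 90) where
  "F $$ n \<equiv> fps_nth F n"

text \<open>An index \<open>(p\<^sub>1, q\<^sub>1), \<dots>, (p\<^sub>k, q\<^sub>k)\<close> of Dynkin's sum is a factorization into \<open>k\<close> blocks of the word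
  \<open>x\<^sup>p\<^sup>1 y\<^sup>q\<^sup>1 \<dots> x\<^sup>p\<^sup>k y\<^sup>q\<^sup>k\<close>, where \<open>False\<close> stands for \<open>x\<close> and \<open>True\<close> for \<open>y\<close>. Only the words \<open>x\<^sup>n y\<close> and
  \<open>x\<^sup>n y x\<close> contribute to the linear part in \<open>y\<close>.\<close>

fun block_word :: "(nat \<times> nat) list \<Rightarrow> bool list" where
  "block_word [] = []"
| "block_word ((p, q) # ps) = replicate p False @ replicate q True @ block_word ps"

definition proper_blocks :: "(nat \<times> nat) list \<Rightarrow> bool" where
  "proper_blocks ps \<longleftrightarrow> (\<forall>(p, q)\<in>set ps. 1 \<le> p + q)"

definition block_weight :: "(nat \<times> nat) list \<Rightarrow> real" where
  "block_weight ps = 1 / (\<Prod>(p, q)\<leftarrow>ps. fact p * fact q)"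

lemma length_block_word: "length (block_word ps) = (\<Sum>(p, q)\<leftarrow>ps. p + q)"
  by (induction ps rule: block_word.induct) auto

lemma block_word_eq_Nil: "proper_blocks ps \<Longrightarrow> block_word ps = [] \<longleftrightarrow> ps = []"
  by (induction ps rule: block_word.induct) (auto simp: proper_blocks_def)

lemma length_le_block_word: "proper_blocks ps \<Longrightarrow> length ps \<le> length (block_word ps)"
  by (induction ps rule: block_word.induct) (auto simp: proper_blocks_def)

lemma block_word_bound: "(p, q) \<in> set ps \<Longrightarrow> p + q \<le> length (block_word ps)"
  by (induction ps rule: block_word.induct) auto

lemma concat_block_word:
  "concat (map (\<lambda>(p, q). replicate p x @ replicate q y) ps) = map (\<lambda>b. if b then y else x) (block_word ps)"
  by (induction ps rule: block_word.induct) auto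

lemma finite_blocks: "finite {ps. proper_blocks ps \<and> length (block_word ps) \<le> r}"
proof (rule finite_subset)
  show "{ps. proper_blocks ps \<and> length (block_word ps) \<le> r} \<subseteq>
      {ps. set ps \<subseteq> {..r} \<times> {..r} \<and> length ps \<le> r}"
    using length_le_block_word block_word_bound by fastforce
  show "finite {ps. set ps \<subseteq> {..r} \<times> {..r} \<and> length ps \<le> r}"
    by (rule finite_lists_length_le) auto
qed

definition blocks_of :: "bool list \<Rightarrow> nat \<Rightarrow> (nat \<times> nat) list set" where
  "blocks_of u k = {ps. proper_blocks ps \<and> length ps = k \<and> block_word ps = u}"

lemma finite_blocks_of: "finite (blocks_of u k)"
  by (rule finite_subset[OF _ finite_blocks[of "length u"]]) (auto simp: blocks_of_def)

text \<open>The coefficient of the word \<open>u\<close> in the \<open>k\<close>-th power of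
  \<open>exp x * exp y - 1\<close>, for noncommuting \<open>x\<close> and \<open>y\<close>.\<close>

definition blocks_sum :: "bool list \<Rightarrow> nat \<Rightarrow> real" where
  "blocks_sum u k = (\<Sum>ps\<in>blocks_of u k. block_weight ps)"

lemma replicate_append_eq_cases:
  assumes "replicate p False @ replicate q True @ rest = replicate n False @ True # s" "1 \<le> p + q"
  shows "(q = 0 \<and> 1 \<le> p \<and> p \<le> n \<and> rest = replicate (n - p) False @ True # s) \<or>
    (p = n \<and> 1 \<le> q \<and> replicate (q - 1) True @ rest = s)"
proof (cases q)
  case 0
  have "p \<le> n"
  proof (rule ccontr)
    assume "\<not> p \<le> n"
    then have "(replicate p False @ rest) ! n = False" by (simp add: nth_append)
    moreover have "(replicate n False @ True # s) ! n = True" by (simp add: nth_append)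
    ultimately show False using assms(1) 0 by simp
  qed
  moreover from this have "replicate n False = replicate p False @ replicate (n - p) False"
    by (simp add: replicate_add[symmetric])
  ultimately show ?thesis using assms 0 by simp
next
  case (Suc q')
  have "p = n"
  proof (rule ccontr)
    assume "p \<noteq> n"
    then consider "p < n" | "n < p" by linarith
    then show False
    proof cases
      case 1
      then have "(replicate n False @ True # s) ! p = False" by (simp add: nth_append)
      moreover have "(replicate p False @ replicate q True @ rest) ! p = True"
        using Suc by (simp add: nth_append)
      ultimately show False using assms(1) by simp
    next
      case 2
      then have "(replicate p False @ replicate q True @ rest) ! n = False" by (simp add: nth_append)
      moreover have "(replicate n False @ True # s) ! n = True" by (simp add: nth_append)
      ultimately show False using assms(1) by simp
    qed
  qed
  then show ?thesis using assms Suc by simp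
qed

text \<open>The first block is split off: it is \<open>x ^ p\<close> with \<open>p \<ge> 1\<close>,
  or else \<open>x ^ n y\<close>, because the word has a single \<open>y\<close>. The recursion is a
  convolution in \<open>n\<close>.\<close>

lemma blocks_sum_Suc:
  assumes s: "True \<notin> set s"
  shows "blocks_sum (replicate n False @ True # s) (Suc k) =
    (\<Sum>p=1..n. blocks_sum (replicate (n - p) False @ True # s) k / fact p) + blocks_sum s k / fact n"
proof -
  let ?u = "\<lambda>n. replicate n False @ True # s"
  let ?A = "\<lambda>p. Cons (p, 0) ` blocks_of (?u (n - p)) k"
  let ?B = "Cons (n, 1) ` blocks_of s k"
  have split: "blocks_of (?u n) (Suc k) = (\<Union>p\<in>{1..n}. ?A p) \<union> ?B"
  proof (intro equalityI subsetI)
    fix ps assume "ps \<in> blocks_of (?u n) (Suc k)"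
    then obtain p q ps' where ps: "ps = (p, q) # ps'" "length ps' = k" "proper_blocks ps'" "1 \<le> p + q"
      "replicate p False @ replicate q True @ block_word ps' = ?u n"
      by (cases ps) (auto simp: blocks_of_def proper_blocks_def)
    from replicate_append_eq_cases[OF ps(5,4)]
    show "ps \<in> (\<Union>p\<in>{1..n}. ?A p) \<union> ?B"
    proof
      assume "q = 0 \<and> 1 \<le> p \<and> p \<le> n \<and> block_word ps' = ?u (n - p)"
      then show ?thesis using ps by (auto simp: blocks_of_def)
    next
      assume a: "p = n \<and> 1 \<le> q \<and> replicate (q - 1) True @ block_word ps' = s"
      then have "q = 1" using s by (cases "q - 1") auto
      then show ?thesis using a ps by (auto simp: blocks_of_def)
    qed
  next
    fix ps assume "ps \<in> (\<Union>p\<in>{1..n}. ?A p) \<union> ?B"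
    then show "ps \<in> blocks_of (?u n) (Suc k)"
    proof
      assume "ps \<in> (\<Union>p\<in>{1..n}. ?A p)"
      then obtain p ps' where p: "ps = (p, 0) # ps'" "ps' \<in> blocks_of (?u (n - p)) k" "1 \<le> p" "p \<le> n" by auto
      moreover have "replicate p False @ replicate (n - p) False = replicate n False"
        using p by (simp add: replicate_add[symmetric])
      then have "replicate p False @ ?u (n - p) = ?u n" by (metis append_assoc)
      ultimately show ?thesis by (auto simp: blocks_of_def proper_blocks_def)
    qed (auto simp: blocks_of_def proper_blocks_def)
  qed
  have inj: "inj_on (Cons a) S" for a :: "nat \<times> nat" and S by (simp add: inj_on_def)
  have sA: "(\<Sum>ps\<in>?A p. block_weight ps) = blocks_sum (?u (n - p)) k / fact p" for p
    by (simp add: sum.reindex[OF inj] blocks_sum_def sum_divide_distrib block_weight_def field_simps)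
  have sB: "(\<Sum>ps\<in>?B. block_weight ps) = blocks_sum s k / fact n"
    by (simp add: sum.reindex[OF inj] blocks_sum_def sum_divide_distrib block_weight_def field_simps)
  have "blocks_sum (?u n) (Suc k) = (\<Sum>ps\<in>(\<Union>p\<in>{1..n}. ?A p). block_weight ps) + (\<Sum>ps\<in>?B. block_weight ps)"
    unfolding blocks_sum_def split by (rule sum.union_disjoint) (auto simp: finite_blocks_of)
  also have "(\<Sum>ps\<in>(\<Union>p\<in>{1..n}. ?A p). block_weight ps) = (\<Sum>p=1..n. \<Sum>ps\<in>?A p. block_weight ps)"
    by (rule sum.UNION_disjoint) (auto simp: finite_blocks_of)
  finally show ?thesis by (simp only: sA sB)
qed

lemma blocks_sum_0: "blocks_sum (replicate n False @ True # s) 0 = 0"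
proof -
  have "blocks_of (replicate n False @ True # s) 0 = {}" by (auto simp: blocks_of_def)
  then show ?thesis by (simp add: blocks_sum_def)
qed

lemma blocks_sum_Nil: "blocks_sum [] k = (if k = 0 then 1 else 0)"
proof -
  have "blocks_of [] k = (if k = 0 then {[]} else {})"
    using block_word_eq_Nil by (auto simp: blocks_of_def proper_blocks_def)
  then show ?thesis by (simp add: blocks_sum_def block_weight_def)
qed

lemma blocks_sum_False: "blocks_sum [False] k = (if k = 1 then 1 else 0)"
proof -
  have only: "ps = [(1, 0)]" if "proper_blocks ps" "block_word ps = [False]" for ps
  proof -
    have "ps \<noteq> []" using that by auto
    then obtain p q ps' where ps: "ps = (p, q) # ps'" by (cases ps) auto
    have pr: "proper_blocks ps'" "1 \<le> p + q" using that ps by (auto simp: proper_blocks_def)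
    have w: "replicate p False @ replicate q True @ block_word ps' = [False]" using that ps by simp
    then have "length (replicate p False @ replicate q True @ block_word ps') = 1" by simp
    then have "p + q + length (block_word ps') = 1" by simp
    then have "length (block_word ps') = 0" "p + q = 1" using pr by linarith+
    then have "block_word ps' = []" "p + q = 1" by simp_all
    moreover have "q = 0" using w calculation by (cases p) auto
    ultimately show ?thesis using ps block_word_eq_Nil[OF pr(1)] by simp
  qed
  have "blocks_of [False] k \<subseteq> {[(1, 0)]}" using only by (auto simp: blocks_of_def)
  moreover have "[(1, 0)] \<in> blocks_of [False] k \<longleftrightarrow> k = 1"
    by (auto simp: blocks_of_def proper_blocks_def)
  ultimately have "blocks_of [False] k = (if k = 1 then {[(1, 0)]} else {})"
    by auto
  then show ?thesis by (simp add: blocks_sum_def block_weight_def)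
qed

section \<open>Generating series of the block sums\<close>

abbreviation fexp :: "real fps" where "fexp \<equiv> fps_exp 1"

lemma fps_exp_minus_1_nth: "(fexp - 1) $$ n = (if n = 0 then 0 else 1 / fact n)"
  by simp

lemma blocks_sum_conv:
  assumes "\<And>m. blocks_sum (replicate m False @ True # s) k = F $$ m"
  shows "(\<Sum>p=1..n. blocks_sum (replicate (n - p) False @ True # s) k / fact p) = ((fexp - 1) * F) $$ n"
proof -
  have "((fexp - 1) * F) $$ n = (\<Sum>p=0..n. (fexp - 1) $$ p * F $$ (n - p))"
    by (simp add: fps_mult_nth)
  also have "\<dots> = (\<Sum>p=1..n. (fexp - 1) $$ p * F $$ (n - p))"
    by (simp add: sum.atLeast_Suc_atMost)
  finally show ?thesis using assms by simp
qed

text \<open>As a series in \<open>n\<close>, each of the first \<open>k\<close> blocks consists of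
  \<open>x\<close> only and contributes \<open>fexp - 1\<close>; the last one,
  \<open>x ^ p y\<close> with \<open>p \<ge> 0\<close>, contributes \<open>fexp\<close>.\<close>

lemma blocks_sum_last:
  "blocks_sum (replicate n False @ [True]) (Suc k) = ((fexp - 1) ^ k * fexp) $$ n"
proof (induction k arbitrary: n)
  case 0
  then show ?case by (simp add: blocks_sum_Suc blocks_sum_0 blocks_sum_Nil)
next
  case (Suc k)
  have "blocks_sum (replicate n False @ [True]) (Suc (Suc k)) =
      ((fexp - 1) * ((fexp - 1) ^ k * fexp)) $$ n"
    by (subst blocks_sum_Suc) (simp_all only: blocks_sum_conv[OF Suc.IH], simp_all add: blocks_sum_Nil)
  then show ?case by (simp add: mult.assoc)
qed

text \<open>Within a block no \<open>x\<close> follows a \<open>y\<close>, so the final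
  \<open>x\<close> is a block of its own: the series of \<open>blocks_sum_last\<close> recurs with
  one block more.\<close>

lemma blocks_sum_last2:
  "blocks_sum (replicate n False @ [True, False]) (Suc (Suc k)) = ((fexp - 1) ^ k * fexp) $$ n"
proof (induction k arbitrary: n)
  case 0
  have "blocks_sum (replicate n False @ [True, False]) (Suc 0) = 0" for n
    by (simp add: blocks_sum_Suc blocks_sum_0 blocks_sum_False)
  then show ?case by (subst blocks_sum_Suc) (simp_all add: blocks_sum_False)
next
  case (Suc k)
  have "blocks_sum (replicate n False @ [True, False]) (Suc (Suc (Suc k))) =
      ((fexp - 1) * ((fexp - 1) ^ k * fexp)) $$ n"
    by (subst blocks_sum_Suc) (simp_all only: blocks_sum_conv[OF Suc.IH], simp_all add: blocks_sum_False)
  then show ?case by (simp add: mult.assoc)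
qed

lemma blocks_sum_last2_1: "blocks_sum (replicate n False @ [True, False]) (Suc 0) = 0"
  by (simp add: blocks_sum_Suc blocks_sum_0 blocks_sum_False)

lemma fps_power_minus_1_nth_0: "n < k \<Longrightarrow> ((fexp - 1) ^ k * F) $$ n = 0"
proof -
  assume "n < k"
  have "((fexp - 1) ^ k) $$ i = 0" if "i < k" for i
    using startsby_zero_power_prefix[of "fexp - 1" k] that by simp
  then show ?thesis using \<open>n < k\<close> by (simp add: fps_mult_nth)
qed

text \<open>The power \<open>(fexp - 1) ^ k\<close> starts in degree \<open>k\<close>, so every
  inner sum may be extended to \<open>k \<le> n\<close> before the sums are exchanged.\<close>

lemma fps_compose_nth_mult:
  "((Abs_fps a oo (fexp - 1)) * F) $$ n = (\<Sum>k\<le>n. a k * ((fexp - 1) ^ k * F) $$ n)"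
proof -
  have "((Abs_fps a oo (fexp - 1)) * F) $$ n =
      (\<Sum>i=0..n. (\<Sum>k=0..i. a k * ((fexp - 1) ^ k) $$ i) * F $$ (n - i))"
    by (simp add: fps_mult_nth fps_compose_nth)
  also have "\<dots> = (\<Sum>i=0..n. (\<Sum>k\<le>n. a k * ((fexp - 1) ^ k) $$ i) * F $$ (n - i))"
  proof (rule sum.cong[OF refl])
    fix i assume "i \<in> {0..n}"
    then have "(\<Sum>k=0..i. a k * ((fexp - 1) ^ k) $$ i) = (\<Sum>k\<le>n. a k * ((fexp - 1) ^ k) $$ i)"
      using fps_power_minus_1_nth_0[of i _ 1] by (intro sum.mono_neutral_left) auto
    then show "(\<Sum>k=0..i. a k * ((fexp - 1) ^ k) $$ i) * F $$ (n - i) =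
        (\<Sum>k\<le>n. a k * ((fexp - 1) ^ k) $$ i) * F $$ (n - i)" by simp
  qed
  also have "\<dots> = (\<Sum>k\<le>n. a k * ((fexp - 1) ^ k * F) $$ n)"
    by (simp add: fps_mult_nth sum_distrib_left sum_distrib_right mult.assoc)
      (rule sum.swap)
  finally show ?thesis .
qed

text \<open>The series \<open>ln (1 + u) / u\<close> and \<open>(ln (1 + u) - u) / u\<^sup>2\<close> at \<open>u = exp X - 1\<close>, which sum the coefficients
  of the words \<open>x\<^sup>n y\<close> and \<open>x\<^sup>n y x\<close> over the number of blocks.\<close>

definition ln_quot :: "real fps" where
  "ln_quot = Abs_fps (\<lambda>k. (- 1) ^ k / real (Suc k)) oo (fexp - 1)"

definition ln_quot2 :: "real fps" where
  "ln_quot2 = Abs_fps (\<lambda>k. (- 1) ^ Suc k / real (Suc (Suc k))) oo (fexp - 1)"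

lemma ln_quot_mult: "ln_quot * (fexp - 1) = fps_X"
proof -
  have "fps_ln (1::real) oo (fexp - 1) = fps_X"
    using fps_inv[of "fexp - 1"] by (simp add: fps_ln_fps_exp_inv)
  moreover have "fps_ln (1::real) = Abs_fps (\<lambda>k. (- 1) ^ k / real (Suc k)) * fps_X"
    by (rule fps_ext) (auto simp: fps_ln_nth)
  ultimately show ?thesis unfolding ln_quot_def by (simp add: fps_compose_mult_distrib)
qed

lemma ln_quot_eq: "ln_quot = 1 + ln_quot2 * (fexp - 1)"
proof -
  have "Abs_fps (\<lambda>k. (- 1) ^ k / real (Suc k)) = 1 + Abs_fps (\<lambda>k. (- 1) ^ Suc k / real (Suc (Suc k))) * fps_X"
    by (rule fps_ext) (auto simp: gr0_conv_Suc)
  then have "ln_quot = (1 + Abs_fps (\<lambda>k. (- 1) ^ Suc k / real (Suc (Suc k))) * fps_X) oo (fexp - 1)"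
    unfolding ln_quot_def by (rule arg_cong)
  also have "\<dots> = 1 + ln_quot2 * (fexp - 1)"
    by (simp add: ln_quot2_def fps_compose_add_distrib fps_compose_mult_distrib)
  finally show ?thesis .
qed

text \<open>This is \<open>X exp X / (exp X - 1) = X / (1 - exp (- X))\<close>.\<close>

definition dynkin_series :: "real fps" where
  "dynkin_series = ln_quot * fexp"

lemma fexp_minus_1_nonzero: "fexp - 1 \<noteq> 0"
  using fps_exp_minus_1_nth[of 1] by (metis fps_zero_nth one_neq_zero divide_self fact_1)

text \<open>Dynkin's factor \<open>1 / (\<Sum>p\<^sub>i + q\<^sub>i)\<close> turns the comparison of coefficients into one of derivatives.\<close>

lemma dynkin_series_deriv:
  "fps_deriv (fps_X * dynkin_series) = ln_quot * fexp - fps_X * (ln_quot2 * fexp)"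
proof -
  \<comment> \<open>Differentiating \<open>ln_quot_mult\<close> and inserting
    \<open>ln_quot_eq\<close> leaves a common factor \<open>fexp - 1\<close>; cancelling it
    expresses the derivative of \<open>ln_quot\<close> through \<open>ln_quot\<close> and
    \<open>ln_quot2\<close>.\<close>
  have "fps_deriv (ln_quot * (fexp - 1)) = 1" by (simp add: ln_quot_mult)
  then have "(fexp - 1) * (fps_deriv ln_quot + ln_quot) = 1 - ln_quot"
    by (simp add: algebra_simps)
  also have "\<dots> = (fexp - 1) * (- ln_quot2)" by (subst ln_quot_eq) (simp add: algebra_simps)
  finally have "fps_deriv ln_quot + ln_quot = - ln_quot2"
    using fexp_minus_1_nonzero by (simp only: mult_cancel_left) simp
  then have d: "fps_deriv ln_quot = - ln_quot2 - ln_quot" by (simp add: eq_diff_eq)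
  show ?thesis by (simp add: dynkin_series_def d algebra_simps)
qed

text \<open>The words \<open>x ^ n y\<close> and, for \<open>n > 0\<close>,
  \<open>x ^ (n - 1) y x\<close> have length \<open>Suc n\<close>, which is Dynkin's denominator,
  and linear parts plus and minus \<open>ad x n\<close>. The right-hand side adds up their
  coefficients.\<close>

lemma dynkin_series_nth:
  "real (Suc n) * dynkin_series $$ n =
    (ln_quot * fexp) $$ n - (if n = 0 then 0 else (ln_quot2 * fexp) $$ (n - 1))"
proof -
  have "fps_deriv (fps_X * dynkin_series) $$ n = real (Suc n) * dynkin_series $$ n"
    by (auto simp: algebra_simps)
  then show ?thesis unfolding dynkin_series_deriv by simp
qed

text \<open>The series \<open>(1 - exp (- X)) / X\<close>; evaluated at \<open>ad x\<close> it gives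
  \<open>dexp_curve\<close> at time 1.\<close>

definition dexp_series :: "real fps" where
  "dexp_series = Abs_fps (\<lambda>k. (- 1) ^ k / fact (Suc k))"

lemma dexp_dynkin: "dexp_series * dynkin_series = 1"
proof -
  have "fps_X * dexp_series = 1 - fps_exp (- 1)"
    by (rule fps_ext) (auto simp: dexp_series_def gr0_conv_Suc simp del: fact_Suc)
  then have "fps_X * (dexp_series * dynkin_series) = (1 - fps_exp (- 1)) * (ln_quot * fexp)"
    by (simp add: dynkin_series_def mult.assoc[symmetric])
  also have "\<dots> = ln_quot * (fexp - fps_exp (- 1) * fexp)" by (simp add: algebra_simps)
  also have "fps_exp (- 1) * fexp = 1" by (simp add: fps_exp_add_mult[symmetric])
  also have "ln_quot * (fexp - 1) = fps_X * 1" by (simp add: ln_quot_mult)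
  finally show ?thesis by (simp only: mult_cancel_left) (simp add: fps_X_neq_zero)
qed

section \<open>Linearization of the product and left-invariant fields\<close>

context graded_algebra
begin

lemma comb_at_0: "comb u 0 = u"
  by (simp add: comb_def Z_0 vec_eq_sum_axis[symmetric])

text \<open>Laws of \<open>br\<close> are read off from those of vector fields at the origin, where
  \<open>comb u 0 = u\<close>.\<close>

lemma br_antisym: "br u v = - br v u"
proof -
  have "br u v = vfield_bracket (comb u) (comb v) 0" for u v by (simp add: comb_br comb_at_0)
  then show ?thesis by (simp add: vfield_bracket_def)
qed

lemma br_self: "br u u = 0"
proof -
  have "br u u = vfield_bracket (comb u) (comb u) 0" by (simp add: comb_br comb_at_0)
  then show ?thesis by (simp add: vfield_bracket_def)
qed

lemma br_zero [simp]: "br 0 u = 0" "br u 0 = 0"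
  using bounded_bilinear_br by (auto simp: bounded_bilinear.zero_left bounded_bilinear.zero_right)

text \<open>Substitution of \<open>ad x\<close> into a power series; by nilpotency the cut-off at
  \<open>r\<close> loses nothing.\<close>

definition ad_series :: "real ^ 'n \<Rightarrow> real fps \<Rightarrow> real ^ 'n \<Rightarrow> real ^ 'n" where
  "ad_series x F v = (\<Sum>n<r. F $$ n *\<^sub>R ad x n v)"

lemma ad_add: "ad x k (ad x n v) = ad x (k + n) v"
  by (simp add: ad_def funpow_add)

lemma ad_series_mult: "ad_series x F (ad_series x G v) = ad_series x (F * G) v"
proof -
  let ?g = "\<lambda>k n. (F $$ k * G $$ n) *\<^sub>R ad x (k + n) v"
  have "ad_series x F (ad_series x G v) = (\<Sum>k<r. \<Sum>n<r. ?g k n)"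
    unfolding ad_series_def using linear_ad
    by (simp add: linear_sum linear_scale ad_add scaleR_sum_right)
  also have "\<dots> = (\<Sum>(k, n)\<in>{..<r} \<times> {..<r}. ?g k n)" by (simp add: sum.cartesian_product)
  also have "\<dots> = (\<Sum>(k, n)\<in>{(k, n). k + n < r}. ?g k n)"
    by (rule sum.mono_neutral_right) (auto, meson ad_nilpotent not_less)
  also have "\<dots> = (\<Sum>j<r. \<Sum>i\<le>j. ?g i (j - i))" by (rule sum.triangle_reindex)
  also have "\<dots> = (\<Sum>j<r. (\<Sum>i\<le>j. F $$ i * G $$ (j - i)) *\<^sub>R ad x j v)"
    by (intro sum.cong refl) (simp add: scaleR_sum_left)
  finally show ?thesis by (simp add: ad_series_def fps_mult_nth atLeast0AtMost)
qed

lemma r_pos: "0 < r"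
  using w_pos w_le by (meson le_trans less_le_trans zero_less_one)

lemma ad_series_1: "ad_series x 1 v = v"
proof -
  have "ad_series x 1 v = (\<Sum>n<r. if n = 0 then v else 0)"
    unfolding ad_series_def by (intro sum.cong refl) auto
  then show ?thesis using r_pos by simp
qed

lemma dexp_curve_1: "dexp_curve x u 1 = ad_series x dexp_series u"
  by (simp add: dexp_curve_def ad_series_def dexp_series_def)

lemma FD_Exp_dynkin: "FD Exp x (ad_series x dynkin_series v) = comb v (Exp x)"
  by (simp add: FD_Exp dexp_curve_1 ad_series_mult dexp_dynkin ad_series_1)

abbreviation word_bracket :: "real ^ 'n \<Rightarrow> bool list \<Rightarrow> real ^ 'n \<Rightarrow> real ^ 'n" where
  "word_bracket x bs y \<equiv> nested_bracket br (map (\<lambda>b. if b then y else x) bs)"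

lemma word_bracket_at_0:
  "word_bracket x (c # cs) 0 = (if cs = [] \<and> \<not> c then x else 0)"
  by (induction cs arbitrary: c) (auto simp: br_self)

text \<open>The product rule at \<open>y = 0\<close>: either the outer letter is varied and the rest
  is evaluated at \<open>y = 0\<close>, or the rest is varied and an outer \<open>y\<close> becomes
  0.\<close>

fun word_linear :: "real ^ 'n \<Rightarrow> bool list \<Rightarrow> real ^ 'n \<Rightarrow> real ^ 'n" where
  "word_linear x [] v = 0"
| "word_linear x [b] v = (if b then v else 0)"
| "word_linear x (b # c # cs) v =
     br (if b then v else 0) (word_bracket x (c # cs) 0) + br (if b then 0 else x) (word_linear x (c # cs) v)"

lemma word_bracket_has_derivative:
  "((\<lambda>y. word_bracket x bs y) has_derivative word_linear x bs) (at 0)"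
proof (induction bs rule: induct_list012)
  case 1
  have "word_linear x [] = (\<lambda>v. 0)" by (simp add: fun_eq_iff)
  then show ?case by simp
next
  case (2 b)
  have "word_linear x [b] = (\<lambda>v. if b then v else 0)" by (simp add: fun_eq_iff)
  then show ?case by (cases b) (auto intro!: derivative_eq_intros)
next
  case (3 b c cs)
  have "((\<lambda>y. if b then y else x) has_derivative (\<lambda>v. if b then v else 0)) (at 0)"
    by (cases b) (auto intro!: derivative_eq_intros)
  from bounded_bilinear.FDERIV[OF bounded_bilinear_br this 3(2)]
  have "((\<lambda>y. br (if b then y else x) (word_bracket x (c # cs) y)) has_derivative
    (\<lambda>v. br (if b then 0 else x) (word_linear x (c # cs) v) +
        br (if b then v else 0) (word_bracket x (c # cs) 0))) (at 0)" .
  then show ?case by (simp add: add.commute)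
qed

lemma word_linear_last: "word_linear x (replicate n False @ [True]) v = ad x n v"
proof (induction n)
  case (Suc n)
  have "word_linear x (False # (replicate n False @ [True])) v = br x (word_linear x (replicate n False @ [True]) v)"
    by (cases "replicate n False @ [True]") auto
  then show ?case using Suc by (simp add: ad_Suc)
qed simp

lemma word_linear_last2: "word_linear x (replicate n False @ [True, False]) v = - ad x (Suc n) v"
proof (induction n)
  case 0
  then show ?case using br_antisym[of v x] by (simp add: ad_Suc)
next
  case (Suc n)
  have "word_linear x (False # (replicate n False @ [True, False])) v =
      br x (word_linear x (replicate n False @ [True, False]) v)"
    by (cases "replicate n False @ [True, False]") auto
  then show ?case using Suc bounded_bilinear.minus_right[OF bounded_bilinear_br]
    by (simp add: ad_Suc[of _ "Suc n"])
qed

text \<open>If the outer letter is \<open>y\<close>, the rest evaluated at \<open>y = 0\<close> is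
  zero unless it is the single letter \<open>x\<close>; if the outer letter is \<open>x\<close>, the
  claim passes to the rest.\<close>

lemma word_linear_other:
  assumes "\<And>n. bs \<noteq> replicate n False @ [True]" "\<And>n. bs \<noteq> replicate n False @ [True, False]"
  shows "word_linear x bs v = 0"
  using assms
proof (induction bs rule: induct_list012)
  case (2 b)
  then show ?case using 2(1)[of 0] by auto
next
  case (3 b c cs)
  show ?case
  proof (cases b)
    case True
    then have "c # cs \<noteq> [False]" using 3(4)[of 0] by auto
    then show ?thesis using True word_bracket_at_0[of x c cs] by auto
  next
    case False
    have "word_linear x (c # cs) v = 0"
    proof (rule 3(2))
      show "c # cs \<noteq> replicate n False @ [True]" for n
        using 3(3)[of "Suc n"] False by auto
      show "c # cs \<noteq> replicate n False @ [True, False]" for n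
        using 3(4)[of "Suc n"] False by auto
    qed
    then show ?thesis using False by simp
  qed
qed simp

definition dynkin_index :: "(nat \<times> nat) list set" where
  "dynkin_index = {ps. ps \<noteq> [] \<and> proper_blocks ps \<and> length (block_word ps) \<le> r}"

definition dynkin_coeff :: "(nat \<times> nat) list \<Rightarrow> real" where
  "dynkin_coeff ps = (- 1) ^ (length ps - 1) / (real (length ps) * real (length (block_word ps))) * block_weight ps"

lemma dynkin_product_eq:
  "dynkin_product br r x y = (\<Sum>ps\<in>dynkin_index. dynkin_coeff ps *\<^sub>R word_bracket x (block_word ps) y)"
  unfolding dynkin_product_def dynkin_index_def proper_blocks_def length_block_word concat_block_word
  by (intro sum.cong refl) (simp add: dynkin_coeff_def block_weight_def length_block_word)

lemma finite_dynkin_index: "finite dynkin_index"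
  by (rule finite_subset[OF _ finite_blocks[of r]]) (auto simp: dynkin_index_def)

text \<open>Factorizations of \<open>u\<close> are grouped by their number of blocks, on which the
  remaining factors of \<open>dynkin_coeff\<close> depend; \<open>length u \<le> r\<close> ensures
  that all of them occur in \<open>dynkin_index\<close>.\<close>

lemma dynkin_coeff_sum:
  assumes "length u \<le> r" "u \<noteq> []"
  shows "(\<Sum>ps | ps \<in> dynkin_index \<and> block_word ps = u. dynkin_coeff ps) =
    (\<Sum>k<length u. (- 1) ^ k / real (Suc k) * blocks_sum u (Suc k)) / real (length u)"
proof -
  let ?A = "{ps. ps \<in> dynkin_index \<and> block_word ps = u}"
  have fin: "finite ?A" using finite_dynkin_index by simp
  have len: "length ` ?A \<subseteq> {1..length u}"
    using length_le_block_word by (auto simp: dynkin_index_def Suc_le_eq)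
  have "(\<Sum>ps\<in>?A. dynkin_coeff ps) = (\<Sum>k=1..length u. \<Sum>ps | ps \<in> ?A \<and> length ps = k. dynkin_coeff ps)"
    by (rule sum.group[OF fin _ len, symmetric]) simp
  also have "\<dots> = (\<Sum>k=1..length u. (- 1) ^ (k - 1) / (real k * real (length u)) * blocks_sum u k)"
  proof (rule sum.cong[OF refl])
    fix k assume k: "k \<in> {1..length u}"
    have "{ps. ps \<in> ?A \<and> length ps = k} = blocks_of u k"
      using k assms by (auto simp: dynkin_index_def blocks_of_def)
    then show "(\<Sum>ps | ps \<in> ?A \<and> length ps = k. dynkin_coeff ps) =
        (- 1) ^ (k - 1) / (real k * real (length u)) * blocks_sum u k"
      by (auto simp: blocks_sum_def sum_distrib_left dynkin_coeff_def blocks_of_def intro!: sum.cong)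
  qed
  also have "\<dots> = (\<Sum>k<length u. (- 1) ^ k / (real (Suc k) * real (length u)) * blocks_sum u (Suc k))"
    by (rule sum.reindex_bij_witness[of _ Suc "\<lambda>k. k - 1"]) auto
  finally show ?thesis by (simp add: sum_divide_distrib)
qed

lemma dynkin_coeff_sum_last:
  assumes "n < r"
  shows "(\<Sum>ps | ps \<in> dynkin_index \<and> block_word ps = replicate n False @ [True]. dynkin_coeff ps) =
    (ln_quot * fexp) $$ n / real (Suc n)"
  using assms by (subst dynkin_coeff_sum)
    (auto simp: ln_quot_def fps_compose_nth_mult blocks_sum_last lessThan_Suc_atMost)

lemma dynkin_coeff_sum_last2:
  assumes "Suc n < r"
  shows "(\<Sum>ps | ps \<in> dynkin_index \<and> block_word ps = replicate n False @ [True, False]. dynkin_coeff ps) =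
    (ln_quot2 * fexp) $$ n / real (Suc (Suc n))"
proof -
  let ?u = "replicate n False @ [True, False]"
  \<comment> \<open>A single block cannot spell a word in which \<open>x\<close> follows
    \<open>y\<close>, so the term \<open>k = 0\<close> drops out.\<close>
  have "(\<Sum>k<Suc (Suc n). (- 1) ^ k / real (Suc k) * blocks_sum ?u (Suc k)) =
      (\<Sum>k<Suc n. (- 1) ^ Suc k / real (Suc (Suc k)) * blocks_sum ?u (Suc (Suc k)))"
    by (subst sum.lessThan_Suc_shift) (simp add: blocks_sum_last2_1)
  also have "\<dots> = (ln_quot2 * fexp) $$ n"
    unfolding ln_quot2_def fps_compose_nth_mult blocks_sum_last2 lessThan_Suc_atMost ..
  finally show ?thesis using assms by (subst dynkin_coeff_sum) auto
qed

text \<open>In this form, summation over \<open>dynkin_index\<close> can be exchanged with summation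
  over \<open>n\<close> and collects the total coefficient of each word.\<close>

lemma word_linear_expand:
  assumes "length bs \<le> r"
  shows "word_linear x bs v =
    (\<Sum>n<r. (if bs = replicate n False @ [True] then ad x n v else 0)) -
    (\<Sum>n<r. (if bs = replicate n False @ [True, False] then ad x (Suc n) v else 0))"
proof -
  have len: "replicate n False @ [True] = replicate m False @ [True] \<longleftrightarrow> n = m"
    "replicate n False @ [True, False] = replicate m False @ [True, False] \<longleftrightarrow> n = m"
    "replicate n False @ [True] \<noteq> replicate m False @ [True, False]"
    "replicate n False @ [True, False] \<noteq> replicate m False @ [True]" for n m
    by (metis length_append length_replicate add_right_cancel,
        metis length_append length_replicate add_right_cancel,
        metis last_snoc last_append last.simps list.distinct(1),
        metis last_snoc last_append last.simps list.distinct(1))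
  consider n where "bs = replicate n False @ [True]" | n where "bs = replicate n False @ [True, False]"
    | "\<And>n. bs \<noteq> replicate n False @ [True]" "\<And>n. bs \<noteq> replicate n False @ [True, False]" by blast
  then show ?thesis
  proof cases
    case 1
    then show ?thesis using assms by (simp add: len word_linear_last)
  next
    case 2
    then show ?thesis using assms by (simp add: len word_linear_last2)
  next
    case 3
    then show ?thesis by (simp add: word_linear_other)
  qed
qed

lemma dynkin_product_has_derivative:
  "((\<lambda>y. dynkin_product br r x y) has_derivative ad_series x dynkin_series) (at 0)"
proof -
  let ?S = dynkin_index
  let ?F = "\<lambda>n ps. block_word ps = replicate n False @ [True]"
  let ?G = "\<lambda>n ps. block_word ps = replicate n False @ [True, False]"
  have "((\<lambda>y. dynkin_product br r x y) has_derivative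
     (\<lambda>v. \<Sum>ps\<in>?S. dynkin_coeff ps *\<^sub>R word_linear x (block_word ps) v)) (at 0)"
    unfolding dynkin_product_eq
    by (intro has_derivative_sum has_derivative_scaleR_right word_bracket_has_derivative)
  moreover have "(\<Sum>ps\<in>?S. dynkin_coeff ps *\<^sub>R word_linear x (block_word ps) v) = ad_series x dynkin_series v" for v
  proof -
    have swap: "(\<Sum>ps\<in>?S. dynkin_coeff ps *\<^sub>R (\<Sum>n<r. if P n ps then a n else 0)) =
        (\<Sum>n<r. (\<Sum>ps | ps \<in> ?S \<and> P n ps. dynkin_coeff ps) *\<^sub>R a n)" for P and a :: "nat \<Rightarrow> real ^ 'n"
    proof -
      have "(\<Sum>ps\<in>?S. dynkin_coeff ps *\<^sub>R (\<Sum>n<r. if P n ps then a n else 0)) =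
        (\<Sum>n<r. \<Sum>ps\<in>?S. if P n ps then dynkin_coeff ps *\<^sub>R a n else 0)"
        unfolding scaleR_sum_right by (subst sum.swap) (intro sum.cong refl, auto)
      also have "\<dots> = (\<Sum>n<r. (\<Sum>ps | ps \<in> ?S \<and> P n ps. dynkin_coeff ps) *\<^sub>R a n)"
        unfolding sum.inter_filter[OF finite_dynkin_index] scaleR_sum_left
        by (intro sum.cong refl) auto
      finally show ?thesis .
    qed
    have "(\<Sum>ps\<in>?S. dynkin_coeff ps *\<^sub>R word_linear x (block_word ps) v) =
      (\<Sum>ps\<in>?S. dynkin_coeff ps *\<^sub>R (\<Sum>n<r. if ?F n ps then ad x n v else 0) -
        dynkin_coeff ps *\<^sub>R (\<Sum>n<r. if ?G n ps then ad x (Suc n) v else 0))"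
      by (intro sum.cong refl) (simp add: word_linear_expand dynkin_index_def scaleR_diff_right)
    also have "\<dots> = (\<Sum>ps\<in>?S. dynkin_coeff ps *\<^sub>R (\<Sum>n<r. if ?F n ps then ad x n v else 0)) -
      (\<Sum>ps\<in>?S. dynkin_coeff ps *\<^sub>R (\<Sum>n<r. if ?G n ps then ad x (Suc n) v else 0))"
      by (rule sum_subtractf)
    also have "\<dots> = (\<Sum>n<r. (\<Sum>ps | ps \<in> ?S \<and> ?F n ps. dynkin_coeff ps) *\<^sub>R ad x n v) -
      (\<Sum>n<r. (\<Sum>ps | ps \<in> ?S \<and> ?G n ps. dynkin_coeff ps) *\<^sub>R ad x (Suc n) v)"
      by (simp only: swap)
    also have "(\<Sum>n<r. (\<Sum>ps | ps \<in> ?S \<and> ?F n ps. dynkin_coeff ps) *\<^sub>R ad x n v) =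
      (\<Sum>n<r. ((ln_quot * fexp) $$ n / real (Suc n)) *\<^sub>R ad x n v)"
      by (intro sum.cong refl) (simp only: dynkin_coeff_sum_last lessThan_iff)
    also have "(\<Sum>n<r. (\<Sum>ps | ps \<in> ?S \<and> ?G n ps. dynkin_coeff ps) *\<^sub>R ad x (Suc n) v) =
      (\<Sum>n<r. ((ln_quot2 * fexp) $$ n / real (Suc (Suc n))) *\<^sub>R ad x (Suc n) v)"
    proof (intro sum.cong refl)
      \<comment> \<open>For \<open>n = r - 1\<close> the word has length \<open>r + 1\<close> and
        lies outside the index set, but both sides vanish because \<open>ad x r\<close> is
        zero.\<close>
      fix n assume "n \<in> {..<r}"
      show "(\<Sum>ps | ps \<in> ?S \<and> ?G n ps. dynkin_coeff ps) *\<^sub>R ad x (Suc n) v =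
        ((ln_quot2 * fexp) $$ n / real (Suc (Suc n))) *\<^sub>R ad x (Suc n) v"
        by (cases "Suc n < r") (simp_all only: dynkin_coeff_sum_last2 ad_nilpotent not_less scaleR_zero_right)
    qed
    also have "\<dots> = (\<Sum>n<Suc r. (if n = 0 then 0 else (ln_quot2 * fexp) $$ (n - 1) / real (Suc n)) *\<^sub>R ad x n v)"
      unfolding sum.lessThan_Suc_shift by simp
    also have "\<dots> = (\<Sum>n<r. (if n = 0 then 0 else (ln_quot2 * fexp) $$ (n - 1) / real (Suc n)) *\<^sub>R ad x n v)"
      by (simp add: ad_nilpotent)
    also have "(\<Sum>n<r. ((ln_quot * fexp) $$ n / real (Suc n)) *\<^sub>R ad x n v) - \<dots> = ad_series x dynkin_series v"
      unfolding sum_subtractf[symmetric] scaleR_diff_left[symmetric] ad_series_def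
    proof (intro sum.cong refl arg_cong2[where f=scaleR])
      fix n
      have "(ln_quot * fexp) $$ n / real (Suc n) - (if n = 0 then 0 else (ln_quot2 * fexp) $$ (n - 1) / real (Suc n)) =
        ((ln_quot * fexp) $$ n - (if n = 0 then 0 else (ln_quot2 * fexp) $$ (n - 1))) / real (Suc n)"
        by (simp add: diff_divide_distrib del: of_nat_Suc)
      also have "\<dots> = dynkin_series $$ n"
        unfolding dynkin_series_nth[symmetric] by (simp del: of_nat_Suc)
      finally show "(ln_quot * fexp) $$ n / real (Suc n) -
        (if n = 0 then 0 else (ln_quot2 * fexp) $$ (n - 1) / real (Suc n)) = dynkin_series $$ n" .
    qed
    finally show ?thesis .
  qed
  ultimately show ?thesis by simp
qed

definition left_field :: "'n \<Rightarrow> real ^ 'n \<Rightarrow> real ^ 'n" where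
  "left_field j x = FD (\<lambda>y. dynkin_product br r x y) 0 (axis j 1)"

lemma FD_Exp_left_field: "FD Exp x (left_field j x) = Z j (Exp x)"
  unfolding left_field_def FD_eq[OF dynkin_product_has_derivative] FD_Exp_dynkin comb_axis ..

lemma FD_Log_Exp: "FD Log (Exp x) (FD Exp x v) = v"
proof -
  have "((Log \<circ> Exp) has_derivative (FD Log (Exp x) \<circ> FD Exp x)) (at x)"
    by (rule diff_chain_at[OF smooth_on_has_derivative[OF smooth_on_Exp UNIV_I]
      smooth_on_has_derivative[OF smooth_on_Log UNIV_I]])
  moreover have "((Log \<circ> Exp) has_derivative id) (at x)"
    by (rule has_derivative_eq_rhs[where f'="\<lambda>v. v"]) (simp_all add: o_def Log_Exp id_def)
  ultimately show ?thesis using has_derivative_unique by (metis comp_apply id_apply)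
qed

lemma FD_Log_Z: "FD Log (Exp x) (Z j (Exp x)) = left_field j x"
  using FD_Log_Exp[of x "left_field j x"] by (simp add: FD_Exp_left_field)

lemma pushforward_Log: "pushforward Log (Z j) = left_field j"
  by (rule ext) (simp add: pushforward_def inv_Log FD_Log_Z)

lemma Exp_0: "Exp 0 = 0"
  using Exp_homogeneous[unfolded w_homogeneous_def, rule_format, of 0 0] by simp

lemma left_field_0: "left_field j 0 = axis j 1"
proof -
  have "ad 0 n v = (if n = 0 then v else 0)" for n v
    by (cases n) (auto simp: ad_Suc)
  then have "left_field j 0 = (\<Sum>n<r. if n = 0 then dynkin_series $$ 0 *\<^sub>R axis j 1 else 0)"
    unfolding left_field_def FD_eq[OF dynkin_product_has_derivative] ad_series_def
    by (intro sum.cong) auto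
  also have "\<dots> = dynkin_series $$ 0 *\<^sub>R axis j 1" using r_pos by simp
  also have "dynkin_series $$ 0 = 1"
    using dynkin_series_nth[of 0] by (simp add: ln_quot_def fps_compose_nth_mult)
  finally show ?thesis by simp
qed

lemma FD_Log_0: "FD Log 0 (axis j 1) = axis j 1"
  using FD_Log_Z[of 0 j] by (simp add: Exp_0 Z_0 left_field_0)

text \<open>Since \<open>Exp \<circ> \<psi>\<close> maps integral curves of each combination of the fields \<open>Z j\<close> to
  such curves, it fixes every point \<open>Exp x\<close>.\<close>

lemma Log_unique:
  assumes "\<And>x. \<psi> differentiable (at x)" "\<psi> 0 = 0"
    and push: "\<And>j x. FD \<psi> x (Z j x) = left_field j (\<psi> x)"
  shows "\<psi> = Log"
proof
  fix z
  define x where "x = Log z"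
  define c where "c = (\<lambda>t. Exp (\<psi> (flow (t, x))))"
  have "c 1 = flow (1, x)"
  proof (rule flow_unique)
    show "c 0 = 0" by (simp add: c_def flow_0 assms(2) Exp_0)
    fix t :: real
    let ?y = "flow (t, x)"
    have "((\<lambda>y. Exp (\<psi> y)) has_derivative (\<lambda>v. FD Exp (\<psi> ?y) (FD \<psi> ?y v))) (at ?y)"
      using diff_chain_at[OF assms(1)[unfolded frechet_derivative_works]
        smooth_on_has_derivative[OF smooth_on_Exp UNIV_I]] by (simp add: o_def)
    from vector_derivative_diff_chain_within[OF flow_has_vector_derivative, OF has_derivative_at_withinI[OF this]]
    have "(c has_vector_derivative FD Exp (\<psi> ?y) (FD \<psi> ?y (comb x ?y))) (at t)"
      by (simp add: o_def c_def)
    also have "FD Exp (\<psi> ?y) (FD \<psi> ?y (comb x ?y)) = comb x (Exp (\<psi> ?y))"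
      using linear_frechet_derivative[OF assms(1)]
        linear_frechet_derivative[OF smooth_on_differentiable[OF smooth_on_Exp UNIV_I]]
      by (simp add: comb_def linear_sum linear_scale push FD_Exp_left_field)
    finally show "(c has_vector_derivative comb x (c t)) (at t within {0..1})"
      unfolding c_def by (rule has_vector_derivative_at_within)
  qed auto
  then have "Exp (\<psi> (Exp x)) = Exp x" by (simp add: c_def Exp_def)
  then show "\<psi> z = Log z" using Exp_Log Log_Exp by (metis x_def)
qed

end

section \<open>Vector fields in charts\<close>

text \<open>The coefficients are averages of the partial derivatives over the segment from the
  centre, which stays inside the ball.\<close>

lemma hadamard_ball:
  fixes F :: "real ^ 'n \<Rightarrow> real"
  assumes F: "smooth_on (ball c e) F"
  shows "\<exists>g. (\<forall>k. smooth_on (ball c e) (g k)) \<and>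
    (\<forall>y\<in>ball c e. F y = F c + (\<Sum>k\<in>UNIV. (y $ k - c $ k) * g k y)) \<and>
    (\<forall>k. g k c = FD F c (axis k 1))"
proof -
  let ?m = "\<lambda>q::real \<times> (real ^ 'n). c + fst q *\<^sub>R (snd q - c)"
  let ?T = "?m -` ball c e"
  define g where "g = (\<lambda>k y. integral {0..1} (\<lambda>s. FD F (?m (s, y)) (axis k 1)))"
  have oT: "open ?T" by (intro open_vimage open_ball continuous_intros)
  have m: "smooth_on ?T ?m"
    by (intro smooth_on_add smooth_on_const smooth_on_scaleR smooth_on_fst smooth_on_diff smooth_on_snd
      smooth_on_id oT)
  have inb: "c + s *\<^sub>R (y - c) \<in> ball c e" if "y \<in> ball c e" "s \<in> {0..1}" for s y
  proof -
    have "norm (s *\<^sub>R (y - c)) \<le> norm (y - c)" using that(2) by (simp add: mult_left_le_one_le)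
    then show ?thesis using that(1) by (simp add: dist_norm norm_minus_commute)
  qed
  have Fk: "smooth_on ?T (\<lambda>q. FD F (?m q) (axis k 1))" for k
    by (rule smooth_on_compose[OF oT open_ball m smooth_on_FD[OF F]]) simp
  have g: "smooth_on (ball c e) (g k)" for k
    unfolding g_def by (rule smooth_on_param_integral[OF open_ball Fk]) (use inb in auto)
  have "F y = F c + (\<Sum>k\<in>UNIV. (y $ k - c $ k) * g k y)" if y: "y \<in> ball c e" for y
  proof -
    have int: "(\<lambda>s. FD F (?m (s, y)) (axis k 1)) integrable_on {0..1}" for k
      by (intro integrable_continuous_interval continuous_on_compose2[OF smooth_on_continuous[OF Fk]]
        continuous_intros) (use inb y in auto)
    have "((\<lambda>s. FD F (?m (s, y)) (y - c)) has_integral F (?m (1, y)) - F (?m (0, y))) {0..1}"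
    proof (rule fundamental_theorem_of_calculus)
      fix s :: real assume s: "s \<in> {0..1}"
      have "((\<lambda>s. ?m (s, y)) has_vector_derivative (y - c)) (at s within {0..1})"
        by (auto intro!: derivative_eq_intros)
      from vector_derivative_diff_chain_within[OF this, of F "FD F (?m (s, y))"]
      show "((\<lambda>s. F (?m (s, y))) has_vector_derivative FD F (?m (s, y)) (y - c)) (at s within {0..1})"
        using smooth_on_has_derivative[OF F inb[OF y s]]
        by (auto simp: o_def intro: has_derivative_at_withinI)
    qed simp
    then have "F y - F c = integral {0..1} (\<lambda>s. FD F (?m (s, y)) (y - c))"
      by (simp add: integral_unique)
    also have "\<dots> = integral {0..1} (\<lambda>s. \<Sum>k\<in>UNIV. (y - c) $ k *\<^sub>R FD F (?m (s, y)) (axis k 1))"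
      by (intro integral_cong FD_linear_sum smooth_on_differentiable[OF F]) (use inb y in simp)
    also have "\<dots> = (\<Sum>k\<in>UNIV. (y $ k - c $ k) * g k y)"
      using integrable_cmul[OF int] by (subst integral_sum) (auto simp: g_def)
    finally show ?thesis by simp
  qed
  moreover have "g k c = FD F c (axis k 1)" for k by (simp add: g_def)
  ultimately show ?thesis using g by (intro exI[of _ g] conjI ballI allI)
qed

lemma topological_chartD:
  assumes "topological_chart (U, \<kappa>)"
  shows "open U" "inj_on \<kappa> U" "continuous_on U \<kappa>" "open (\<kappa> ` U)" "continuous_on (\<kappa> ` U) (inv_into U \<kappa>)"
proof -
  have h: "open U" "open (\<kappa> ` U)" "homeomorphism U (\<kappa> ` U) \<kappa> (inv_into U \<kappa>)"
    using assms by (auto simp: topological_chart_def)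
  from h show "open U" "open (\<kappa> ` U)" "continuous_on U \<kappa>" "continuous_on (\<kappa> ` U) (inv_into U \<kappa>)"
    by (auto simp: homeomorphism_def)
  show "inj_on \<kappa> U" using h(3) by (metis homeomorphism_def inj_on_inverseI)
qed

lemma topological_chart_image_open:
  assumes "topological_chart (U, \<kappa>)" "open V" "V \<subseteq> U"
  shows "open (\<kappa> ` V)"
proof -
  note c = topological_chartD[OF assms(1)]
  have "\<kappa> ` V = \<kappa> ` U \<inter> inv_into U \<kappa> -` V"
  proof (intro equalityI subsetI)
    fix x assume "x \<in> \<kappa> ` V"
    then show "x \<in> \<kappa> ` U \<inter> inv_into U \<kappa> -` V" using assms(3) inv_into_f_f[OF c(2)] by auto
  next
    fix x assume "x \<in> \<kappa> ` U \<inter> inv_into U \<kappa> -` V"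
    then show "x \<in> \<kappa> ` V" using f_inv_into_f[of x \<kappa> U] by (metis Int_iff imageI vimageD)
  qed
  then show ?thesis using continuous_open_preimage[OF c(5,4) assms(2)] by simp
qed

lemma inv_into_chart: "topological_chart (U, \<kappa>) \<Longrightarrow> p \<in> U \<Longrightarrow> inv_into U \<kappa> (\<kappa> p) = p"
  using topological_chartD(2) inv_into_f_f by metis

lemma smooth_on_change_chart:
  fixes \<kappa> \<nu> :: "'m::topological_space \<Rightarrow> real ^ 'n::finite"
  assumes U: "topological_chart (U, \<kappa>)" and N: "topological_chart (N, \<nu>)"
    and W: "open W" "W \<subseteq> U" "W \<subseteq> N"
    and t: "smooth_on (\<kappa> ` W) (\<nu> \<circ> inv_into U \<kappa>)"
    and f: "smooth_on (\<nu> ` W) (f \<circ> inv_into N \<nu>)"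
  shows "smooth_on (\<kappa> ` W) (f \<circ> inv_into U \<kappa>)"
proof -
  have o: "open (\<kappa> ` W)" "open (\<nu> ` W)"
    by (rule topological_chart_image_open[OF U W(1,2)], rule topological_chart_image_open[OF N W(1,3)])
  have i: "inv_into U \<kappa> (\<kappa> p) = p" "inv_into N \<nu> (\<nu> p) = p" if "p \<in> W" for p
    using inv_into_chart[OF U, of p] inv_into_chart[OF N, of p] W(2,3) that by auto
  have "smooth_on (\<kappa> ` W) (\<lambda>x. (f \<circ> inv_into N \<nu>) ((\<nu> \<circ> inv_into U \<kappa>) x))"
    by (rule smooth_on_compose[OF o t f]) (use i in auto)
  moreover have "smooth_on (\<kappa> ` W) (\<lambda>x. (f \<circ> inv_into N \<nu>) ((\<nu> \<circ> inv_into U \<kappa>) x)) \<longleftrightarrow>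
      smooth_on (\<kappa> ` W) (f \<circ> inv_into U \<kappa>)"
    by (rule smooth_on_cong[OF o(1)]) (use i in auto)
  ultimately show ?thesis by simp
qed

lemma smooth_chartD:
  assumes "smooth_chart A (U, \<kappa>)"
  shows "topological_chart (U, \<kappa>)"
    "(N, \<nu>) \<in> A \<Longrightarrow> smooth_on (\<kappa> ` (U \<inter> N)) (\<nu> \<circ> inv_into U \<kappa>)"
    "(N, \<nu>) \<in> A \<Longrightarrow> smooth_on (\<nu> ` (U \<inter> N)) (\<kappa> \<circ> inv_into N \<nu>)"
  using assms by (auto simp: smooth_chart_def compatible_charts_def)

lemma smooth_atlas_chart_at:
  assumes "smooth_atlas A"
  obtains N \<nu> where "(N, \<nu>) \<in> A" "p \<in> N" "topological_chart (N, \<nu>)"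
proof -
  have "p \<in> (\<Union>c\<in>A. fst c)" using assms by (simp add: smooth_atlas_def)
  then obtain c where "c \<in> A" "p \<in> fst c" by blast
  moreover from this have "topological_chart (fst c, snd c)" using assms by (simp add: smooth_atlas_def)
  ultimately show ?thesis using that[of "fst c" "snd c"] by simp
qed

text \<open>Smoothness is local, and around each point a chart of the atlas is available; membership
  of \<open>(U, \<kappa>)\<close> in the maximal atlas makes the transition to it smooth.\<close>

lemma smooth_on_chartI:
  fixes A :: "('m::{t2_space,second_countable_topology}, 'n::finite) chart set"
  assumes A: "smooth_atlas A" and U: "smooth_chart A (U, \<kappa>)" and V: "open V" "V \<subseteq> U"
    and f: "\<And>N \<nu>. (N, \<nu>) \<in> A \<Longrightarrow> smooth_on (\<nu> ` (N \<inter> V)) (f \<circ> inv_into N \<nu>)"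
  shows "smooth_on (\<kappa> ` V) (f \<circ> inv_into U \<kappa>)"
proof (rule smooth_on_local)
  fix x assume "x \<in> \<kappa> ` V"
  then obtain p where p: "p \<in> V" "x = \<kappa> p" by blast
  obtain N \<nu> where N: "(N, \<nu>) \<in> A" "p \<in> N" "topological_chart (N, \<nu>)"
    by (rule smooth_atlas_chart_at[OF A])
  have "smooth_on (\<kappa> ` (N \<inter> V)) (f \<circ> inv_into U \<kappa>)"
  proof (rule smooth_on_change_chart[OF smooth_chartD(1)[OF U] N(3) _ _ _ _ f[OF N(1)]])
    show "open (N \<inter> V)" using topological_chartD(1)[OF N(3)] V by auto
    show "smooth_on (\<kappa> ` (N \<inter> V)) (\<nu> \<circ> inv_into U \<kappa>)"
      by (rule smooth_on_subset[OF smooth_chartD(2)[OF U N(1)]]) (use V in auto)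
  qed (use V in auto)
  then show "\<exists>T. x \<in> T \<and> smooth_on T (f \<circ> inv_into U \<kappa>)"
    using p N by (intro exI[of _ "\<kappa> ` (N \<inter> V)"]) auto
qed

lemma smooth_on_transition:
  fixes A :: "('m::{t2_space,second_countable_topology}, 'n::finite) chart set"
  assumes A: "smooth_atlas A" and U: "smooth_chart A (U, \<kappa>)" and V: "smooth_chart A (V, \<mu>)"
  shows "smooth_on (\<kappa> ` (U \<inter> V)) (\<mu> \<circ> inv_into U \<kappa>)"
proof (rule smooth_on_chartI[OF A U])
  show "open (U \<inter> V)" using topological_chartD(1) smooth_chartD(1) U V by blast
  show "smooth_on (\<nu> ` (N \<inter> (U \<inter> V))) (\<mu> \<circ> inv_into N \<nu>)" if "(N, \<nu>) \<in> A" for N \<nu>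
    by (rule smooth_on_subset[OF smooth_chartD(3)[OF V that]]) auto
qed auto

section \<open>Derivations and vector fields in a chart\<close>

locale manifold_chart =
  fixes A :: "('m::{t2_space,second_countable_topology}, 'n::finite) chart set"
    and U :: "'m set" and \<kappa> :: "'m \<Rightarrow> real ^ 'n"
  assumes atlas: "smooth_atlas A" and chart: "smooth_chart A (U, \<kappa>)"
begin

lemma open_U: "open U" and continuous_\<kappa>: "continuous_on U \<kappa>"
  using topological_chartD[OF smooth_chartD(1)[OF chart]] by auto

lemma inv_\<kappa>: "p \<in> U \<Longrightarrow> inv_into U \<kappa> (\<kappa> p) = p"
  by (rule inv_into_chart[OF smooth_chartD(1)[OF chart]])

lemma open_\<kappa>: "open V \<Longrightarrow> V \<subseteq> U \<Longrightarrow> open (\<kappa> ` V)"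
  by (rule topological_chart_image_open[OF smooth_chartD(1)[OF chart]])

lemma smooth_fun_on_iff:
  assumes V: "open V" "V \<subseteq> U" and f: "\<And>q. q \<in> V \<Longrightarrow> f q = F (\<kappa> q)"
  shows "smooth_fun_on A V f \<longleftrightarrow> smooth_on (\<kappa> ` V) F"
proof -
  have "smooth_on (\<kappa> ` V) (f \<circ> inv_into U \<kappa>) \<longleftrightarrow> smooth_on (\<kappa> ` V) F"
    by (rule smooth_on_cong[OF open_\<kappa>[OF V]]) (use V f inv_\<kappa> in auto)
  moreover have "smooth_fun_on A V f \<longleftrightarrow> smooth_on (\<kappa> ` V) (f \<circ> inv_into U \<kappa>)"
  proof
    assume "smooth_fun_on A V f"
    then show "smooth_on (\<kappa> ` V) (f \<circ> inv_into U \<kappa>)"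
      by (intro smooth_on_chartI[OF atlas chart V]) (auto simp: smooth_fun_on_def)
  next
    assume f: "smooth_on (\<kappa> ` V) (f \<circ> inv_into U \<kappa>)"
    have "smooth_on (\<nu> ` (N \<inter> V)) (f \<circ> inv_into N \<nu>)" if N: "(N, \<nu>) \<in> A" for N \<nu>
    proof (rule smooth_on_change_chart[OF _ smooth_chartD(1)[OF chart]])
      show tN: "topological_chart (N, \<nu>)" using atlas N by (auto simp: smooth_atlas_def)
      show "open (N \<inter> V)" using topological_chartD(1)[OF tN] V by auto
      show "smooth_on (\<nu> ` (N \<inter> V)) (\<kappa> \<circ> inv_into N \<nu>)"
        by (rule smooth_on_subset[OF smooth_chartD(3)[OF chart N]]) (use V in auto)
      show "smooth_on (\<kappa> ` (N \<inter> V)) (f \<circ> inv_into U \<kappa>)"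
        by (rule smooth_on_subset[OF f]) auto
    qed (use V in auto)
    then show "smooth_fun_on A V f" by (auto simp: smooth_fun_on_def)
  qed
  ultimately show ?thesis by simp
qed

lemma smooth_nearI:
  assumes "open V" "V \<subseteq> U" "p \<in> V" "smooth_on (\<kappa> ` V) F" "\<And>q. q \<in> V \<Longrightarrow> f q = F (\<kappa> q)"
  shows "smooth_near A p f"
  unfolding smooth_near_def
  by (rule exI[of _ V]) (use smooth_fun_on_iff[OF assms(1,2), of f F] assms in auto)

text \<open>Near \<open>p\<close> the function is a constant plus products of
  \<open>\<kappa> q $ k - \<kappa> p $ k\<close> with smooth \<open>g k\<close>. The first factors
  vanish at \<open>p\<close>, so the Leibniz rule leaves the value of \<open>g k\<close> there, a
  partial derivative of \<open>F\<close>.\<close>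

lemma tangent_formula:
  assumes v: "v \<in> tangent_space A p"
    and V: "open V" "V \<subseteq> U" "p \<in> V" and F: "smooth_on (\<kappa> ` V) F" and f: "\<And>q. q \<in> V \<Longrightarrow> f q = F (\<kappa> q)"
  shows "v f = (\<Sum>k\<in>UNIV. v (\<lambda>q. \<kappa> q $ k) * FD F (\<kappa> p) (axis k 1))"
proof -
  have germ: "v f = v g" if "smooth_near A p f" "smooth_near A p g" "\<forall>\<^sub>F q in nhds p. f q = g q" for f g
  proof -
    have "\<forall>f g. smooth_near A p f \<and> smooth_near A p g \<and> (\<forall>\<^sub>F q in nhds p. f q = g q) \<longrightarrow> v f = v g"
      using v by (simp add: tangent_space_def)
    then show ?thesis using that by simp
  qed
  have add: "v (\<lambda>q. f q + g q) = v f + v g" if "smooth_near A p f" "smooth_near A p g" for f g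
  proof -
    have "\<forall>f g. smooth_near A p f \<and> smooth_near A p g \<longrightarrow> v (\<lambda>q. f q + g q) = v f + v g"
      using v by (simp add: tangent_space_def)
    then show ?thesis using that by simp
  qed
  have scale: "v (\<lambda>q. c * f q) = c * v f" if "smooth_near A p f" for f c
  proof -
    have "\<forall>f c. smooth_near A p f \<longrightarrow> v (\<lambda>q. c * f q) = c * v f"
      using v by (simp add: tangent_space_def)
    then show ?thesis using that by simp
  qed
  have mult: "v (\<lambda>q. f q * g q) = v f * g p + f p * v g" if "smooth_near A p f" "smooth_near A p g" for f g
  proof -
    have "\<forall>f g. smooth_near A p f \<and> smooth_near A p g \<longrightarrow> v (\<lambda>q. f q * g q) = v f * g p + f p * v g"
      using v by (simp add: tangent_space_def)
    then show ?thesis using that by simp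
  qed
  obtain e where e: "e > 0" "ball (\<kappa> p) e \<subseteq> \<kappa> ` V"
    using open_\<kappa>[OF V(1,2)] V(3) by (meson imageI openE)
  let ?B = "ball (\<kappa> p) e"
  \<comment> \<open>Shrinking to the preimage of a ball makes the Hadamard expansion available;
    tangent vectors see only germs.\<close>
  define N where "N = V \<inter> \<kappa> -` ?B"
  have N: "open N" "N \<subseteq> U" "p \<in> N"
  proof -
    have "open (U \<inter> \<kappa> -` ?B)" by (rule continuous_open_preimage[OF continuous_\<kappa> open_U open_ball])
    moreover have "N = V \<inter> (U \<inter> \<kappa> -` ?B)" using V by (auto simp: N_def)
    ultimately show "open N" using V by auto
    show "N \<subseteq> U" "p \<in> N" using V e by (auto simp: N_def)
  qed
  have \<kappa>N: "\<kappa> ` N \<subseteq> ?B" by (auto simp: N_def)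
  note oN = open_\<kappa>[OF N(1,2)]
  have near: "smooth_near A p (\<lambda>q. G (\<kappa> q))" if "smooth_on (\<kappa> ` N) G" for G
    by (rule smooth_nearI[OF N that]) simp
  from hadamard_ball[OF smooth_on_subset[OF F e(2)]]
  obtain g where g': "\<forall>k. smooth_on ?B (g k)"
    and Fg: "\<forall>y\<in>?B. F y = F (\<kappa> p) + (\<Sum>k\<in>UNIV. (y $ k - \<kappa> p $ k) * g k y)"
    and g0: "\<forall>k. g k (\<kappa> p) = FD F (\<kappa> p) (axis k 1)"
    by (elim exE conjE)
  note g = g'[rule_format]
  have gN: "smooth_on (\<kappa> ` N) (g k)" for k by (rule smooth_on_subset[OF g \<kappa>N])
  have coN: "smooth_on (\<kappa> ` N) (\<lambda>y. y $ k)" for k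
    by (intro smooth_on_vec_nth smooth_on_id oN)
  have const: "v (\<lambda>q. c) = 0" for c
  proof -
    \<comment> \<open>The Leibniz rule for \<open>1 * 1\<close> makes the value at the constant 1
      equal to its double.\<close>
    have n: "smooth_near A p (\<lambda>q. 1)" by (rule near) (rule smooth_on_const)
    from mult[OF n n] have "v (\<lambda>q. 1) = 0" by simp
    with scale[OF n, of c] show ?thesis by simp
  qed
  \<comment> \<open>The difference is written as a sum with \<open>- \<kappa> p $ k\<close>, to
    which the additivity of tangent vectors applies.\<close>
  let ?T = "\<lambda>k q. (\<kappa> q $ k + - \<kappa> p $ k) * g k (\<kappa> q)"
  have cN: "smooth_near A p (\<lambda>q. \<kappa> q $ k + - \<kappa> p $ k)" for k
    by (rule near[of "\<lambda>y. y $ k + - \<kappa> p $ k"]) (intro smooth_on_add oN coN smooth_on_const)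
  have TN: "smooth_on (\<kappa> ` N) (\<lambda>y. (y $ k + - \<kappa> p $ k) * g k y)" for k
    by (intro smooth_on_mult smooth_on_add oN coN smooth_on_const gN)
  have vT: "v (?T k) = v (\<lambda>q. \<kappa> q $ k) * FD F (\<kappa> p) (axis k 1)" for k
  proof -
    have "v (?T k) = v (\<lambda>q. \<kappa> q $ k + - \<kappa> p $ k) * g k (\<kappa> p)"
      using mult[OF cN near[OF gN]] by simp
    also have "v (\<lambda>q. \<kappa> q $ k + - \<kappa> p $ k) = v (\<lambda>q. \<kappa> q $ k)"
      using add[OF near[OF coN[of k]] near[OF smooth_on_const[of _ "- \<kappa> p $ k"]]]
      by (simp only: const add_0_right)
    finally show ?thesis by (simp add: g0)
  qed
  have sum: "v (\<lambda>q. \<Sum>k\<in>K. ?T k q) = (\<Sum>k\<in>K. v (?T k))" if "finite K" for K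
    using that
  proof (induction K)
    case (insert k K)
    have "smooth_near A p (\<lambda>q. \<Sum>k\<in>K. ?T k q)"
      by (rule near[of "\<lambda>y. \<Sum>k\<in>K. (y $ k + - \<kappa> p $ k) * g k y"]) (intro smooth_on_sum oN TN)
    with add[OF near[OF TN[of k]] this] insert show ?case by simp
  qed (simp add: const)
  have nsum: "smooth_near A p (\<lambda>q. \<Sum>k\<in>UNIV. ?T k q)"
    by (rule near[of "\<lambda>y. \<Sum>k\<in>UNIV. (y $ k + - \<kappa> p $ k) * g k y"]) (intro smooth_on_sum oN TN)
  have "v f = v (\<lambda>q. F (\<kappa> p) + (\<Sum>k\<in>UNIV. ?T k q))"
  proof (rule germ)
    show "smooth_near A p f" by (rule smooth_nearI[OF V F f])
    show "smooth_near A p (\<lambda>q. F (\<kappa> p) + (\<Sum>k\<in>UNIV. ?T k q))"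
      by (rule near[of "\<lambda>y. F (\<kappa> p) + (\<Sum>k\<in>UNIV. (y $ k + - \<kappa> p $ k) * g k y)"])
        (intro smooth_on_add smooth_on_const smooth_on_sum oN TN)
    show "\<forall>\<^sub>F q in nhds p. f q = F (\<kappa> p) + (\<Sum>k\<in>UNIV. ?T k q)"
      unfolding eventually_nhds
    proof (intro exI conjI ballI)
      fix q assume "q \<in> N"
      then have q: "q \<in> V" "\<kappa> q \<in> ?B" by (auto simp: N_def)
      show "f q = F (\<kappa> p) + (\<Sum>k\<in>UNIV. ?T k q)"
        unfolding f[OF q(1)] add_uminus_conv_diff by (rule Fg[rule_format, OF q(2)])
    qed (use N in auto)
  qed
  also have "\<dots> = v (\<lambda>q. F (\<kappa> p)) + v (\<lambda>q. \<Sum>k\<in>UNIV. ?T k q)"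
    by (rule add[OF near[OF smooth_on_const] nsum])
  finally show ?thesis by (simp only: sum[OF finite] const vT add_0_left)
qed

end

locale chart_frame = manifold_chart A U \<kappa>
  for A :: "('m::{t2_space,second_countable_topology}, 'n::finite) chart set" and U \<kappa> +
  fixes W :: "'m set" and X :: "'n \<Rightarrow> 'm vfield"
  assumes open_W: "open W" and X_smooth: "smooth_vfield A W (X j)"
begin

abbreviation Y :: "'n \<Rightarrow> real ^ 'n \<Rightarrow> real ^ 'n" where
  "Y j \<equiv> coord_vfield (U, \<kappa>) (X j)"

lemma open_UW: "open (U \<inter> W)" using open_U open_W by auto

lemma Y_nth: "p \<in> U \<Longrightarrow> Y j (\<kappa> p) $ k = X j p (\<lambda>q. \<kappa> q $ k)"
  by (simp add: coord_vfield_def inv_\<kappa>)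

lemma Y_smooth_chart: "smooth_on (\<kappa> ` (U \<inter> W)) (Y j)"
proof -
  have "smooth_on (\<kappa> ` (U \<inter> W)) (\<lambda>x. Y j x $ k)" for k
  proof -
    have "smooth_fun_on A (U \<inter> W) (\<lambda>q. \<kappa> q $ k)"
      by (subst smooth_fun_on_iff[OF open_UW, where F="\<lambda>x. x $ k"])
        (auto intro!: smooth_on_vec_nth smooth_on_id open_\<kappa> open_UW)
    then have "smooth_fun_on A (U \<inter> W) (\<lambda>p. X j p (\<lambda>q. \<kappa> q $ k))"
      using X_smooth[of j] open_UW unfolding smooth_vfield_def by blast
    then show ?thesis
      by (subst (asm) smooth_fun_on_iff[OF open_UW, where F="\<lambda>x. Y j x $ k"]) (auto simp: Y_nth)
  qed
  then show ?thesis
    by (intro smooth_on_vec_iff[THEN iffD2] allI open_\<kappa> open_UW) auto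
qed

lemma X_apply:
  assumes V: "open V" "V \<subseteq> U \<inter> W" "p \<in> V" and F: "smooth_on (\<kappa> ` V) F" and f: "\<And>q. q \<in> V \<Longrightarrow> f q = F (\<kappa> q)"
  shows "X j p f = FD F (\<kappa> p) (Y j (\<kappa> p))"
proof -
  have "X j p \<in> tangent_space A p" using X_smooth[of j] V unfolding smooth_vfield_def by blast
  then have "X j p f = (\<Sum>k\<in>UNIV. X j p (\<lambda>q. \<kappa> q $ k) * FD F (\<kappa> p) (axis k 1))"
    by (rule tangent_formula[OF _ V(1) _ V(3) F f]) (use V in auto)
  also have "\<dots> = (\<Sum>k\<in>UNIV. Y j (\<kappa> p) $ k *\<^sub>R FD F (\<kappa> p) (axis k 1))"
    using V by (intro sum.cong refl) (auto simp: Y_nth)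
  also have "\<dots> = FD F (\<kappa> p) (Y j (\<kappa> p))"
    by (rule FD_linear_sum[symmetric]) (use smooth_on_differentiable[OF F] V in auto)
  finally show ?thesis .
qed

text \<open>Smoothness belongs to the induction because \<open>X_apply\<close> asks for it at the
  next letter.\<close>

lemma apply_word_chart:
  assumes F: "smooth_on (\<kappa> ` (U \<inter> W)) F" and f: "\<And>q. q \<in> U \<inter> W \<Longrightarrow> f q = F (\<kappa> q)"
  shows "smooth_on (\<kappa> ` (U \<inter> W)) (word_deriv Y I F) \<and>
    (\<forall>q\<in>U \<inter> W. apply_word X I f q = word_deriv Y I F (\<kappa> q))"
proof (induction I)
  case (Cons i I)
  have "X i q (apply_word X I f) = FD (word_deriv Y I F) (\<kappa> q) (Y i (\<kappa> q))" if "q \<in> U \<inter> W" for q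
    by (rule X_apply[OF open_UW order_refl that]) (use Cons in auto)
  moreover have "smooth_on (\<kappa> ` (U \<inter> W)) (\<lambda>x. FD (word_deriv Y I F) x (Y i x))"
    by (rule smooth_on_FD_apply[OF open_\<kappa>[OF open_UW] _ Y_smooth_chart]) (use Cons in auto)
  ultimately show ?case by simp
qed (use F f in auto)

lemma lie_bracket_coord:
  assumes p: "p \<in> U \<inter> W"
  shows "lie_bracket A (X i) (X j) p (\<lambda>q. \<kappa> q $ k) = vfield_bracket (Y i) (Y j) (\<kappa> p) $ k"
proof -
  have co: "smooth_on (\<kappa> ` (U \<inter> W)) (\<lambda>x. x $ k)"
    by (auto intro!: smooth_on_vec_nth smooth_on_id open_\<kappa> open_UW)
  have "smooth_near A p (\<lambda>q. \<kappa> q $ k)"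
    by (rule smooth_nearI[OF open_UW _ p co]) auto
  moreover have "X i p (\<lambda>q. X j q (\<lambda>q. \<kappa> q $ k)) = FD (Y j) (\<kappa> p) (Y i (\<kappa> p)) $ k" for i j
  proof -
    have "X i p (\<lambda>q. X j q (\<lambda>q. \<kappa> q $ k)) = FD (\<lambda>x. Y j x $ k) (\<kappa> p) (Y i (\<kappa> p))"
      by (rule X_apply[OF open_UW order_refl p])
        (auto intro!: smooth_on_vec_nth Y_smooth_chart open_\<kappa> open_UW simp: Y_nth)
    also have "\<dots> = FD (Y j) (\<kappa> p) (Y i (\<kappa> p)) $ k"
      by (rule FD_vec_nth) (use smooth_on_differentiable[OF Y_smooth_chart] p in auto)
    finally show ?thesis .
  qed
  ultimately show ?thesis by (simp add: lie_bracket_def vfield_bracket_def)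
qed

lemma lie_bracket_expand:
  assumes p: "p \<in> U \<inter> W" and c: "lie_bracket A (X i) (X j) p = (\<Sum>l\<in>UNIV. tscale (c l) (X l p))"
  shows "vfield_bracket (Y i) (Y j) (\<kappa> p) = (\<Sum>l\<in>UNIV. c l *\<^sub>R Y l (\<kappa> p))"
  unfolding vec_eq_iff
proof
  fix k
  have ev: "(\<Sum>l\<in>S. tscale (c l) (X l p)) f = (\<Sum>l\<in>S. c l * X l p f)" for S f
    by (induction S rule: infinite_finite_induct) (auto simp: tscale_def)
  show "vfield_bracket (Y i) (Y j) (\<kappa> p) $ k = (\<Sum>l\<in>UNIV. c l *\<^sub>R Y l (\<kappa> p)) $ k"
    unfolding lie_bracket_coord[OF p, symmetric] c ev using p by (simp add: Y_nth)
qed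

lemma coord_vfield_comp:
  assumes V: "open V" "V \<subseteq> U" and inj: "inj_on (\<psi> \<circ> \<kappa>) V" and \<psi>: "smooth_on (\<kappa> ` V) \<psi>"
    and x: "x \<in> \<kappa> ` (V \<inter> W)"
  shows "coord_vfield (V, \<psi> \<circ> \<kappa>) (X j) (\<psi> x) = FD \<psi> x (Y j x)"
  unfolding vec_eq_iff
proof
  fix k
  obtain p where p: "p \<in> V \<inter> W" "x = \<kappa> p" using x by blast
  have o: "open (V \<inter> W)" using V open_W by auto
  have sub: "V \<inter> W \<subseteq> U \<inter> W" using V by auto
  have s: "smooth_on (\<kappa> ` (V \<inter> W)) \<psi>" by (rule smooth_on_subset[OF \<psi>]) auto
  have "inv_into V (\<psi> \<circ> \<kappa>) (\<psi> x) = p" using inv_into_f_f[OF inj] p by auto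
  then have "coord_vfield (V, \<psi> \<circ> \<kappa>) (X j) (\<psi> x) $ k = X j p (\<lambda>q. \<psi> (\<kappa> q) $ k)"
    by (simp add: coord_vfield_def)
  also have "\<dots> = FD (\<lambda>x. \<psi> x $ k) (\<kappa> p) (Y j (\<kappa> p))"
    by (rule X_apply[OF o sub p(1)])
      (use V in \<open>auto intro!: smooth_on_vec_nth s open_\<kappa> o\<close>)
  also have "\<dots> = FD \<psi> x (Y j x) $ k" unfolding p(2)
    by (rule FD_vec_nth) (use smooth_on_differentiable[OF s] p in auto)
  finally show "coord_vfield (V, \<psi> \<circ> \<kappa>) (X j) (\<psi> x) $ k = FD \<psi> x (Y j x) $ k" .
qed

end

lemma smooth_chart_compose:
  fixes A :: "('m::{t2_space,second_countable_topology}, 'n::finite) chart set"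
  assumes A: "smooth_atlas A" and U: "smooth_chart A (U, \<kappa>)" and \<phi>: "smooth_on UNIV \<phi>" and \<psi>: "smooth_on UNIV \<psi>"
    and inv: "\<And>x. \<psi> (\<phi> x) = x" "\<And>y. \<phi> (\<psi> y) = y"
  shows "smooth_chart A (U, \<phi> \<circ> \<kappa>)"
proof -
  note tU = smooth_chartD(1)[OF U]
  note c = topological_chartD[OF tU]
  have inj: "inj \<phi>" using inv(1) by (metis injI)
  have injc: "inj_on (\<phi> \<circ> \<kappa>) U" by (rule comp_inj_on[OF c(2) inj_on_subset[OF inj subset_UNIV]])
  have img: "\<phi> ` S = \<psi> -` S" for S using inv by (auto simp: image_iff) metis
  have oimg: "open (\<phi> ` S)" if "open S" for S
    unfolding img by (rule open_vimage[OF that smooth_on_continuous[OF \<psi>]])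
  have inv_comp: "inv_into U (\<phi> \<circ> \<kappa>) y = inv_into U \<kappa> (\<psi> y)" if "y \<in> (\<phi> \<circ> \<kappa>) ` U" for y
    using that inv_into_f_f[OF injc] inv_into_f_f[OF c(2)] inv(1) by fastforce
  have cont: "continuous_on S \<phi>" "continuous_on S \<psi>" for S
    using smooth_on_continuous[OF smooth_on_subset[OF \<phi>]] smooth_on_continuous[OF smooth_on_subset[OF \<psi>]] by auto
  have "topological_chart (U, \<phi> \<circ> \<kappa>)"
    unfolding topological_chart_def split
  proof (intro conjI)
    show "open ((\<phi> \<circ> \<kappa>) ` U)" using oimg[OF c(4)] by (simp add: image_comp)
    show "homeomorphism U ((\<phi> \<circ> \<kappa>) ` U) (\<phi> \<circ> \<kappa>) (inv_into U (\<phi> \<circ> \<kappa>))"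
    proof (rule homeomorphismI)
      show "continuous_on U (\<phi> \<circ> \<kappa>)" by (rule continuous_on_compose[OF c(3) cont(1)])
      have "continuous_on ((\<phi> \<circ> \<kappa>) ` U) (\<lambda>y. inv_into U \<kappa> (\<psi> y))"
        by (rule continuous_on_compose2[OF c(5) cont(2)]) (use inv in auto)
      then show "continuous_on ((\<phi> \<circ> \<kappa>) ` U) (inv_into U (\<phi> \<circ> \<kappa>))"
        using inv_comp by (simp cong: continuous_on_cong)
    qed (use injc inv_into_f_f[OF injc] in auto)
  qed (rule c(1))
  moreover have "compatible_charts (U, \<phi> \<circ> \<kappa>) (N, \<nu>)" if N: "(N, \<nu>) \<in> A" "topological_chart (N, \<nu>)" for N \<nu>
  proof -
    have oUN: "open (U \<inter> N)" using c(1) topological_chartD(1)[OF N(2)] by auto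
    have o1: "open (\<kappa> ` (U \<inter> N))" "open (\<nu> ` (U \<inter> N))"
      using topological_chart_image_open[OF tU oUN] topological_chart_image_open[OF N(2) oUN] by auto
    have o2: "open ((\<phi> \<circ> \<kappa>) ` (U \<inter> N))" using oimg[OF o1(1)] by (simp add: image_comp)
    have "smooth_on ((\<phi> \<circ> \<kappa>) ` (U \<inter> N)) (\<lambda>y. (\<nu> \<circ> inv_into U \<kappa>) (\<psi> y))"
      by (rule smooth_on_compose[OF o2 o1(1) smooth_on_subset[OF \<psi>] smooth_chartD(2)[OF U N(1)]])
        (use inv in auto)
    moreover have "smooth_on ((\<phi> \<circ> \<kappa>) ` (U \<inter> N)) (\<lambda>y. (\<nu> \<circ> inv_into U \<kappa>) (\<psi> y)) \<longleftrightarrow>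
        smooth_on ((\<phi> \<circ> \<kappa>) ` (U \<inter> N)) (\<nu> \<circ> inv_into U (\<phi> \<circ> \<kappa>))"
      by (rule smooth_on_cong[OF o2]) (use inv_comp in auto)
    moreover have "smooth_on (\<nu> ` (U \<inter> N)) (\<lambda>y. \<phi> ((\<kappa> \<circ> inv_into N \<nu>) y))"
      by (rule smooth_on_compose[OF o1(2) open_UNIV smooth_chartD(3)[OF U N(1)] \<phi>]) simp
    then have "smooth_on (\<nu> ` (U \<inter> N)) (\<phi> \<circ> \<kappa> \<circ> inv_into N \<nu>)" by (simp add: o_def)
    ultimately show ?thesis by (simp add: compatible_charts_def)
  qed
  moreover have "topological_chart d" if "d \<in> A" for d
    using A that by (simp add: smooth_atlas_def)
  ultimately show ?thesis unfolding smooth_chart_def by auto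
qed

section \<open>Carnot coordinates\<close>

text \<open>The position \<open>card {..j}\<close> is strictly increasing in \<open>j\<close>, hence
  a bijection onto the positions from 1 to \<open>CARD('n)\<close>. This counts the frame fields of
  weight at most \<open>s\<close>.\<close>

lemma card_initial_segments:
  assumes "d \<le> CARD('n::{finite,linorder})"
  shows "card {j::'n. card {..j} \<le> d} = d"
proof -
  let ?c = "\<lambda>j::'n. card {..j}"
  have mono: "?c i < ?c j" if "i < j" for i j :: 'n
    using that by (intro psubset_card_mono) (auto simp: psubset_eq)
  have inj: "inj ?c"
    by (rule linorder_injI) (use mono in \<open>metis less_irrefl\<close>)
  have sub: "range ?c \<subseteq> {1..CARD('n)}"
    using card_mono[OF finite subset_UNIV] by (auto simp: Suc_le_eq card_gt_0_iff)
  have "range ?c = {1..CARD('n)}"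
    by (rule card_subset_eq[OF _ sub]) (simp_all add: card_image[OF inj])
  moreover have "?c ` {j. ?c j \<le> d} = {k \<in> range ?c. k \<le> d}" by auto
  ultimately have "?c ` {j. ?c j \<le> d} = {1..d}" using assms by auto
  then have "card (?c ` {j. ?c j \<le> d}) = d" by simp
  then show ?thesis by (simp add: card_image[OF inj_on_subset[OF inj subset_UNIV]])
qed

text \<open>The fibres have one common dimension \<open>d\<close>, which gives the definite
  description in \<open>bundle_rank\<close> its value.\<close>

lemma subbundle_basis:
  assumes "subbundle A E"
  shows "\<exists>B. finite B \<and> \<not> tdependent B \<and> tspan B = E p \<and> card B = bundle_rank E"
proof -
  from assms obtain d :: nat where d: "\<forall>p. \<exists>U Y. open U \<and> p \<in> U \<and> (\<forall>i<d. smooth_vfield A U (Y i)) \<and>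
     (\<forall>q\<in>U. tbasis {..<d} (\<lambda>i. Y i q) (E q))" unfolding subbundle_def by (elim exE)
  have B: "\<exists>B. finite B \<and> \<not> tdependent B \<and> tspan B = E q \<and> card B = d" for q
  proof -
    from d obtain Y where "tbasis {..<d} (\<lambda>i. Y i q) (E q)" by blast
    then show ?thesis unfolding tbasis_def
      by (intro exI[of _ "(\<lambda>i. Y i q) ` {..<d}"]) (auto simp: card_image)
  qed
  have dim: "tdim (E q) = d" for q
  proof -
    from B obtain B where "\<not> tdependent B" "tspan B = E q" "card B = d" by blast
    then show ?thesis using tvec.dim_span_eq_card_independent by metis
  qed
  have "bundle_rank E = d" unfolding bundle_rank_def
    by (rule the_equality) (use dim in auto)
  then show ?thesis using B by blast
qed

lemma tvec_span_eq:
  assumes B: "finite B" "tspan B = E" and S: "finite S" "\<not> tdependent S" "S \<subseteq> E" "card B \<le> card S"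
  shows "E \<subseteq> tspan S"
proof
  fix v assume v: "v \<in> E"
  show "v \<in> tspan S"
  proof (rule ccontr)
    assume n: "v \<notin> tspan S"
    then have "\<not> tdependent (insert v S)" using S tvec.independent_insertI by blast
    moreover have "insert v S \<subseteq> tspan B" using v S B by auto
    ultimately have "card (insert v S) \<le> card B" using tvec.independent_span_bound[OF B(1)] by blast
    moreover have "v \<notin> S" using n tvec.span_base by blast
    ultimately show False using S by simp
  qed
qed

lemma converges_to_model_unique:
  assumes "converges_to_model w X c j Z" "converges_to_model w X c j Z'"
  shows "Z = Z'"
proof
  fix x
  show "Z x = Z' x"
    using smooth_limit_tendsto[OF assms(1)[unfolded converges_to_model_def], of x]
      smooth_limit_tendsto[OF assms(2)[unfolded converges_to_model_def], of x]
    by (rule tendsto_unique[rotated]) simp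
qed

section \<open>Privileged coordinates on a Carnot manifold\<close>

locale carnot_chart =
  fixes A :: "('m::{t2_space,second_countable_topology}, 'n::{finite,linorder}) chart set"
    and r :: nat and H :: "nat \<Rightarrow> 'm \<Rightarrow> 'm tvec set" and a :: 'm and W U :: "'m set"
    and X :: "'n \<Rightarrow> 'm vfield" and \<kappa> :: "'m \<Rightarrow> (real, 'n) vec" and w :: "'n \<Rightarrow> nat"
  assumes carnot: "carnot_manifold A r H" and frame: "H_frame A H a W X"
    and w_def: "w = weights H" and privileged: "privileged_coords A w X a (U, \<kappa>)"
begin

lemma H_mono:
  assumes "1 \<le> s" "s \<le> s'" "s' \<le> r" shows "H s p \<subseteq> H s' p"
  using assms(2,3)
proof (induction rule: dec_induct)
  case (step m)
  have "m \<in> {1..<r}" using step assms(1) by auto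
  moreover have "\<forall>s\<in>{1..<r}. \<forall>p. H s p \<subseteq> H (Suc s) p"
    using carnot by (simp add: carnot_manifold_def)
  ultimately have "H m p \<subseteq> H (Suc m) p" by simp
  then show ?case using step by auto
qed simp

lemma H_basis:
  assumes "1 \<le> s" "s \<le> r"
  shows "\<exists>B. finite B \<and> \<not> tdependent B \<and> tspan B = H s p \<and> card B = bundle_rank (H s)"
  using carnot assms by (intro subbundle_basis[where A=A]) (simp add: carnot_manifold_def)

lemma r_ge_1: "1 \<le> r"
  using carnot by (simp add: carnot_manifold_def)

lemma rank_mono:
  assumes "1 \<le> s" "s \<le> s'" "s' \<le> r" shows "bundle_rank (H s) \<le> bundle_rank (H s')"
proof -
  obtain B where B: "\<not> tdependent B" "tspan B = H s a" "card B = bundle_rank (H s)"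
    using H_basis[of s a] assms by auto
  obtain B' where B': "finite B'" "tspan B' = H s' a" "card B' = bundle_rank (H s')"
    using H_basis[of s' a] assms by auto
  have "B \<subseteq> tspan B'" using H_mono[OF assms, of a] B B' tvec.span_superset by blast
  then show ?thesis using tvec.independent_span_bound[OF B'(1) B(1)] B B' by simp
qed

lemma frame_basis:
  assumes "q \<in> W"
  shows "inj (\<lambda>j. X j q)" "\<not> tdependent (range (\<lambda>j. X j q))" "tspan (range (\<lambda>j. X j q)) = tangent_space A q"
  using frame assms unfolding H_frame_def tbasis_def by auto

lemma a_in_W: "a \<in> W" and open_frame: "open W"
  using frame by (auto simp: H_frame_def)

lemma rank_top: "bundle_rank (H r) = CARD('n)"
proof -
  obtain B where B: "\<not> tdependent B" "tspan B = H r a" "card B = bundle_rank (H r)"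
    using H_basis[of r a] r_ge_1 by auto
  have "H r a = tangent_space A a" using carnot by (simp add: carnot_manifold_def)
  then have "tspan B = tspan (range (\<lambda>j. X j a))" using B frame_basis[OF a_in_W] by simp
  then have "card B = card (range (\<lambda>j. X j a))"
    using tvec.dim_span_eq_card_independent B(1) frame_basis(2)[OF a_in_W] by metis
  then show ?thesis using B card_image[OF frame_basis(1)[OF a_in_W]] by simp
qed

text \<open>Ranks are monotone in the filtration index, so the least admissible index is a
  threshold; \<open>rank_top\<close> shows that some index is admissible.\<close>

lemma weight_le_iff:
  assumes "1 \<le> s" "s \<le> r" shows "w j \<le> s \<longleftrightarrow> card {..j} \<le> bundle_rank (H s)"
proof
  assume "card {..j} \<le> bundle_rank (H s)"
  then show "w j \<le> s" unfolding w_def weights_def using assms by (intro Least_le) simp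
next
  assume l: "w j \<le> s"
  have "1 \<le> r \<and> card {..j} \<le> bundle_rank (H r)" using r_ge_1 by (simp add: rank_top card_mono)
  then have "1 \<le> w j \<and> card {..j} \<le> bundle_rank (H (w j))"
    unfolding w_def weights_def by (rule LeastI)
  then show "card {..j} \<le> bundle_rank (H s)" using rank_mono[of "w j" s] l assms by linarith
qed

lemma weight_bounds: "1 \<le> w j" "w j \<le> r"
proof -
  have r: "1 \<le> r \<and> card {..j} \<le> bundle_rank (H r)" using r_ge_1 by (simp add: rank_top card_mono)
  then have "1 \<le> w j \<and> card {..j} \<le> bundle_rank (H (w j))"
    unfolding w_def weights_def by (rule LeastI)
  then show "1 \<le> w j" by simp
  show "w j \<le> r" using weight_le_iff[of r j] r by simp
qed

lemma frame_section: "section_on A (H (w j)) W (X j)"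
  using frame by (simp add: H_frame_def w_def)

text \<open>The frame fields of weight at most \<open>s\<close> are independent elements of the
  fibre, and there are \<open>bundle_rank (H s)\<close> of them, so they span it.\<close>

lemma H_expand:
  assumes s: "1 \<le> s" "s \<le> r" and q: "q \<in> W" and v: "v \<in> H s q"
  shows "\<exists>c. (\<forall>l. s < w l \<longrightarrow> c l = 0) \<and> v = (\<Sum>l\<in>UNIV. tscale (c l) (X l q))"
proof -
  let ?I = "{l. w l \<le> s}"
  let ?S = "(\<lambda>l. X l q) ` ?I"
  obtain B where B: "finite B" "tspan B = H s q" "card B = bundle_rank (H s)"
    using H_basis[OF s, of q] by auto
  have inj: "inj_on (\<lambda>l. X l q) ?I" by (rule inj_on_subset[OF frame_basis(1)[OF q]]) simp
  have "card ?S = card {l::'n. card {..l} \<le> bundle_rank (H s)}"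
    unfolding card_image[OF inj] by (simp only: weight_le_iff[OF s])
  also have "\<dots> = bundle_rank (H s)"
    using rank_mono[OF s(1,2) order_refl] by (intro card_initial_segments) (simp add: rank_top)
  finally have card: "card B \<le> card ?S" using B by simp
  have sub: "?S \<subseteq> H s q"
  proof
    fix u assume "u \<in> ?S"
    then obtain l where l: "w l \<le> s" "u = X l q" by blast
    have "X l q \<in> H (w l) q" using frame_section[of l] q by (simp add: section_on_def)
    then show "u \<in> H s q" using H_mono[OF weight_bounds(1) l(1) s(2), of q] l by blast
  qed
  have "\<not> tdependent ?S" by (rule tvec.independent_mono[OF frame_basis(2)[OF q]]) auto
  with v have "v \<in> tspan ?S" using tvec_span_eq[OF B(1,2) _ _ sub card] by auto
  then obtain u where "v = (\<Sum>x\<in>?S. tscale (u x) x)"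
    using tvec.span_finite[of ?S] by auto
  also have "\<dots> = (\<Sum>l\<in>?I. tscale (u (X l q)) (X l q))" by (simp add: sum.reindex[OF inj])
  also have "\<dots> = (\<Sum>l\<in>UNIV. tscale (if w l \<le> s then u (X l q) else 0) (X l q))"
    by (rule sum.mono_neutral_cong_left) (auto simp: tscale_def fun_eq_iff)
  finally show ?thesis by (intro exI[of _ "\<lambda>l. if w l \<le> s then u (X l q) else 0"]) auto
qed

lemma is_chart: "smooth_chart A (U, \<kappa>)" and a_in_U: "a \<in> U" and \<kappa>_a: "\<kappa> a = 0"
  using privileged by (auto simp: privileged_coords_def)

sublocale chart_frame A U \<kappa> W X
  by unfold_locales
    (use carnot is_chart open_frame frame_section in \<open>auto simp: carnot_manifold_def section_on_def\<close>)

definition \<rho> :: real where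
  "\<rho> = (SOME e. e > 0 \<and> ball 0 e \<subseteq> \<kappa> ` (U \<inter> W))"

lemma \<rho>: "\<rho> > 0" "ball 0 \<rho> \<subseteq> \<kappa> ` (U \<inter> W)"
proof -
  have "0 \<in> \<kappa> ` (U \<inter> W)" using a_in_U a_in_W \<kappa>_a by (metis IntI image_eqI)
  then have "\<exists>e. e > 0 \<and> ball 0 e \<subseteq> \<kappa> ` (U \<inter> W)" using open_\<kappa>[OF open_UW] openE by (metis Int_lower1)
  from someI_ex[OF this] show "\<rho> > 0" "ball 0 \<rho> \<subseteq> \<kappa> ` (U \<inter> W)" by (auto simp: \<rho>_def)
qed

lemma apply_word_at_a:
  assumes "smooth_on (\<kappa> ` (U \<inter> W)) F" "\<And>q. q \<in> U \<inter> W \<Longrightarrow> f q = F (\<kappa> q)"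
  shows "apply_word X I f a = word_deriv Y I F 0"
  using apply_word_chart[OF assms, of I] a_in_U a_in_W \<kappa>_a by auto

lemma smooth_coord: "smooth_on (\<kappa> ` (U \<inter> W)) (\<lambda>x. x $ k)"
  by (intro smooth_on_vec_nth smooth_on_id open_\<kappa> open_UW) auto

sublocale privileged_fields w Y \<rho>
proof unfold_locales
  show "1 \<le> w j" for j by (rule weight_bounds)
  show "\<rho> > 0" by (rule \<rho>)
  show "smooth_on (ball 0 \<rho>) (Y j)" for j by (rule smooth_on_subset[OF Y_smooth_chart \<rho>(2)])
  show "Y j 0 = axis j 1" for j using privileged by (simp add: privileged_coords_def)
  show "word_deriv Y I (\<lambda>x. x $ k) 0 = 0" if "sum_list (map w I) < w k" for I k
  proof -
    have "has_order A w X a (\<lambda>q. \<kappa> q $ k) (w k)" using privileged by (simp add: privileged_coords_def)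
    then have "apply_word X I (\<lambda>q. \<kappa> q $ k) a = 0" using that by (simp add: has_order_def)
    then show ?thesis using apply_word_at_a[OF smooth_coord, of "\<lambda>q. \<kappa> q $ k" k I] by simp
  qed
qed

lemma ball_point:
  fixes x :: "(real, 'n) vec"
  assumes "x \<in> ball 0 \<rho>" obtains p where "p \<in> U \<inter> W" "x = \<kappa> p"
  using assms \<rho>(2) by blast

lemma bracket_expand:
  assumes "w i + w j \<le> r" "p \<in> U \<inter> W"
  shows "\<exists>c. (\<forall>l. w i + w j < w l \<longrightarrow> c l = 0) \<and>
    lie_bracket A (X i) (X j) p = (\<Sum>l\<in>UNIV. tscale (c l) (X l p))"
proof (rule H_expand)
  have "\<forall>s s' U X Y. 1 \<le> s \<and> 1 \<le> s' \<and> s + s' \<le> r \<and> open U \<and>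
        section_on A (H s) U X \<and> section_on A (H s') U Y \<longrightarrow>
        section_on A (H (s + s')) U (lie_bracket A X Y)"
    using carnot by (simp add: carnot_manifold_def)
  then have "section_on A (H (w i + w j)) W (lie_bracket A (X i) (X j))"
    using weight_bounds assms frame_section open_frame by blast
  then show "lie_bracket A (X i) (X j) p \<in> H (w i + w j) p" using assms by (simp add: section_on_def)
qed (use weight_bounds(1)[of i] assms in auto)

text \<open>At \<open>a\<close> the frame becomes the standard basis of the chart, so coefficients
  are components; this also settles uniqueness in the definite description of
  \<open>structure_fun\<close>.\<close>

lemma structure_fun_eq:
  assumes "w i + w j \<le> r"
  shows "structure_fun A X i j k a = vfield_bracket (Y i) (Y j) 0 $ k"
proof -
  have a: "a \<in> U \<inter> W" using a_in_U a_in_W by simp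
  have coeff: "c = (\<lambda>k. vfield_bracket (Y i) (Y j) 0 $ k)"
    if "lie_bracket A (X i) (X j) a = (\<Sum>l\<in>UNIV. tscale (c l) (X l a))" for c
  proof
    fix k
    have "vfield_bracket (Y i) (Y j) 0 = (\<Sum>l\<in>UNIV. c l *\<^sub>R axis l 1)"
      using lie_bracket_expand[OF a that] by (simp add: \<kappa>_a Y_0)
    then show "c k = vfield_bracket (Y i) (Y j) 0 $ k"
      by (simp add: axis_def if_distrib cong: if_cong)
  qed
  obtain c where c: "lie_bracket A (X i) (X j) a = (\<Sum>l\<in>UNIV. tscale (c l) (X l a))"
    using bracket_expand[OF assms a] by blast
  have "(THE c. lie_bracket A (X i) (X j) a = (\<Sum>l\<in>UNIV. tscale (c l) (X l a))) = c"
  proof (rule the_equality)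
    show "c' = c" if "lie_bracket A (X i) (X j) a = (\<Sum>l\<in>UNIV. tscale (c' l) (X l a))" for c'
      unfolding coeff[OF that] coeff[OF c] ..
  qed (rule c)
  then show ?thesis by (simp add: structure_fun_def coeff[OF c])
qed

lemma model_bracket_eq:
  "vfield_bracket (model i) (model j) y =
    (\<Sum>l | w l = w i + w j. structure_fun A X i j l a *\<^sub>R model l y)"
proof (cases "w i + w j \<le> r")
  case True
  have "\<forall>x\<in>ball 0 \<rho>. \<exists>c. vfield_bracket (Y i) (Y j) x = (\<Sum>l\<in>UNIV. c l *\<^sub>R Y l x) \<and>
      (\<forall>l. w i + w j < w l \<longrightarrow> c l = 0)"
  proof
    fix x :: "(real, 'n) vec" assume "x \<in> ball 0 \<rho>"
    then obtain p where p: "p \<in> U \<inter> W" "x = \<kappa> p" by (rule ball_point)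
    from bracket_expand[OF True p(1)] show "\<exists>c. vfield_bracket (Y i) (Y j) x = (\<Sum>l\<in>UNIV. c l *\<^sub>R Y l x) \<and>
      (\<forall>l. w i + w j < w l \<longrightarrow> c l = 0)"
      using lie_bracket_expand[OF p(1)] p(2) by blast
  qed
  from bchoice[OF this] obtain c where
    c: "\<forall>x\<in>ball 0 \<rho>. vfield_bracket (Y i) (Y j) x = (\<Sum>l\<in>UNIV. c x l *\<^sub>R Y l x) \<and>
      (\<forall>l. w i + w j < w l \<longrightarrow> c x l = 0)" by blast
  show ?thesis
    unfolding structure_fun_eq[OF True] by (rule model_bracket_low[of _ _ c]) (use c in auto)
next
  \<comment> \<open>No weight reaches \<open>w i + w j\<close>, so the sum over such weights is
    empty.\<close>
  case False
  then have "w k < w i + w j" for k using weight_bounds(2)[of k] by linarith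
  moreover from this have "{l. w l = w i + w j} = {}" by (simp add: nat_less_le)
  ultimately show ?thesis using model_bracket_high by simp
qed

sublocale graded_algebra w model r "\<lambda>i j l. structure_fun A X i j l a"
  by unfold_locales (rule model_smooth model_scaling model_0 weight_bounds model_bracket_eq)+

lemma br_eq: "br = model_bracket A w X a"
  by (intro ext) (simp add: br_def model_bracket_def)

lemma left_field_eq: "left_invariant_vfield A w r X a = left_field"
  by (intro ext) (simp add: left_invariant_vfield_def left_field_def br_eq)

text \<open>A homogeneous \<open>\<psi>\<close> commutes with dilations, so changing coordinates
  commutes with rescaling. Existence and uniqueness of Carnot coordinates both use this formula as
  \<open>t\<close> tends to 0.\<close>

lemma rescaled_coord_vfield:
  assumes V: "open V" "V \<subseteq> U" and inj: "inj_on (\<psi> \<circ> \<kappa>) V" and \<psi>: "smooth_on (\<kappa> ` V) \<psi>"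
    and h: "w_homogeneous w \<psi>" and d: "\<psi> differentiable (at x)"
    and t: "t \<noteq> 0" "(t, x) \<in> dilation_dom \<rho>" "dilation w t x \<in> \<kappa> ` (V \<inter> W)"
  shows "t ^ w j *\<^sub>R dilation_pullback w t (coord_vfield (V, \<psi> \<circ> \<kappa>) (X j)) (\<psi> x) = FD \<psi> x (blowup j (t, x))"
  unfolding vec_eq_iff
proof
  fix k
  let ?y = "dilation w t x"
  have d': "\<psi> differentiable (at ?y)"
    by (rule smooth_on_differentiable[OF \<psi>]) (use t in auto)
  have "dilation w t (blowup j (t, x)) = t ^ w j *\<^sub>R Y j ?y"
    using blowup_eq[OF t(2)] by (simp add: vec_eq_iff)
  then have "t ^ w j *\<^sub>R FD \<psi> ?y (Y j ?y) = dilation w t (FD \<psi> x (blowup j (t, x)))"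
    using FD_homogeneous[OF h d d', of "blowup j (t, x)"] linear_scale[OF linear_frechet_derivative[OF d']]
    by simp
  moreover have "coord_vfield (V, \<psi> \<circ> \<kappa>) (X j) (dilation w t (\<psi> x)) = FD \<psi> ?y (Y j ?y)"
    using coord_vfield_comp[OF V inj \<psi> t(3)] h by (simp add: w_homogeneous_def)
  ultimately have "t ^ w j * coord_vfield (V, \<psi> \<circ> \<kappa>) (X j) (dilation w t (\<psi> x)) $ k =
      t ^ w k * FD \<psi> x (blowup j (t, x)) $ k"
    by (simp add: vec_eq_iff)
  then show "(t ^ w j *\<^sub>R dilation_pullback w t (coord_vfield (V, \<psi> \<circ> \<kappa>) (X j)) (\<psi> x)) $ k =
      FD \<psi> x (blowup j (t, x)) $ k"
    using t(1) by (simp add: dilation_pullback_def field_simps)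
qed

lemma converges_to_model_model: "converges_to_model w X (U, \<kappa>) j (model j)"
proof -
  have "smooth_limit (\<lambda>t x. t ^ w j *\<^sub>R dilation_pullback w t (Y j) x) (\<lambda>x. blowup j (0, x)) (at 0)"
  proof (rule smooth_limit_joint[OF open_dilation_dom zero_in_dilation_dom[OF \<rho>(1)] blowup_smooth])
    fix t x assume t: "(t, x) \<in> dilation_dom \<rho>" "t \<noteq> 0"
    have "t ^ w j * (inverse (t ^ w k) * Y j (dilation w t x) $ k) = blowup j (t, x) $ k" for k
      using blowup_eq[OF t(1), of k j] t(2) by (simp add: field_simps)
    then show "t ^ w j *\<^sub>R dilation_pullback w t (Y j) x = blowup j (t, x)"
      by (simp add: vec_eq_iff dilation_pullback_def)
  qed
  then show ?thesis unfolding converges_to_model_def model_def[abs_def] .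
qed

lemma model_vfield_eq: "model_vfield w X (U, \<kappa>) = model"
proof
  show "model_vfield w X (U, \<kappa>) j = model j" for j
    unfolding model_vfield_def
    by (rule the_equality, rule converges_to_model_model,
      rule converges_to_model_unique[OF _ converges_to_model_model])
qed

lemma chart_Log: "smooth_chart A (U, Log \<circ> \<kappa>)"
  by (rule smooth_chart_compose[OF atlas is_chart smooth_on_Log smooth_on_Exp Exp_Log Log_Exp])

lemma Log_0: "Log 0 = 0"
  using Log_Exp[of 0] by (simp add: Exp_0)

lemma privileged_Log: "privileged_coords A w X a (U, Log \<circ> \<kappa>)"
proof -
  have sL: "smooth_on S Log" for S by (rule smooth_on_subset[OF smooth_on_Log]) simp
  have inj: "inj_on (Log \<circ> \<kappa>) U"
    by (rule topological_chartD(2)[OF smooth_chartD(1)[OF chart_Log]])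
  have z: "0 \<in> \<kappa> ` (U \<inter> W)" using \<rho> by auto
  have "coord_vfield (U, Log \<circ> \<kappa>) (X j) 0 = axis j 1" for j
    using coord_vfield_comp[OF open_U order_refl inj sL z, of j] by (simp add: Log_0 Y_0 FD_Log_0)
  moreover have "has_order A w X a (\<lambda>q. (Log \<circ> \<kappa>) q $ k) (w k)" for k
  proof -
    have s: "smooth_on S (\<lambda>x. Log x $ k)" for S
      by (rule smooth_on_subset[OF smooth_on_vec_nth[OF open_UNIV smooth_on_Log]]) simp
    have w: "apply_word X I (\<lambda>q. (Log \<circ> \<kappa>) q $ k) a = word_deriv Y I (\<lambda>x. Log x $ k) 0" for I
      by (rule apply_word_at_a[OF s]) simp
    have "smooth_near A a (\<lambda>q. (Log \<circ> \<kappa>) q $ k)"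
      by (rule smooth_nearI[OF open_U order_refl a_in_U s]) simp
    moreover have "vanish (w k) (\<lambda>x. Log x $ k)"
      by (rule homogeneous_imp_vanish[OF s w_homogeneous_nth[OF Log_homogeneous]])
    \<comment> \<open>The order is exactly \<open>w k\<close>: the one-letter word
      \<open>[k]\<close> has this weight and sees the identity differential of \<open>Log\<close> at
      0.\<close>
    moreover have "word_deriv Y [k] (\<lambda>x. Log x $ k) 0 = 1"
      using FD_vec_nth[OF smooth_on_differentiable[OF smooth_on_Log UNIV_I], of k 0 "axis k 1"]
      by (simp add: Y_0 FD_Log_0)
    ultimately show ?thesis unfolding has_order_def w vanish_def
      by (intro conjI exI[of _ "[k]"]) auto
  qed
  ultimately show ?thesis unfolding privileged_coords_def
    using chart_Log a_in_U \<kappa>_a Log_0 by simp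
qed

lemma converges_Log: "converges_to_model w X (U, Log \<circ> \<kappa>) j (left_field j)"
proof -
  let ?m = "\<lambda>p::real \<times> (real, 'n) vec. (fst p, Exp (snd p))"
  define T where "T = ?m -` dilation_dom \<rho>"
  \<comment> \<open>\<open>rescaled_coord_vfield\<close> is used at the point \<open>Exp y\<close>,
    so that it describes the new field at \<open>y\<close>; the expansion in the standard basis
    makes joint smoothness visible.\<close>
  define Q where "Q = (\<lambda>p. \<Sum>k\<in>UNIV. blowup j (?m p) $ k *\<^sub>R FD Log (Exp (snd p)) (axis k 1))"
  have m: "smooth_on S ?m" if "open S" for S
    by (intro smooth_on_Pair smooth_on_fst smooth_on_id that
      smooth_on_compose[OF that open_UNIV smooth_on_snd[OF that smooth_on_id] smooth_on_Exp] UNIV_I)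
  have oT: "open T" unfolding T_def
    by (rule open_vimage[OF open_dilation_dom smooth_on_continuous[OF m]]) simp
  have "smooth_on T (\<lambda>p. Exp (snd p))"
    by (rule smooth_on_compose[OF oT open_UNIV smooth_on_snd[OF oT smooth_on_id] smooth_on_Exp]) simp
  then have "smooth_on T (\<lambda>p. FD Log (Exp (snd p)) (axis k 1))" for k
    by (rule smooth_on_compose[OF oT open_UNIV _ smooth_on_FD[OF smooth_on_Log]]) simp
  moreover have "smooth_on T (\<lambda>p. blowup j (?m p))"
    by (rule smooth_on_compose[OF oT open_dilation_dom m[OF oT] blowup_smooth]) (simp add: T_def)
  ultimately have Q: "smooth_on T Q" unfolding Q_def
    by (intro smooth_on_sum smooth_on_scaleR smooth_on_vec_nth oT)
  have Q_eq: "Q (t, y) = FD Log (Exp y) (blowup j (t, Exp y))" for t y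
    unfolding Q_def fst_conv snd_conv
    by (rule FD_linear_sum[OF smooth_on_differentiable[OF smooth_on_Log UNIV_I], symmetric])
  have "smooth_limit (\<lambda>t y. t ^ w j *\<^sub>R dilation_pullback w t (coord_vfield (U, Log \<circ> \<kappa>) (X j)) y)
      (\<lambda>y. Q (0, y)) (at 0)"
  proof (rule smooth_limit_joint[OF oT _ Q])
    show "(0, y) \<in> T" for y using zero_in_dilation_dom[OF \<rho>(1)] by (simp add: T_def)
    fix t y assume t: "(t, y) \<in> T" "t \<noteq> 0"
    have "t ^ w j *\<^sub>R dilation_pullback w t (coord_vfield (U, Log \<circ> \<kappa>) (X j)) (Log (Exp y)) =
        FD Log (Exp y) (blowup j (t, Exp y))"
    proof (rule rescaled_coord_vfield[OF open_U order_refl])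
      show "inj_on (Log \<circ> \<kappa>) U" by (rule topological_chartD(2)[OF smooth_chartD(1)[OF chart_Log]])
      show "smooth_on (\<kappa> ` U) Log" by (rule smooth_on_subset[OF smooth_on_Log]) simp
      show "(t, Exp y) \<in> dilation_dom \<rho>" using t by (simp add: T_def)
      then show "dilation w t (Exp y) \<in> \<kappa> ` (U \<inter> W)" using in_ball \<rho>(2) by blast
    qed (use t in \<open>auto intro: Log_homogeneous smooth_on_differentiable[OF smooth_on_Log]\<close>)
    then show "t ^ w j *\<^sub>R dilation_pullback w t (coord_vfield (U, Log \<circ> \<kappa>) (X j)) y = Q (t, y)"
      by (simp add: Log_Exp Q_eq)
  qed
  moreover have "(\<lambda>y. Q (0, y)) = left_field j"
    by (rule ext) (simp add: Q_eq model_def[symmetric] FD_Log_Z)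
  ultimately show ?thesis by (simp add: converges_to_model_def)
qed

lemma carnot_coords_Log: "carnot_coords A w r X a (U, Log \<circ> \<kappa>)"
  unfolding carnot_coords_def left_field_eq using privileged_Log converges_Log by simp

text \<open>Smoothness of \<open>\<psi>\<close> near 0 comes from the transition between the two
  charts, differentiability elsewhere from homogeneity. The rescaled field then has both
  \<open>FD \<psi> x (model j x)\<close> and \<open>left_field j (\<psi> x)\<close> as limits, which
  is the hypothesis of \<open>Log_unique\<close>.\<close>

lemma carnot_coords_unique:
  assumes h: "w_homogeneous w \<psi>" and V: "open V" "a \<in> V" "V \<subseteq> U"
    and c: "carnot_coords A w r X a (V, \<psi> \<circ> \<kappa>)"
  shows "\<psi> = Log"
proof -
  have sc: "smooth_chart A (V, \<psi> \<circ> \<kappa>)"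
    using c by (simp add: carnot_coords_def privileged_coords_def)
  have inj: "inj_on (\<psi> \<circ> \<kappa>) V" by (rule topological_chartD(2)[OF smooth_chartD(1)[OF sc]])
  have oV: "open (\<kappa> ` V)" by (rule open_\<kappa>[OF V(1,3)])
  have UV: "U \<inter> V = V" using V by auto
  have "smooth_on (\<kappa> ` V) (\<psi> \<circ> \<kappa> \<circ> inv_into U \<kappa>)"
    using smooth_on_transition[OF atlas is_chart sc] unfolding UV .
  moreover have "smooth_on (\<kappa> ` V) (\<psi> \<circ> \<kappa> \<circ> inv_into U \<kappa>) \<longleftrightarrow> smooth_on (\<kappa> ` V) \<psi>"
    by (rule smooth_on_cong[OF oV]) (use inv_\<kappa> V in auto)
  ultimately have s: "smooth_on (\<kappa> ` V) \<psi>" by simp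
  have zV: "0 \<in> \<kappa> ` (V \<inter> W)" using V(2) a_in_W \<kappa>_a by (metis IntI image_eqI)
  have d: "\<psi> differentiable (at x)" for x
    by (rule homogeneous_differentiable[OF h oV _ s]) (use zV in auto)
  have "FD \<psi> x (model j x) = left_field j (\<psi> x)" for j x
  proof -
    have "converges_to_model w X (V, \<psi> \<circ> \<kappa>) j (left_field j)"
      using c by (simp add: carnot_coords_def left_field_eq)
    then have 1: "((\<lambda>t. t ^ w j *\<^sub>R dilation_pullback w t (coord_vfield (V, \<psi> \<circ> \<kappa>) (X j)) (\<psi> x)) \<longlongrightarrow>
        left_field j (\<psi> x)) (at 0)"
      unfolding converges_to_model_def by (rule smooth_limit_tendsto)
    have "bounded_linear (FD \<psi> x)" using d[of x] by (simp add: frechet_derivative_works has_derivative_bounded_linear)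
    then have 2: "((\<lambda>t. FD \<psi> x (blowup j (t * 1, x))) \<longlongrightarrow> FD \<psi> x (model j x)) (at 0)"
      by (rule bounded_linear.tendsto[OF _ blowup_tendsto])
    have oVW: "open (\<kappa> ` (V \<inter> W))" using V open_W by (intro open_\<kappa>) auto
    have "\<forall>\<^sub>F t in at 0. dilation w t x \<in> \<kappa> ` (V \<inter> W)"
      by (rule topological_tendstoD[OF dilation_tendsto_0 oVW zV])
    moreover have "\<forall>\<^sub>F t in at (0::real). t \<noteq> 0" by (simp add: eventually_at_filter)
    ultimately have "\<forall>\<^sub>F t in at 0. FD \<psi> x (blowup j (t * 1, x)) =
        t ^ w j *\<^sub>R dilation_pullback w t (coord_vfield (V, \<psi> \<circ> \<kappa>) (X j)) (\<psi> x)"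
      using eventually_in_dilation_dom[OF \<rho>(1), of x]
    proof eventually_elim
      case (elim t)
      show ?case using rescaled_coord_vfield[OF V(1,3) inj s h d elim(2,3,1), of j] by simp
    qed
    from Lim_transform_eventually[OF 2 this] show ?thesis
      using tendsto_unique[OF _ _ 1] by simp
  qed
  moreover have "\<psi> 0 = 0" using h[unfolded w_homogeneous_def, rule_format, of 0 0] by simp
  ultimately show ?thesis using Log_unique[OF d] by simp
qed

lemma pushforward_unique:
  assumes h: "w_homogeneous w \<psi>" and d: "diffeomorphism \<psi>" and p: "\<And>j. pushforward \<psi> (model j) = left_field j"
  shows "\<psi> = Log"
proof (rule Log_unique)
  show "\<psi> differentiable (at x)" for x
    using d smooth_on_differentiable[of UNIV \<psi>] by (simp add: diffeomorphism_def)
  show "\<psi> 0 = 0" using h[unfolded w_homogeneous_def, rule_format, of 0 0] by simp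
  have "inv \<psi> (\<psi> x) = x" for x using d by (simp add: diffeomorphism_def bij_is_inj)
  then show "FD \<psi> x (model j x) = left_field j (\<psi> x)" for j x
    unfolding p[symmetric] by (simp add: pushforward_def)
qed

end

theorem theorem5p9:
  fixes A :: "('m::{t2_space,second_countable_topology}, 'n::{finite,linorder}) chart set"
    and r :: nat
    and H :: "nat \<Rightarrow> 'm \<Rightarrow> 'm tvec set"
    and a :: 'm
    and W U :: "'m set"
    and X :: "'n \<Rightarrow> 'm vfield"
    and \<kappa> :: "'m \<Rightarrow> (real, 'n) vec"
    and w :: "'n \<Rightarrow> nat"
    and Xm Xa :: "'n \<Rightarrow> (real, 'n) vec \<Rightarrow> (real, 'n) vec"
    and \<phi> :: "(real, 'n) vec \<Rightarrow> (real, 'n) vec"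
  assumes "carnot_manifold A r H"
    and "H_frame A H a W X"
    and "w = weights H"
    and "privileged_coords A w X a (U, \<kappa>)"
    and "Xm = model_vfield w X (U, \<kappa>)"
    and "Xa = left_invariant_vfield A w r X a"
    and "\<phi> = inv (exp_map Xm)"
  shows
    "(w_homogeneous w \<phi> \<and> polynomial_function \<phi> \<and> diffeomorphism \<phi> \<and>
        (\<forall>j. pushforward \<phi> (Xm j) = Xa j)) \<and>
     (\<forall>\<psi>. w_homogeneous w \<psi> \<and> polynomial_function \<psi> \<and> diffeomorphism \<psi> \<and>
        (\<forall>j. pushforward \<psi> (Xm j) = Xa j) \<longrightarrow> \<psi> = \<phi>) \<and>
     carnot_coords A w r X a (U, \<phi> \<circ> \<kappa>) \<and>
     (\<forall>\<psi> V. w_homogeneous w \<psi> \<and> open V \<and> a \<in> V \<and> V \<subseteq> U \<and>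
        carnot_coords A w r X a (V, \<psi> \<circ> \<kappa>) \<longrightarrow> \<psi> = \<phi>)"
proof -
  interpret carnot_chart A r H a W U X \<kappa> w
    by unfold_locales (fact assms)+
  have Xm: "Xm = model" using assms(5) model_vfield_eq by simp
  have Xa: "Xa = left_field" using assms(6) left_field_eq by simp
  have \<phi>: "\<phi> = Log" using assms(7) by (simp add: Xm exp_map_eq inv_Exp)
  show ?thesis
    unfolding Xm Xa \<phi>
    using Log_homogeneous polynomial_Log diffeomorphism_Log pushforward_Log carnot_coords_Log
      pushforward_unique carnot_coords_unique by blast
qed

end
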